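(* Let $f:\mathbb{R}^n\to\mathbb{R}$ be continuous and semi-algebraic, and fix $\bar x\in\mathbb{R}^n$. Then there is $\bar\epsilon>0$ such that for every $\epsilon\in(0,\bar\epsilon]$ the robust regularization $\bar f_\epsilon$ is Lipschitz at $\bar x$ and $\operatorname{calm}\bar f_\epsilon(\bar x)=\operatorname{lip}\bar f_\epsilon(\bar x)<\infty$; moreover $\epsilon\cdot\operatorname{lip}\bar f_\epsilon(\bar x)\to0$ as $\epsilon\downarrow0$ (i.e. the moduli are $o(1/\epsilon)$).
   Context: A function is semi-algebraic if its graph is a finite union of sets each defined by finitely many polynomial equalities and inequalities. $\bar f_\epsilon(x):=\max\{f(x'):|x'-x|\le\epsilon\}$. $\operatorname{calm}F(\bar x):=\limsup_{x\to\bar x,\,x\ne\bar x}\frac{|F(x)-F(\bar x)|}{|x-\bar x|}$, $\operatorname{lip}F(\bar x):=\limsup_{x,x'\to\bar x,\,x\ne x'}\frac{|F(x)-F(x')|}{|x-x'|}$; $F$ is Lipschitz at $\bar x$ if $\operatorname{lip}F(\bar x)<\infty$. *)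

theory Defs
  imports "HOL-Analysis.Analysis"
begin

inductive real_poly_fun :: "('a::euclidean_space \<Rightarrow> real) \<Rightarrow> bool" where
  const: "real_poly_fun (\<lambda>x. c)"
| coord: "b \<in> Basis \<Longrightarrow> real_poly_fun (\<lambda>x. x \<bullet> b)"
| add: "real_poly_fun p \<Longrightarrow> real_poly_fun q \<Longrightarrow> real_poly_fun (\<lambda>x. p x + q x)"
| mult: "real_poly_fun p \<Longrightarrow> real_poly_fun q \<Longrightarrow> real_poly_fun (\<lambda>x. p x * q x)"

definition basic_semialgebraic :: "'a::euclidean_space set \<Rightarrow> bool" where
  "basic_semialgebraic S \<longleftrightarrow>
     (\<exists>E L N. finite E \<and> finite L \<and> finite N \<and>
        (\<forall>p\<in>E. real_poly_fun p) \<and> (\<forall>p\<in>L. real_poly_fun p) \<and> (\<forall>p\<in>N. real_poly_fun p) \<and>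
        S = {x. (\<forall>p\<in>E. p x = 0) \<and> (\<forall>p\<in>L. p x < 0) \<and> (\<forall>p\<in>N. p x \<le> 0)})"

definition semialgebraic :: "'a::euclidean_space set \<Rightarrow> bool" where
  "semialgebraic S \<longleftrightarrow>
     (\<exists>\<F>. finite \<F> \<and> (\<forall>B\<in>\<F>. basic_semialgebraic B) \<and> S = \<Union>\<F>)"

definition semialgebraic_fun :: "('a::euclidean_space \<Rightarrow> real) \<Rightarrow> bool" where
  "semialgebraic_fun f \<longleftrightarrow> semialgebraic {(x, f x) | x. True}"

definition robust_reg :: "('a::metric_space \<Rightarrow> real) \<Rightarrow> real \<Rightarrow> 'a \<Rightarrow> real" where
  "robust_reg f eps x = Sup (f ` cball x eps)"

definition calm_mod :: "('a::real_normed_vector \<Rightarrow> real) \<Rightarrow> 'a \<Rightarrow> ereal" where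
  "calm_mod F xb = Limsup (at xb) (\<lambda>x. ereal (\<bar>F x - F xb\<bar> / norm (x - xb)))"

definition lip_mod :: "('a::real_normed_vector \<Rightarrow> real) \<Rightarrow> 'a \<Rightarrow> ereal" where
  "lip_mod F xb = Limsup (at (xb, xb) within {(x, x'). x \<noteq> x'})
      (\<lambda>(x, x'). ereal (\<bar>F x - F x'\<bar> / norm (x - x')))"

definition lipschitz_at :: "('a::real_normed_vector \<Rightarrow> real) \<Rightarrow> 'a \<Rightarrow> bool" where
  "lipschitz_at F xb \<longleftrightarrow> lip_mod F xb < \<infinity>"

end

theory Submission
  imports Defs "HOL-Computational_Algebra.Polynomial"
begin

text \<open>
Write \<open>G x r\<close> (\<open>ball_max f x r\<close> below) for the maximum of \<open>f\<close> over the ball of radius \<open>r\<close> around \<open>x\<close> and \<open>g r = G xb r\<close>. Then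
\<open>G x (r + s)\<close> is the maximum of \<open>G u r\<close> over the \<open>s\<close>-ball around \<open>x\<close>, so the right slope of \<open>g\<close> at \<open>r\<close> bounds
the calmness modulus of \<open>G _ r\<close> at \<open>xb\<close> from below, and it suffices to bound the Lipschitz modulus by this
slope. Everything is first-order definable over the real field, and by quantifier elimination a definable
property of \<open>r\<close> holds either for all small \<open>r > 0\<close> or for none. So if the bound fails for arbitrarily
small \<open>r\<close>, then on some interval of radii \<open>g\<close> has slope below \<open>\<alpha>\<close> while arbitrarily close to \<open>xb\<close>
there are points at which \<open>G _ r\<close> grows in \<open>r\<close> at rate at least \<open>\<beta> > \<alpha>\<close>. Select such a point \<open>z s t\<close>
definably for the radius \<open>s\<close> within distance \<open>t\<close> of \<open>xb\<close>. As \<open>t\<close> tends to 0 this selection tends to a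
constant, so on a smaller interval it moves with speed at most \<open>\<eta>\<close>, and \<open>s \<mapsto> G (z s t) s\<close> has slope at least
\<open>\<beta> (1 - \<eta>) > \<alpha>\<close>; its limit is \<open>g\<close>, a contradiction. The bound \<open>o(1/\<epsilon>)\<close> follows because a slope of
at least \<open>\<delta>/s\<close> near 0 would contradict the continuity of \<open>g\<close> at 0.
\<close>

section \<open>Quantifier elimination over the reals\<close>

text \<open>Quantifier elimination is done without syntax: a predicate is definable if finitely many
  polynomial signs decide it, and a witness of an existential statement is carried from one
  parameter to another by an order isomorphism of the line that matches all signs. The obstacle in
  the main argument is uniformity. A slope condition holds only for small \<open>h\<close>, with a
  threshold depending on \<open>s\<close> and \<open>t\<close>, and definable functions may jump, so
  limits in \<open>t\<close> and slopes in \<open>s\<close> cannot simply be interchanged. Therefore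
  the thresholds are replaced by inverse natural numbers, and the interval of radii is covered by
  countably many definable sets; one of them contains an interval, on which the threshold is
  uniform. The steep points also move with the radius. Moving the centre by
  \<open>\<eta> * h\<close> uses up that much of a radius gain \<open>h\<close>, which is where the
  factor \<open>1 - \<eta>\<close> comes from; \<eta> is chosen so that the remaining slope is the
  midpoint of \<alpha> and \<beta>.\<close>

lemma shift_point_iso:
  fixes a b z z' :: real
  assumes "a < z" "z < b" "a < z'" "z' < b"
  obtains \<psi> :: "real \<Rightarrow> real" where "strict_mono \<psi>" "surj \<psi>" "\<psi> z = z'"
    "\<And>y. y \<le> a \<or> b \<le> y \<Longrightarrow> \<psi> y = y"
proof -
  \<comment> \<open>Identity outside (a, b), affine on [a, z] and on [z, b]. Both points are
    arguments because swapping them gives the inverse map, which is how surjectivity is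
    obtained.\<close>
  define m where "m = (\<lambda>z z' y. if y \<le> a \<or> b \<le> y then y
      else if y \<le> z then a + (y - a) * ((z' - a) / (z - a))
      else b - (b - y) * ((b - z') / (b - z)))"
  have m_eq: "m z z' y = (if y \<le> a \<or> b \<le> y then y
      else if y \<le> z then a + (y - a) * ((z' - a) / (z - a))
      else b - (b - y) * ((b - z') / (b - z)))" for z z' y
    by (simp add: m_def)
  have mid1: "a < m z z' y \<and> m z z' y \<le> z'" if "a < y" "y \<le> z" "a < z" "z < b" "a < z'" "z' < b" for y z z'
  proof -
    have "(y - a) * ((z' - a) / (z - a)) \<le> (z - a) * ((z' - a) / (z - a))"
      using that by (intro mult_right_mono) auto
    also have "\<dots> = z' - a" using that by simp
    finally show ?thesis using that by (auto simp: m_eq)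
  qed
  have mid2: "z' < m z z' y \<and> m z z' y < b" if "z < y" "y < b" "a < z" "z < b" "a < z'" "z' < b" for y z z'
  proof -
    have "(b - y) * ((b - z') / (b - z)) < (b - z) * ((b - z') / (b - z))"
      using that by (intro mult_strict_right_mono) auto
    also have "\<dots> = b - z'" using that by simp
    finally show ?thesis using that by (auto simp: m_eq)
  qed
  have cancel: "c * (A / B) * (B / A) = c" if "A \<noteq> 0" "B \<noteq> 0" for A B c :: real
    using that by simp
  have inv: "m z' z (m z z' y) = y" if "a < z" "z < b" "a < z'" "z' < b" for z z' y
  proof -
    consider "y \<le> a \<or> b \<le> y" | "a < y" "y \<le> z" | "z < y" "y < b" by linarith
    then show ?thesis
    proof cases
      case 1 then show ?thesis by (auto simp: m_eq)
    next
      case 2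
      from mid1[OF 2 that] have e1: "m z' z (m z z' y) = a + (m z z' y - a) * ((z - a) / (z' - a))"
        using that by (auto simp: m_eq[of z' z])
      have e2: "m z z' y - a = (y - a) * ((z' - a) / (z - a))" using 2 that by (auto simp: m_eq)
      show ?thesis unfolding e1 e2 using cancel[of "z' - a" "z - a" "y - a"] that by simp
    next
      case 3
      from mid2[OF 3 that] have e1: "m z' z (m z z' y) = b - (b - m z z' y) * ((b - z) / (b - z'))"
        using that by (auto simp: m_eq[of z' z])
      have e2: "b - m z z' y = (b - y) * ((b - z') / (b - z))" using 3 that by (auto simp: m_eq)
      show ?thesis unfolding e1 e2 using cancel[of "b - z'" "b - z" "b - y"] that by simp
    qed
  qed
  have "m z z' x < m z z' y" if "x < y" for x y
  proof -
    consider "x \<le> a" | "a < x" "x \<le> z" | "z < x" "x < b" | "b \<le> x" by linarith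
    then show ?thesis
    proof cases
      case 1
      then have [simp]: "m z z' x = x" by (simp add: m_eq)
      consider "y \<le> a \<or> b \<le> y" | "a < y" "y \<le> z" | "z < y" "y < b" by linarith
      then show ?thesis
      proof cases
        case 1 then show ?thesis using \<open>x \<le> a\<close> that by (simp add: m_eq)
      next
        case 2 then show ?thesis using \<open>x \<le> a\<close> mid1[OF 2 assms] by simp
      next
        case 3 then show ?thesis using \<open>x \<le> a\<close> mid2[OF 3 assms] assms by simp
      qed
    next
      case 2
      consider "b \<le> y" | "y \<le> z" | "z < y" "y < b" by linarith
      then show ?thesis
      proof cases
        case 1 then show ?thesis using mid1[OF 2 assms] assms by (auto simp: m_eq[of z z' y])
      next
        case y: 2
        have "(x - a) * ((z' - a) / (z - a)) < (y - a) * ((z' - a) / (z - a))"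
          using that assms by (intro mult_strict_right_mono) auto
        then show ?thesis using 2 y that assms by (auto simp: m_eq)
      next
        case 3 then show ?thesis using mid1[OF 2 assms] mid2[OF 3 assms] by linarith
      qed
    next
      case 3
      show ?thesis
      proof (cases "b \<le> y")
        case True then show ?thesis using mid2[OF 3 assms] by (auto simp: m_eq[of z z' y])
      next
        case False
        have "(b - y) * ((b - z') / (b - z)) < (b - x) * ((b - z') / (b - z))"
          using that assms by (intro mult_strict_right_mono) auto
        then show ?thesis using 3 False that assms by (auto simp: m_eq)
      qed
    next
      case 4 then show ?thesis using that by (auto simp: m_eq)
    qed
  qed
  then have "strict_mono (m z z')" by (simp add: strict_mono_def)
  moreover have "surj (m z z')" using inv[OF assms(3,4,1,2)] by (metis surjI)
  moreover have "m z z' z = z'" using assms by (auto simp: m_eq)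
  moreover have "m z z' y = y" if "y \<le> a \<or> b \<le> y" for y using that by (auto simp: m_eq)
  ultimately show thesis using that by blast
qed

lemma continuous_on_strict_mono_surj:
  fixes \<psi> :: "real \<Rightarrow> real"
  assumes "strict_mono \<psi>" "surj \<psi>"
  shows "continuous_on S \<psi>"
proof -
  have "continuous_on UNIV \<psi>"
    using assms by (intro continuous_onI_mono) (auto simp: strict_mono_less_eq)
  then show ?thesis by (rule continuous_on_subset) simp
qed

text \<open>The factor \<open>s\<close> is the common direction: both functions increase or both
  decrease. Strictness leaves each of them at most one zero on \<open>S\<close>.\<close>

definition comonotone_on :: "real set \<Rightarrow> (real \<Rightarrow> real) \<Rightarrow> (real \<Rightarrow> real) \<Rightarrow> bool" where
  "comonotone_on S p r \<longleftrightarrow> (\<exists>s\<in>{-1,1}. strict_mono_on S (\<lambda>y. s * p y) \<and> strict_mono_on S (\<lambda>y. s * r y))"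

text \<open>Roots of \<open>p\<close> that \<open>r\<close> does not share are moved onto roots of \<open>r\<close> one at a time.\<close>

lemma sign_matching_iso:
  fixes p r :: "real \<Rightarrow> real"
  assumes p: "continuous_on UNIV p" and r: "continuous_on UNIV r"
    and Y: "finite Y" and sY: "\<And>y. y \<in> Y \<Longrightarrow> sgn (p y) = sgn (r y)"
    and ends: "\<And>y. y \<le> A \<or> B \<le> y \<Longrightarrow> sgn (p y) = sgn (r y)"
    and mono: "\<And>l u. l < u \<Longrightarrow> {l<..<u} \<inter> Y = {} \<Longrightarrow> comonotone_on {l..u} p r"
    and fin: "finite {z. p z = 0}"
  shows "\<exists>\<psi>. strict_mono \<psi> \<and> surj \<psi> \<and> (\<forall>w\<in>Y. \<psi> w = w) \<and> (\<forall>y. sgn (p y) = sgn (r (\<psi> y)))"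
  using r sY ends mono
\<comment> \<open>The measure counts the zeros of \<open>p\<close> that are not zeros of
  \<open>r\<close>. The bounds \<open>A\<close> and \<open>B\<close> vary too, since moving a root
  enlarges the region where \<open>r\<close> is altered.\<close>
proof (induction "card {z. p z = 0 \<and> r z \<noteq> 0}" arbitrary: r A B rule: less_induct)
  case less
  \<comment> \<open>\<open>l\<close> and \<open>u\<close> are the neighbours of \<open>y\<close>
    among the points of \<open>Y\<close> and the bounds \<open>A\<close>, \<open>B\<close>, where
    the signs are known to agree.\<close>
  have cell: "\<exists>l u. l < y \<and> y < u \<and> {l<..<u} \<inter> Y = {} \<and> sgn (p l) = sgn (r l) \<and> sgn (p u) = sgn (r u)"
    if "y \<notin> Y" "A < y" "y < B" for y
  proof -
    define l where "l = Max (insert A {w\<in>Y. w < y})"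
    define u where "u = Min (insert B {w\<in>Y. y < w})"
    have fl: "finite (insert A {w\<in>Y. w < y})" and fu: "finite (insert B {w\<in>Y. y < w})" using Y by auto
    have "l \<in> insert A {w\<in>Y. w < y}" unfolding l_def by (rule Max_in[OF fl]) simp
    then have 1: "l < y" "sgn (p l) = sgn (r l)" using that less.prems(2,3) by auto
    have "u \<in> insert B {w\<in>Y. y < w}" unfolding u_def by (rule Min_in[OF fu]) simp
    then have 2: "y < u" "sgn (p u) = sgn (r u)" using that less.prems(2,3) by auto
    have "w \<notin> {l<..<u}" if wY: "w \<in> Y" for w
    proof
      assume w: "w \<in> {l<..<u}"
      consider "w < y" | "y < w" using \<open>y \<notin> Y\<close> wY by fastforce
      then show False
      proof cases
        case 1 then have "w \<le> l" unfolding l_def using wY by (intro Max_ge[OF fl]) auto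
        then show False using w by simp
      next
        case 2 then have "u \<le> w" unfolding u_def using wY by (intro Min_le[OF fu]) auto
        then show False using w by simp
      qed
    qed
    with 1 2 show ?thesis by blast
  qed
  have ivt: "\<exists>x. l < x \<and> x < u \<and> h x = 0"
    if "l < u" "continuous_on UNIV h" "sgn (h l) * sgn (h u) = -1" for l u and h :: "real \<Rightarrow> real"
  proof -
    have c: "continuous_on {l..u} h" by (rule continuous_on_subset[OF that(2)]) simp
    have "\<exists>x. l \<le> x \<and> x \<le> u \<and> h x = 0"
    proof (cases "h l < 0")
      case True
      then have "h u > 0" using that(3) by (auto simp: sgn_if split: if_splits)
      then show ?thesis using IVT'[of h l 0 u] that c True by auto
    next
      case False
      then have "h l > 0" "h u < 0" using that(3) by (auto simp: sgn_if split: if_splits)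
      then show ?thesis using IVT2'[of h u 0 l] that c by auto
    qed
    then obtain x where x: "l \<le> x" "x \<le> u" "h x = 0" by blast
    moreover have "x \<noteq> l" "x \<noteq> u" using x that(3) by auto
    ultimately show ?thesis by force
  qed
  show ?case
  proof (cases "{z. p z = 0 \<and> r z \<noteq> 0} = {}")
    case True
    \<comment> \<open>With every zero of \<open>p\<close> shared, the identity works: a mismatch at
      \<open>y\<close> would force a zero of \<open>p\<close> between \<open>y\<close> and an end of
      the cell; \<open>r\<close> vanishes there too, and its strict monotonicity then gives
      \<open>r y\<close> the right sign.\<close>
    have "sgn (p y) = sgn (r y)" for y
    proof (cases "y \<in> Y \<or> y \<le> A \<or> B \<le> y \<or> p y = 0")
      case True
      then show ?thesis using less.prems(2,3) \<open>{z. p z = 0 \<and> r z \<noteq> 0} = {}\<close> by auto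
    next
      case False
      then obtain l u where lu: "l < y" "y < u" "{l<..<u} \<inter> Y = {}" "sgn (p l) = sgn (r l)" "sgn (p u) = sgn (r u)"
        using cell[of y] by auto
      obtain s where s: "s \<in> {-1,1}" "strict_mono_on {l..u} (\<lambda>y. s * p y)" "strict_mono_on {l..u} (\<lambda>y. s * r y)"
        using less.prems(4)[of l u] lu unfolding comonotone_on_def by (meson order.strict_trans)
      have pm: "s * p a < s * p b" and rm: "s * r a < s * r b" if "l \<le> a" "a < b" "b \<le> u" for a b
        using s(2,3) that by (auto simp: strict_mono_on_def)
      have sp: "sgn (s * p x) = s * sgn (p x)" "sgn (s * r x) = s * sgn (r x)" for x
        using s(1) by (auto simp: sgn_minus)
      have rz: "r z = 0" if "p z = 0" for z using that True by auto
      have "sgn (s * p y) = sgn (s * r y)"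
      proof (cases "s * p y > 0")
        case pos: True
        have "s * r y > 0"
        proof (rule ccontr)
          assume "\<not> s * r y > 0"
          then have "s * r l < 0" using rm[of l y] lu by auto
          then have "s * p l < 0" using lu(4) sp[of l] by (metis sgn_less)
          then have "sgn (p l) * sgn (p y) = -1" using pos s(1) by (auto simp: sgn_if)
          then obtain z where z: "l < z" "z < y" "p z = 0" using ivt[of l y p] lu p by auto
          then show False using rz[of z] rm[of z y] lu \<open>\<not> s * r y > 0\<close> by auto
        qed
        with pos show ?thesis by simp
      next
        case nonpos: False
        then have neg: "s * p y < 0" using False s(1) by auto
        have "s * r y < 0"
        proof (rule ccontr)
          assume "\<not> s * r y < 0"
          then have "s * r u > 0" using rm[of y u] lu by auto
          then have "s * p u > 0" using lu(5) sp[of u] by (metis sgn_greater)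
          then have "sgn (p y) * sgn (p u) = -1" using neg s(1) by (auto simp: sgn_if)
          then obtain z where z: "y < z" "z < u" "p z = 0" using ivt[of y u p] lu p by auto
          then show False using rz[of z] rm[of y z] lu \<open>\<not> s * r y < 0\<close> by auto
        qed
        with neg show ?thesis by simp
      qed
      then show ?thesis using sp[of y] s(1) by auto
    qed
    then show ?thesis by (intro exI[of _ "\<lambda>x. x"]) (auto simp: strict_mono_def)
  next
    case False
    then obtain z where z: "p z = 0" "r z \<noteq> 0" by auto
    then have zY: "z \<notin> Y" "A < z" "z < B"
      using less.prems(2)[of z] less.prems(3)[of z] by (auto simp: sgn_zero_iff not_le[symmetric] sgn_0_0)
    then obtain l u where lu: "l < z" "z < u" "{l<..<u} \<inter> Y = {}" "sgn (p l) = sgn (r l)" "sgn (p u) = sgn (r u)"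
      using cell[of z] by auto
    obtain s where s: "s \<in> {-1,1}" "strict_mono_on {l..u} (\<lambda>y. s * p y)" "strict_mono_on {l..u} (\<lambda>y. s * r y)"
      using less.prems(4)[of l u] lu unfolding comonotone_on_def by (meson order.strict_trans)
    have pm: "s * p a < s * p b" if "l \<le> a" "a < b" "b \<le> u" for a b
      using s(2) that by (auto simp: strict_mono_on_def)
    have "s * p l < 0" "s * p u > 0" using pm[of l z] pm[of z u] lu z by auto
    then have "sgn (p l) * sgn (p u) = -1" using s(1) by (auto simp: sgn_if)
    then have "sgn (r l) * sgn (r u) = -1" using lu by simp
    then obtain z' where z': "l < z'" "z' < u" "r z' = 0" using ivt[of l u r] lu less.prems(1) by auto
    \<comment> \<open>The midpoints keep the moved stretch strictly inside the cell, so the points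
      of \<open>Y\<close> stay fixed. On the cell \<open>z\<close> is the only zero of
      \<open>p\<close>, so no matched zero is lost.\<close>
    define a where "a = (l + min z z') / 2"
    define b where "b = (u + max z z') / 2"
    have ab: "l < a" "a < z" "a < z'" "z < b" "z' < b" "b < u" using lu z' by (auto simp: a_def b_def min_def max_def)
    obtain \<psi> where \<psi>: "strict_mono \<psi>" "surj \<psi>" "\<psi> z = z'" "\<And>y. y \<le> a \<or> b \<le> y \<Longrightarrow> \<psi> y = y"
      using shift_point_iso[of a z b z'] ab by metis
    have fixY: "\<psi> w = w" if "w \<in> Y" for w
    proof -
      have "w \<notin> {l<..<u}" using that lu(3) by blast
      then have "w \<le> a \<or> b \<le> w" using ab by auto
      then show ?thesis by (rule \<psi>(4))
    qed
    let ?r = "\<lambda>y. r (\<psi> y)"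
    have sub: "{z. p z = 0 \<and> ?r z \<noteq> 0} \<subset> {z. p z = 0 \<and> r z \<noteq> 0}"
    proof (rule psubsetI)
      show "{z. p z = 0 \<and> ?r z \<noteq> 0} \<subseteq> {z. p z = 0 \<and> r z \<noteq> 0}"
      proof clarify
        fix w assume w: "p w = 0" "r (\<psi> w) \<noteq> 0" "r w = 0"
        then have "w \<noteq> z" using z by auto
        have "\<not> (l \<le> w \<and> w \<le> u)"
          using pm[of w z] pm[of z w] w(1) z(1) lu \<open>w \<noteq> z\<close> by (cases "w < z") auto
        then have "\<psi> w = w" using \<psi>(4)[of w] ab by linarith
        then show False using w by simp
      qed
      show "{z. p z = 0 \<and> ?r z \<noteq> 0} \<noteq> {z. p z = 0 \<and> r z \<noteq> 0}"
        using z z'(3) \<psi>(3) by auto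
    qed
    have "\<exists>\<psi>'. strict_mono \<psi>' \<and> surj \<psi>' \<and> (\<forall>w\<in>Y. \<psi>' w = w) \<and> (\<forall>y. sgn (p y) = sgn (?r (\<psi>' y)))"
    proof (rule less.hyps[where A = "min A a" and B = "max B b"])
      show "card {z. p z = 0 \<and> ?r z \<noteq> 0} < card {z. p z = 0 \<and> r z \<noteq> 0}"
        using sub by (rule psubset_card_mono[rotated]) (rule finite_subset[OF _ fin], auto)
      show "continuous_on UNIV ?r"
        using continuous_on_compose2[OF less.prems(1) continuous_on_strict_mono_surj[OF \<psi>(1,2)]] by simp
      show "sgn (p y) = sgn (?r y)" if "y \<in> Y" for y using fixY less.prems(2) that by simp
      show "sgn (p y) = sgn (?r y)" if "y \<le> min A a \<or> max B b \<le> y" for y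
        using \<psi>(4)[of y] less.prems(3)[of y] that by auto
      show "comonotone_on {l'..u'} p ?r" if lu': "l' < u'" "{l'<..<u'} \<inter> Y = {}" for l' u'
      proof -
        \<comment> \<open>One direction must serve \<open>p\<close> on the interval and
          \<open>r\<close> on its image, so monotonicity is taken on the hull of both. The hull has
          no point of \<open>Y\<close> in its interior because \<open>\<psi>\<close> fixes
          \<open>Y\<close>.\<close>
        let ?l = "min l' (\<psi> l')" and ?u = "max u' (\<psi> u')"
        have "w \<notin> {?l<..<?u}" if w: "w \<in> Y" for w
        proof -
          have "w \<notin> {l'<..<u'}" using lu'(2) w by blast
          then have "w \<le> l' \<or> u' \<le> w" by auto
          moreover have "w \<le> \<psi> l'" if "w \<le> l'"
            using strict_mono_less_eq[OF \<psi>(1), of w l'] that fixY[OF w] by simp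
          moreover have "\<psi> u' \<le> w" if "u' \<le> w"
            using strict_mono_less_eq[OF \<psi>(1), of u' w] that fixY[OF w] by simp
          ultimately show ?thesis by auto
        qed
        then have "comonotone_on {?l..?u} p r" using lu'(1) by (intro less.prems(4)) auto
        then obtain t where t: "t \<in> {-1,1}" "strict_mono_on {?l..?u} (\<lambda>y. t * p y)"
            "strict_mono_on {?l..?u} (\<lambda>y. t * r y)"
          unfolding comonotone_on_def by blast
        have "strict_mono_on {l'..u'} (\<lambda>y. t * p y)"
          by (rule strict_mono_onI, rule strict_mono_onD[OF t(2)]) auto
        moreover have "strict_mono_on {l'..u'} (\<lambda>y. t * ?r y)"
        proof (rule strict_mono_onI)
          fix x y assume xy: "x \<in> {l'..u'}" "y \<in> {l'..u'}" "x < y"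
          then have "\<psi> l' \<le> \<psi> x" "\<psi> x < \<psi> y" "\<psi> y \<le> \<psi> u'"
            using \<psi>(1) by (auto simp: strict_mono_less_eq strict_mono_less)
          then show "t * ?r x < t * ?r y" by (intro strict_mono_onD[OF t(3)]) auto
        qed
        ultimately show ?thesis using t(1) unfolding comonotone_on_def by auto
      qed
    qed
    then obtain \<psi>' where \<psi>': "strict_mono \<psi>'" "surj \<psi>'" "\<forall>w\<in>Y. \<psi>' w = w" "\<forall>y. sgn (p y) = sgn (?r (\<psi>' y))" by blast
    have "surj (\<lambda>y. \<psi> (\<psi>' y))" using comp_surj[OF \<psi>'(2) \<psi>(2)] by (simp add: comp_def)
    then show ?thesis
      using \<psi>' \<psi>(1) fixY by (intro exI[of _ "\<lambda>y. \<psi> (\<psi>' y)"]) (simp add: strict_mono_def)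
  qed
qed

section \<open>Signs of real polynomials in one variable\<close>

text \<open>The quotient by \<open>x ^ degree p\<close> tends to the leading coefficient
  \<open>L\<close>; a further factor \<open>L\<close> makes the limit positive whatever its sign.
  The power of \<open>sgn x\<close> treats both ends of the line at once.\<close>

lemma poly_sgn_at_infinity:
  fixes p :: "real poly"
  assumes "p \<noteq> 0"
  shows "\<exists>R>0. \<forall>x. R \<le> \<bar>x\<bar> \<longrightarrow> sgn (poly p x) = sgn (lead_coeff p) * sgn x ^ degree p"
proof -
  define L where "L = lead_coeff p"
  have L0: "L \<noteq> 0" using assms by (simp add: L_def)
  have "((\<lambda>x. L * (poly p x / x ^ degree p)) \<longlongrightarrow> L * L) at_infinity"
    unfolding L_def by (intro tendsto_mult_left poly_divide_tendsto_aux)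
  moreover have "0 < L * L" using L0 by (auto simp: zero_less_mult_iff)
  ultimately have "\<forall>\<^sub>F x in at_infinity. 0 < L * (poly p x / x ^ degree p)"
    by (rule order_tendstoD(1))
  then obtain R where R: "\<And>x. R \<le> \<bar>x\<bar> \<Longrightarrow> 0 < L * (poly p x / x ^ degree p)"
    unfolding eventually_at_infinity by auto
  have "sgn (poly p x) = sgn L * sgn x ^ degree p" if "max R 1 \<le> \<bar>x\<bar>" for x
  proof -
    define u where "u = sgn x ^ degree p"
    have "x \<noteq> 0" using that by auto
    then have "\<bar>u\<bar> = 1" by (simp add: u_def power_abs abs_sgn_eq)
    then have u: "u \<noteq> 0" by auto
    have "0 < L * (poly p x / x ^ degree p)" using R that by simp
    then have "sgn (L * (poly p x / x ^ degree p)) = 1" by (rule sgn_pos)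
    then have "sgn L * (sgn (poly p x) / u) = 1"
      by (simp only: sgn_mult sgn_divide u_def power_sgn)
    then have "sgn L * sgn (poly p x) = u" using u by (simp add: field_simps)
    then have "(sgn L * sgn L) * sgn (poly p x) = sgn L * u" by (simp only: mult.assoc)
    moreover have "sgn L * sgn L = 1" using L0 by (auto simp: sgn_if)
    ultimately show ?thesis by (simp add: u_def)
  qed
  then show ?thesis unfolding L_def by (intro exI[of _ "max R 1"]) auto
qed

lemma poly_no_root_sgn:
  fixes p :: "real poly"
  assumes "\<And>w. min a b \<le> w \<Longrightarrow> w \<le> max a b \<Longrightarrow> poly p w \<noteq> 0"
  shows "sgn (poly p a) = sgn (poly p b)"
proof (rule ccontr)
  assume neq: "sgn (poly p a) \<noteq> sgn (poly p b)"
  then have "a \<noteq> b" by auto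
  have "poly p a \<noteq> 0" "poly p b \<noteq> 0" using assms[of a] assms[of b] by auto
  with neq have "poly p a * poly p b < 0" by (auto simp: sgn_if mult_less_0_iff split: if_splits)
  then have "poly p (min a b) * poly p (max a b) < 0" by (auto simp: min_def max_def mult.commute)
  then obtain x where "x > min a b" "x < max a b" "poly p x = 0"
    using poly_IVT[of "min a b" "max a b" p] \<open>a \<noteq> b\<close> by (auto simp: min_def max_def split: if_splits)
  then show False using assms[of x] by auto
qed

text \<open>Since the derivatives are paired in \<open>K\<close>, between consecutive roots of
  members of \<open>K\<close> the functions \<open>p\<close> and \<open>q o \<phi>\<close> are
  monotone in the same direction. Their signs agree at these roots by assumption and far out by
  degree and leading coefficient, so \<open>sign_matching_iso\<close> supplies a correction
  \<open>\<psi>\<close>; it fixes the roots, hence \<open>\<phi> o \<psi>\<close> still matches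
  \<open>K\<close>.\<close>

lemma sign_iso_extend:
  fixes p q :: "real poly"
  assumes K: "finite K" and \<phi>: "strict_mono \<phi>" "surj \<phi>"
    and sK: "\<And>P Q y. (P, Q) \<in> K \<Longrightarrow> sgn (poly P y) = sgn (poly Q (\<phi> y))"
    and der: "(pderiv p, pderiv q) \<in> K"
    and deg: "degree p = degree q" "degree p > 0"
    and lead: "sgn (lead_coeff p) = sgn (lead_coeff q)"
    and roots: "\<And>P Q y. (P, Q) \<in> K \<Longrightarrow> P \<noteq> 0 \<Longrightarrow> poly P y = 0 \<Longrightarrow> sgn (poly p y) = sgn (poly q (\<phi> y))"
  shows "\<exists>\<phi>. strict_mono \<phi> \<and> surj \<phi> \<and>
    (\<forall>(P, Q)\<in>insert (p, q) K. \<forall>y. sgn (poly P y) = sgn (poly Q (\<phi> y)))"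
proof -
  \<comment> \<open>The zero polynomial is excluded: its roots would make \<open>Y\<close>
    infinite.\<close>
  define Y where "Y = (\<Union>P\<in>fst ` K - {0}. {y. poly P y = 0})"
  have Y: "finite Y" unfolding Y_def using K by (auto intro: poly_roots_finite)
  have YI: "y \<in> Y" if "(P, Q) \<in> K" "P \<noteq> 0" "poly P y = 0" for P Q y
    unfolding Y_def using that by (intro UN_I[of P]) (auto intro: image_eqI[of _ fst "(P, Q)"])
  have c\<phi>: "continuous_on UNIV \<phi>" using \<phi> by (rule continuous_on_strict_mono_surj)
  have pq0: "p \<noteq> 0" "q \<noteq> 0" using deg by auto
  obtain R where R: "R > 0" "\<And>x. R \<le> \<bar>x\<bar> \<Longrightarrow> sgn (poly p x) = sgn (lead_coeff p) * sgn x ^ degree p"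
    using poly_sgn_at_infinity[OF pq0(1)] by blast
  obtain R' where R': "R' > 0" "\<And>x. R' \<le> \<bar>x\<bar> \<Longrightarrow> sgn (poly q x) = sgn (lead_coeff q) * sgn x ^ degree q"
    using poly_sgn_at_infinity[OF pq0(2)] by blast
  \<comment> \<open>\<open>q\<close> is evaluated at \<open>\<phi> y\<close>, so the bound for its
    argument is pulled back through \<open>\<phi>\<close>.\<close>
  obtain A' B' where AB: "\<phi> A' = - R'" "\<phi> B' = R'" using \<phi>(2) by (metis surjD)
  have pd0: "pderiv p \<noteq> 0" using deg by (simp add: pderiv_eq_0_iff)
  have "\<exists>\<psi>. strict_mono \<psi> \<and> surj \<psi> \<and> (\<forall>w\<in>Y. \<psi> w = w) \<and> (\<forall>y. sgn (poly p y) = sgn (poly q (\<phi> (\<psi> y))))"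
  proof (rule sign_matching_iso[where p = "poly p" and r = "\<lambda>y. poly q (\<phi> y)" and A = "min A' (-R)" and B = "max B' R"])
    show "continuous_on UNIV (poly p)" by (intro continuous_intros)
    show "continuous_on UNIV (\<lambda>y. poly q (\<phi> y))" by (intro continuous_intros c\<phi>)
    show "finite Y" by (rule Y)
    show "finite {z. poly p z = 0}" using pq0 by (rule_tac poly_roots_finite)
    show "sgn (poly p y) = sgn (poly q (\<phi> y))" if yY: "y \<in> Y" for y
    proof -
      obtain P where P: "P \<in> fst ` K" "P \<noteq> 0" "poly P y = 0" using yY unfolding Y_def by blast
      then obtain Q where "(P, Q) \<in> K" by force
      then show ?thesis using P by (intro roots)
    qed
    show "sgn (poly p y) = sgn (poly q (\<phi> y))" if y: "y \<le> min A' (-R) \<or> max B' R \<le> y" for y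
    proof (cases "y \<le> min A' (-R)")
      case True
      then have "\<phi> y \<le> - R'" using strict_mono_less_eq[OF \<phi>(1), of y A'] AB by simp
      with True R(2)[of y] R'(2)[of "\<phi> y"] R(1) R'(1) deg lead show ?thesis by simp
    next
      case False
      then have "R' \<le> \<phi> y" "R \<le> y" using y strict_mono_less_eq[OF \<phi>(1), of B' y] AB by auto
      with R(2)[of y] R'(2)[of "\<phi> y"] R(1) R'(1) deg lead show ?thesis by simp
    qed
    show "comonotone_on {l..u} (poly p) (\<lambda>y. poly q (\<phi> y))" if lu: "l < u" "{l<..<u} \<inter> Y = {}" for l u
    proof -
      define m where "m = (l + u) / 2"
      have m: "l < m" "m < u" using lu by (auto simp: m_def)
      define s where "s = sgn (poly (pderiv p) m)"
      have nz: "poly (pderiv p) x \<noteq> 0" if "l < x" "x < u" for x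
        using YI[OF der pd0] that lu(2) by auto
      have s: "s \<in> {-1, 1}" using nz[OF m] by (auto simp: s_def sgn_if)
      have sp: "sgn (poly (pderiv p) x) = s" if "l < x" "x < u" for x
        unfolding s_def using that m nz by (intro poly_no_root_sgn) auto
      have "s * poly p a < s * poly p b" if "a \<in> {l..u}" "b \<in> {l..u}" "a < b" for a b
      proof (rule DERIV_pos_imp_increasing_open[OF \<open>a < b\<close>, of "\<lambda>x. s * poly p x"])
        fix x assume "a < x" "x < b"
        then have "sgn (poly (pderiv p) x) = s" using sp that by auto
        then have "s * poly (pderiv p) x > 0" using s by (auto simp: sgn_if split: if_splits)
        then show "\<exists>y. ((\<lambda>x. s * poly p x) has_real_derivative y) (at x) \<and> 0 < y"
          by (intro exI[of _ "s * poly (pderiv p) x"]) (auto intro!: derivative_eq_intros)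
      qed (intro continuous_intros)
      moreover have "s * poly q (\<phi> a) < s * poly q (\<phi> b)" if "a \<in> {l..u}" "b \<in> {l..u}" "a < b" for a b
      proof (rule DERIV_pos_imp_increasing_open[of "\<phi> a" "\<phi> b" "\<lambda>x. s * poly q x"])
        show "\<phi> a < \<phi> b" using \<phi>(1) that by (simp add: strict_mono_less)
        fix x assume x: "\<phi> a < x" "x < \<phi> b"
        obtain w where w: "x = \<phi> w" using \<phi>(2) by (metis surjD)
        then have "a < w" "w < b" using x \<phi>(1) by (auto simp: strict_mono_less)
        then have "sgn (poly (pderiv p) w) = s" using sp that by auto
        then have "sgn (poly (pderiv q) x) = s" using sK[OF der, of w] w by simp
        then have "s * poly (pderiv q) x > 0" using s by (auto simp: sgn_if split: if_splits)
        then show "\<exists>y. ((\<lambda>x. s * poly q x) has_real_derivative y) (at x) \<and> 0 < y"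
          by (intro exI[of _ "s * poly (pderiv q) x"]) (auto intro!: derivative_eq_intros)
      qed (intro continuous_intros)
      ultimately show ?thesis using s unfolding comonotone_on_def strict_mono_on_def by blast
    qed
  qed
  then obtain \<psi> where \<psi>: "strict_mono \<psi>" "surj \<psi>" "\<And>w. w \<in> Y \<Longrightarrow> \<psi> w = w"
    "\<And>y. sgn (poly p y) = sgn (poly q (\<phi> (\<psi> y)))" by blast
  have "sgn (poly P y) = sgn (poly Q (\<phi> (\<psi> y)))" if PQ: "(P, Q) \<in> K" for P Q y
  proof -
    \<comment> \<open>A root of \<open>P\<close> between \<open>y\<close> and
      \<open>\<psi> y\<close> would be fixed by \<open>\<psi>\<close>, against monotonicity; so
      \<open>\<psi>\<close> carries no point across a root of \<open>P\<close>.\<close>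
    have "sgn (poly P y) = sgn (poly P (\<psi> y))"
    proof (cases "P = 0 \<or> poly P y = 0")
      case True
      then show ?thesis using YI[OF PQ, of y] \<psi>(3)[of y] by (cases "P = 0") auto
    next
      case False
      have "poly P w \<noteq> 0" if w: "min y (\<psi> y) \<le> w" "w \<le> max y (\<psi> y)" for w
      proof
        assume "poly P w = 0"
        then have "\<psi> w = w" using False YI[OF PQ] \<psi>(3) by blast
        moreover have "w \<noteq> y" using False \<open>poly P w = 0\<close> by auto
        ultimately show False using w strict_mono_less[OF \<psi>(1), of y w] strict_mono_less[OF \<psi>(1), of w y]
          by (auto simp: min_def max_def split: if_splits)
      qed
      then show ?thesis by (rule poly_no_root_sgn)
    qed
    also have "\<dots> = sgn (poly Q (\<phi> (\<psi> y)))" by (rule sK[OF PQ])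
    finally show ?thesis .
  qed
  moreover have "surj (\<lambda>y. \<phi> (\<psi> y))" using comp_surj[OF \<psi>(2) \<phi>(2)] by (simp add: comp_def)
  ultimately show ?thesis using \<psi>(1,4) \<phi>(1)
    by (intro exI[of _ "\<lambda>y. \<phi> (\<psi> y)"]) (auto simp: strict_mono_def)
qed

section \<open>Polynomials in one variable with polynomial coefficients\<close>

lemma real_poly_fun_uminus: "real_poly_fun p \<Longrightarrow> real_poly_fun (\<lambda>x. - p x)"
  using real_poly_fun.mult[OF real_poly_fun.const[of "-1"]] by simp

lemma real_poly_fun_diff: "real_poly_fun p \<Longrightarrow> real_poly_fun q \<Longrightarrow> real_poly_fun (\<lambda>x. p x - q x)"
  using real_poly_fun.add[OF _ real_poly_fun_uminus] by fastforce

lemma real_poly_fun_sum: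
  "finite I \<Longrightarrow> (\<And>i. i \<in> I \<Longrightarrow> real_poly_fun (p i)) \<Longrightarrow> real_poly_fun (\<lambda>x. \<Sum>i\<in>I. p i x)"
  by (induction rule: finite_induct) (auto intro: real_poly_fun.intros)

text \<open>A polynomial in a distinguished variable whose coefficients are polynomials in
  \<open>x\<close>. Only the degree bound is uniform: the actual degree drops where a leading
  coefficient vanishes, which forces the case splits below.\<close>

definition param_poly :: "('a::euclidean_space \<Rightarrow> real poly) \<Rightarrow> bool" where
  "param_poly p \<longleftrightarrow> (\<forall>i. real_poly_fun (\<lambda>x. coeff (p x) i)) \<and> (\<exists>d. \<forall>x. degree (p x) \<le> d)"

lemma param_poly_const: "param_poly (\<lambda>x. c)"
  by (auto simp: param_poly_def intro: real_poly_fun.const)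

lemma param_poly_coeff: "param_poly p \<Longrightarrow> real_poly_fun (\<lambda>x. coeff (p x) i)"
  by (simp add: param_poly_def)

lemma param_poly_embed:
  assumes "real_poly_fun t"
  shows "param_poly (\<lambda>x. [:t x:])"
  unfolding param_poly_def
proof (intro conjI allI)
  show "real_poly_fun (\<lambda>x. coeff [:t x:] i)" for i
    using assms by (cases i) (auto intro: real_poly_fun.const)
qed auto

lemma param_poly_add:
  assumes "param_poly p" "param_poly q"
  shows "param_poly (\<lambda>x. p x + q x)"
proof -
  obtain d e where "\<And>x. degree (p x) \<le> d" "\<And>x. degree (q x) \<le> e" using assms unfolding param_poly_def by blast
  then have "degree (p x + q x) \<le> max d e" for x
    by (metis degree_add_le_max le_trans max.mono)
  with assms show ?thesis unfolding param_poly_def by (auto intro: real_poly_fun.add)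
qed

lemma param_poly_mult:
  assumes "param_poly p" "param_poly q"
  shows "param_poly (\<lambda>x. p x * q x)"
proof -
  obtain d e where "\<And>x. degree (p x) \<le> d" "\<And>x. degree (q x) \<le> e" using assms unfolding param_poly_def by blast
  then have "degree (p x * q x) \<le> d + e" for x
    by (metis degree_mult_le le_trans add_mono)
  with assms show ?thesis unfolding param_poly_def coeff_mult
    by (auto intro!: real_poly_fun_sum intro: real_poly_fun.mult)
qed

lemma param_poly_smult:
  "real_poly_fun t \<Longrightarrow> param_poly p \<Longrightarrow> param_poly (\<lambda>x. smult (t x) (p x))"
  using param_poly_mult[OF param_poly_embed] by fastforce

lemma param_poly_diff:
  assumes "param_poly p" "param_poly q"
  shows "param_poly (\<lambda>x. p x - q x)"
  using param_poly_add[OF assms(1) param_poly_mult[OF param_poly_const[of "-1"] assms(2)]] by simp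

lemma param_poly_pderiv:
  assumes "param_poly p"
  shows "param_poly (\<lambda>x. pderiv (p x))"
proof -
  obtain d where "\<And>x. degree (p x) \<le> d" using assms unfolding param_poly_def by blast
  then have "degree (pderiv (p x)) \<le> d" for x
    by (metis degree_pderiv diff_le_self le_trans)
  with assms show ?thesis unfolding param_poly_def coeff_pderiv
    by (auto intro: real_poly_fun.mult real_poly_fun.const)
qed

text \<open>Division by \<open>q\<close> without fractions. Multiplying by the square of the leading
  coefficient \<open>b\<close>, not by \<open>b\<close> itself, preserves signs at the roots of
  \<open>q\<close>. The induction runs over a bound for the degrees, because
  \<open>degree (p x)\<close> depends on \<open>x\<close> and the coefficient to be cancelled may
  vanish at some \<open>x\<close>.\<close>

lemma param_pseudo_remainder:
  assumes p: "param_poly p" and q: "param_poly q"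
    and e: "\<And>x. x \<in> C \<Longrightarrow> degree (q x) = e" "e > 0"
  shows "\<exists>r. param_poly r \<and> (\<forall>x\<in>C. degree (r x) < e \<and>
    (\<forall>y. poly (q x) y = 0 \<longrightarrow> sgn (poly (p x) y) = sgn (poly (r x) y)))"
proof -
  obtain d where "\<And>x. degree (p x) \<le> d" using p unfolding param_poly_def by blast
  then have "\<exists>k. \<forall>x\<in>C. degree (p x) < k" using le_imp_less_Suc by blast
  then obtain k where "\<forall>x\<in>C. degree (p x) < k" ..
  with p show ?thesis
  proof (induction k arbitrary: p)
    case 0
    then have "C = {}" by auto
    then show ?case using param_poly_const by blast
  next
    case (Suc k)
    show ?case
    proof (cases "k < e")
      case True
      then show ?thesis using Suc.prems by (intro exI[of _ p]) auto
    next
      case False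
      define b where "b = (\<lambda>x. coeff (q x) e)"
      define c where "c = (\<lambda>x. coeff (p x) k)"
      \<comment> \<open>The coefficient of order \<open>k\<close> cancels as
        \<open>b b c - b c b\<close>; at a root of \<open>q\<close> only \<open>b b p\<close>
        remains.\<close>
      define p1 where "p1 = (\<lambda>x. smult (b x * b x) (p x) - smult (b x * c x) (monom 1 (k - e) * q x))"
      have bc: "real_poly_fun b" "real_poly_fun c"
        unfolding b_def c_def using Suc.prems(1) q by (auto intro: param_poly_coeff)
      have b0: "b x \<noteq> 0" if "x \<in> C" for x
        using e(1)[OF that] e(2) by (auto simp: b_def)
      have "param_poly p1" unfolding p1_def
        using Suc.prems(1) q bc
        by (intro param_poly_diff param_poly_smult param_poly_mult param_poly_const real_poly_fun.mult)
      moreover have "degree (p1 x) < k" if x: "x \<in> C" for x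
      proof (rule degree_lessI)
        show "\<forall>i\<ge>k. coeff (p1 x) i = 0"
        proof (intro allI impI)
          fix i assume "k \<le> i"
          show "coeff (p1 x) i = 0"
          proof (cases "i = k")
            case True
            then show ?thesis using False
              by (simp add: p1_def coeff_monom_mult b_def c_def)
          next
            case ik: False
            have "degree (p x) < i" using Suc.prems(2) x \<open>k \<le> i\<close> ik by force
            moreover have "degree (q x) < i - (k - e)"
              using e(1)[OF x] \<open>k \<le> i\<close> ik False by linarith
            ultimately show ?thesis by (simp add: p1_def coeff_monom_mult coeff_eq_0)
          qed
        qed
        show "p1 x \<noteq> 0 \<or> k > 0" using False e(2) by linarith
      qed
      ultimately obtain r where r: "param_poly r" "\<And>x. x \<in> C \<Longrightarrow> degree (r x) < e"
        "\<And>x y. x \<in> C \<Longrightarrow> poly (q x) y = 0 \<Longrightarrow> sgn (poly (p1 x) y) = sgn (poly (r x) y)"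
        using Suc.IH[of p1] by blast
      have "sgn (poly (p x) y) = sgn (poly (r x) y)" if "x \<in> C" "poly (q x) y = 0" for x y
      proof -
        have "poly (p1 x) y = (b x * b x) * poly (p x) y" using that by (simp add: p1_def)
        moreover have "b x * b x > 0" using b0[OF that(1)] by (auto simp: zero_less_mult_iff)
        ultimately have "sgn (poly (p1 x) y) = sgn (poly (p x) y)" by (metis sgn_mult sgn_pos mult_1)
        with r(3)[OF that] show ?thesis by simp
      qed
      with r show ?thesis by blast
    qed
  qed
qed

section \<open>Sign diagrams of polynomial families\<close>

definition same_signs :: "('a \<Rightarrow> real) set \<Rightarrow> 'a \<Rightarrow> 'a \<Rightarrow> bool" where
  "same_signs T x x' \<longleftrightarrow> (\<forall>t\<in>T. sgn (t x) = sgn (t x'))"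

text \<open>The sign diagram at \<open>x\<close> is the succession of sign vectors of the family
  along the line; comparing diagrams up to an order isomorphism \<phi> forgets where the roots lie.
  The tests \<open>T\<close> depend on the parameter alone and have to separate only the diagrams
  that occur over \<open>C\<close>.\<close>

definition sign_diagram_determined :: "'a::euclidean_space set \<Rightarrow> ('a \<Rightarrow> real poly) set \<Rightarrow> bool" where
  "sign_diagram_determined C F \<longleftrightarrow> (\<exists>T. finite T \<and> (\<forall>t\<in>T. real_poly_fun t) \<and>
     (\<forall>x\<in>C. \<forall>x'\<in>C. same_signs T x x' \<longrightarrow>
       (\<exists>\<phi>. strict_mono \<phi> \<and> surj \<phi> \<and> (\<forall>p\<in>F. \<forall>y. sgn (poly (p x) y) = sgn (poly (p x') (\<phi> y))))))"

text \<open>Tests can be added freely, so it suffices to treat sets on which the signs of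
  \<open>T0\<close> are constant. Each \<open>t\<close> divides \<open>C\<close> into three classes,
  and the test sets of the three classes together with \<open>t\<close> serve for all of
  \<open>C\<close>.\<close>

lemma sign_diagram_determined_split:
  assumes "finite T0" "\<And>t. t \<in> T0 \<Longrightarrow> real_poly_fun t"
    and "\<And>D. D \<subseteq> C \<Longrightarrow> (\<And>x x'. x \<in> D \<Longrightarrow> x' \<in> D \<Longrightarrow> same_signs T0 x x') \<Longrightarrow> sign_diagram_determined D F"
  shows "sign_diagram_determined C F"
  using assms
proof (induction T0 arbitrary: C rule: finite_induct)
  case empty
  show ?case by (rule empty.prems(2)[OF subset_refl]) (simp add: same_signs_def)
next
  case (insert t T0)
  have cls: "sign_diagram_determined {x\<in>C. sgn (t x) = s} F" for s
  proof (rule insert.IH)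
    show "\<And>t. t \<in> T0 \<Longrightarrow> real_poly_fun t" using insert.prems(1) by simp
    fix D assume D: "D \<subseteq> {x\<in>C. sgn (t x) = s}" "\<And>x x'. x \<in> D \<Longrightarrow> x' \<in> D \<Longrightarrow> same_signs T0 x x'"
    show "sign_diagram_determined D F"
    proof (rule insert.prems(2))
      show "D \<subseteq> C" using D(1) by blast
      fix x x' assume x: "x \<in> D" "x' \<in> D"
      have "sgn (t x) = sgn (t x')" using x D(1) by blast
      then show "same_signs (insert t T0) x x'"
        using D(2)[OF x] unfolding same_signs_def by blast
    qed
  qed
  have "\<forall>s. \<exists>T. finite T \<and> (\<forall>u\<in>T. real_poly_fun u) \<and>
     (\<forall>x\<in>{x\<in>C. sgn (t x) = s}. \<forall>x'\<in>{x\<in>C. sgn (t x) = s}. same_signs T x x' \<longrightarrow>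
       (\<exists>\<phi>. strict_mono \<phi> \<and> surj \<phi> \<and> (\<forall>p\<in>F. \<forall>y. sgn (poly (p x) y) = sgn (poly (p x') (\<phi> y)))))"
    by (intro allI cls[unfolded sign_diagram_determined_def])
  from choice[OF this] obtain T where T: "\<forall>s. finite (T s) \<and> (\<forall>u\<in>T s. real_poly_fun u) \<and>
     (\<forall>x\<in>{x\<in>C. sgn (t x) = s}. \<forall>x'\<in>{x\<in>C. sgn (t x) = s}. same_signs (T s) x x' \<longrightarrow>
       (\<exists>\<phi>. strict_mono \<phi> \<and> surj \<phi> \<and> (\<forall>p\<in>F. \<forall>y. sgn (poly (p x) y) = sgn (poly (p x') (\<phi> y)))))" ..
  let ?T = "insert t (T (-1) \<union> T 0 \<union> T 1)"
  have "\<exists>\<phi>. strict_mono \<phi> \<and> surj \<phi> \<and> (\<forall>p\<in>F. \<forall>y. sgn (poly (p x) y) = sgn (poly (p x') (\<phi> y)))"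
    if "x \<in> C" "x' \<in> C" "same_signs ?T x x'" for x x'
  proof (rule T[rule_format, THEN conjunct2, THEN conjunct2, rule_format, of x "sgn (t x)" x'])
    have "sgn (t x) = -1 \<or> sgn (t x) = 0 \<or> sgn (t x) = 1" by (simp add: sgn_if)
    then have "T (sgn (t x)) \<subseteq> ?T" by (elim disjE) (simp_all only:, blast+)
    then show "same_signs (T (sgn (t x))) x x'"
      using that(3) unfolding same_signs_def by blast
    have "sgn (t x') = sgn (t x)" using that(3) by (simp add: same_signs_def)
    then show "x' \<in> {y\<in>C. sgn (t y) = sgn (t x)}" using that(2) by simp
    show "x \<in> {y\<in>C. sgn (t y) = sgn (t x)}" using that(1) by simp
  qed
  then have "\<forall>x\<in>C. \<forall>x'\<in>C. same_signs ?T x x' \<longrightarrow>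
     (\<exists>\<phi>. strict_mono \<phi> \<and> surj \<phi> \<and> (\<forall>p\<in>F. \<forall>y. sgn (poly (p x) y) = sgn (poly (p x') (\<phi> y))))"
    by (intro ballI impI)
  moreover have "finite ?T" using T by simp
  moreover have "\<forall>u\<in>?T. real_poly_fun u"
    using T[THEN spec, of "-1"] T[THEN spec, of 0] T[THEN spec, of 1] insert.prems(1)[of t] by blast
  ultimately show ?case unfolding sign_diagram_determined_def by (intro exI[of _ ?T] conjI)
qed

text \<open>Cohen-Hoermander elimination: a polynomial of top degree is traded for its derivative and its
  pseudo-remainders, which fix its signs at the roots of the others.\<close>

lemma sign_diagram_determined_bounded:
  assumes "finite F" "\<And>p. p \<in> F \<Longrightarrow> param_poly p" "\<And>p x. p \<in> F \<Longrightarrow> x \<in> C \<Longrightarrow> degree (p x) \<le> d"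
    and "card {p\<in>F. \<exists>x\<in>C. degree (p x) = d} \<le> m"
  shows "sign_diagram_determined C F"
  using assms
\<comment> \<open>Lexicographic induction: on the degree bound \<open>d\<close>, then on the number
  \<open>m\<close> of members that attain it.\<close>
proof (induction d arbitrary: C F m)
  case 0
  define T where "T = (\<lambda>p x. coeff (p x) 0) ` F"
  have "\<exists>\<phi>. strict_mono \<phi> \<and> surj \<phi> \<and> (\<forall>p\<in>F. \<forall>y. sgn (poly (p x) y) = sgn (poly (p x') (\<phi> y)))"
    if "x \<in> C" "x' \<in> C" "same_signs T x x'" for x x'
  proof -
    have "sgn (poly (p x) y) = sgn (poly (p x') y)" if "p \<in> F" for p y
    proof -
      have "degree (p x) = 0" "degree (p x') = 0"
        using 0(3)[OF that \<open>x \<in> C\<close>] 0(3)[OF that \<open>x' \<in> C\<close>] by auto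
      then have "poly (p x) y = coeff (p x) 0" "poly (p x') y = coeff (p x') 0"
        by (auto elim!: degree_eq_zeroE)
      then show ?thesis using \<open>same_signs T x x'\<close> that by (auto simp: T_def same_signs_def)
    qed
    moreover have "strict_mono (\<lambda>y::real. y)" "surj (\<lambda>y::real. y)" by (simp_all add: strict_mono_def)
    ultimately show ?thesis by (intro exI[of _ "\<lambda>y. y"] conjI ballI allI)
  qed
  moreover have "finite T" unfolding T_def using 0(1) by (rule finite_imageI)
  moreover have "\<forall>t\<in>T. real_poly_fun t"
    unfolding T_def by (intro ballI, erule imageE, simp only:, rule param_poly_coeff, rule 0(2))
  ultimately show ?case unfolding sign_diagram_determined_def by blast
next
  case (Suc d)
  note IHd = Suc.IH
  from Suc.prems show ?case
  proof (induction m arbitrary: C F)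
    case 0
    have "finite {p \<in> F. \<exists>x\<in>C. degree (p x) = Suc d}" using 0(1) by (rule rev_finite_subset) blast
    then have "{p \<in> F. \<exists>x\<in>C. degree (p x) = Suc d} = {}" using 0(4) by auto
    then have le: "degree (p x) \<le> d" if "p \<in> F" "x \<in> C" for p x
      using 0(3)[OF that] that by (auto simp: le_Suc_eq)
    show ?case by (rule IHd[of F C, OF 0(1,2) _ order_refl]) (assumption, rule le)
  next
    case (Suc m)
    note F = Suc.prems
    \<comment> \<open>Fixing the signs of all coefficients makes every degree constant and gives
      every leading coefficient a constant sign.\<close>
    define T0 where "T0 = (\<lambda>(p,i) x. coeff (p x) i) ` (F \<times> {..Suc d})"
    show ?case
    proof (rule sign_diagram_determined_split[of T0])
      show "finite T0" using F(1) by (simp add: T0_def)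
      show "real_poly_fun t" if t: "t \<in> T0" for t
      proof -
        obtain p i where "p \<in> F" "t = (\<lambda>x. coeff (p x) i)" using t unfolding T0_def by auto
        then show ?thesis using param_poly_coeff[OF F(2)] by simp
      qed
      fix D assume D: "D \<subseteq> C" and same: "\<And>x x'. x \<in> D \<Longrightarrow> x' \<in> D \<Longrightarrow> same_signs T0 x x'"
      have cf: "sgn (coeff (p x) i) = sgn (coeff (p x') i)" if "p \<in> F" "x \<in> D" "x' \<in> D" for p x x' i
      proof (cases "i \<le> Suc d")
        case True
        then have "(\<lambda>x. coeff (p x) i) \<in> T0"
          unfolding T0_def using that by (intro image_eqI[of _ _ "(p, i)"]) auto
        from bspec[OF same[OF that(2,3), unfolded same_signs_def] this] show ?thesis .
      next
        case False
        have "degree (p x) \<le> Suc d" "degree (p x') \<le> Suc d" using F(3)[OF that(1)] that(2,3) D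
          by (simp_all add: subsetD)
        then have "degree (p x) < i" "degree (p x') < i" using False by auto
        then show ?thesis by (simp add: coeff_eq_0)
      qed
      have dg_le: "degree (p x) \<le> degree (p x')" if "p \<in> F" "x \<in> D" "x' \<in> D" for p x x'
        using cf[OF that] by (intro degree_le) (metis coeff_eq_0 sgn_0_0)
      then have dg: "degree (p x) = degree (p x')" if "p \<in> F" "x \<in> D" "x' \<in> D" for p x x'
        using that by (meson order_antisym)
      let ?N = "{p\<in>F. \<exists>x\<in>D. degree (p x) = Suc d}"
      have DF: "degree (p x) \<le> Suc d" if "p \<in> F" "x \<in> D" for p x using F(3) that D by blast
      show "sign_diagram_determined D F"
      proof (cases "card ?N \<le> m")
        case True
        show ?thesis by (rule Suc.IH[of F D, OF F(1,2) _ True]) (assumption, rule DF)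
      next
        case False
        then have "?N \<noteq> {}" by (metis card.empty le0)
        then obtain p x0 where p: "p \<in> F" "x0 \<in> D" "degree (p x0) = Suc d" by blast
        have dp: "degree (p x) = Suc d" if "x \<in> D" for x using dg[OF p(1) that p(2)] p(3) by simp
        define p' where "p' = (\<lambda>x. pderiv (p x))"
        have dp': "degree (p' x) = d" if "x \<in> D" for x using dp[OF that] by (simp add: p'_def degree_pderiv)
        define F' where "F' = insert p' (F - {p})"
        have F': "finite F'" "\<And>q. q \<in> F' \<Longrightarrow> param_poly q"
        proof -
          show "finite F'" using F(1) by (simp add: F'_def)
          have "param_poly p'" unfolding p'_def by (rule param_poly_pderiv[OF F(2)[OF p(1)]])
          then show "param_poly q" if "q \<in> F'" for q using that F(2)[of q] by (auto simp: F'_def)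
        qed
        have dF': "degree (q x) = degree (q x0)" if "q \<in> F'" "x \<in> D" for q x
          using that dp'[of x] dp'[of x0] p(2) dg[of q x x0] by (auto simp: F'_def)
        \<comment> \<open>Where \<open>q\<close> is constant it is either without roots or the zero
          polynomial, which \<open>sign_iso_extend\<close> leaves aside; there the remainder is a
          dummy 0.\<close>
        have "\<forall>q\<in>F'. \<exists>r. param_poly r \<and> (\<forall>x\<in>D. degree (r x) \<le> d) \<and>
            (0 < degree (q x0) \<longrightarrow> (\<forall>x\<in>D. \<forall>y. poly (q x) y = 0 \<longrightarrow> sgn (poly (p x) y) = sgn (poly (r x) y)))"
        proof
          fix q assume q: "q \<in> F'"
          show "\<exists>r. param_poly r \<and> (\<forall>x\<in>D. degree (r x) \<le> d) \<and>
            (0 < degree (q x0) \<longrightarrow> (\<forall>x\<in>D. \<forall>y. poly (q x) y = 0 \<longrightarrow> sgn (poly (p x) y) = sgn (poly (r x) y)))"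
          proof (cases "0 < degree (q x0)")
            case True
            have "degree (q x0) \<le> Suc d" using q DF[of q x0] p(2) dp'[OF p(2)] by (auto simp: F'_def)
            moreover obtain r where "param_poly r" "\<forall>x\<in>D. degree (r x) < degree (q x0) \<and>
                (\<forall>y. poly (q x) y = 0 \<longrightarrow> sgn (poly (p x) y) = sgn (poly (r x) y))"
              using param_pseudo_remainder[of p q D "degree (q x0)"] F(2)[OF p(1)] F'(2)[OF q] dF'[OF q] True by blast
            ultimately show ?thesis by (intro exI[of _ r]) force
          next
            case False
            then show ?thesis by (intro exI[of _ "\<lambda>x. 0"]) (auto intro: param_poly_const)
          qed
        qed
        then obtain r where r: "\<And>q. q \<in> F' \<Longrightarrow> param_poly (r q)" "\<And>q x. q \<in> F' \<Longrightarrow> x \<in> D \<Longrightarrow> degree (r q x) \<le> d"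
          "\<And>q x y. q \<in> F' \<Longrightarrow> 0 < degree (q x0) \<Longrightarrow> x \<in> D \<Longrightarrow> poly (q x) y = 0 \<Longrightarrow>
             sgn (poly (p x) y) = sgn (poly (r q x) y)"
          unfolding bchoice_iff by blast
        let ?F2 = "F' \<union> r ` F'"
        have "sign_diagram_determined D ?F2"
        proof (rule Suc.IH)
          show "finite ?F2" using F' by simp
          show "param_poly q" if "q \<in> ?F2" for q using that F'(2) r(1) by blast
          show "degree (q x) \<le> Suc d" if qx: "q \<in> ?F2" "x \<in> D" for q x
          proof -
            consider "q = p'" | "q \<in> F" | q' where "q' \<in> F'" "q = r q'" using qx(1) by (auto simp: F'_def)
            then show ?thesis
            proof cases
              case 1 then show ?thesis using dp'[OF qx(2)] by simp
            next
              case 2 then show ?thesis using DF qx(2) by blast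
            next
              case 3 then show ?thesis using r(2)[OF 3(1) qx(2)] by simp
            qed
          qed
          \<comment> \<open>The derivative and the remainders have degree at most \<open>d\<close>,
            so \<open>p\<close> has left the top degree and nothing has joined it.\<close>
          have "{q\<in>?F2. \<exists>x\<in>D. degree (q x) = Suc d} \<subseteq> {q\<in>F. \<exists>x\<in>C. degree (q x) = Suc d} - {p}"
          proof
            fix q assume "q \<in> {q\<in>?F2. \<exists>x\<in>D. degree (q x) = Suc d}"
            then obtain x where q: "q \<in> ?F2" "x \<in> D" "degree (q x) = Suc d" by blast
            have "q \<noteq> p'" using q dp'[of x] by auto
            moreover have "q \<notin> r ` F'"
            proof
              assume "q \<in> r ` F'"
              then obtain q' where "q' \<in> F'" "q = r q'" by blast
              then show False using r(2)[of q' x] q by simp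
            qed
            ultimately have "q \<in> F - {p}" using q(1) unfolding F'_def by blast
            then show "q \<in> {q\<in>F. \<exists>x\<in>C. degree (q x) = Suc d} - {p}" using q D by blast
          qed
          then have "card {q\<in>?F2. \<exists>x\<in>D. degree (q x) = Suc d} \<le> card ({q\<in>F. \<exists>x\<in>C. degree (q x) = Suc d} - {p})"
            using F(1) by (intro card_mono) auto
          also have "\<dots> = card {q\<in>F. \<exists>x\<in>C. degree (q x) = Suc d} - 1"
            using p D by (intro card_Diff_singleton) auto
          finally show "card {q\<in>?F2. \<exists>x\<in>D. degree (q x) = Suc d} \<le> m" using F(4) by linarith
        qed
        then obtain T where T: "finite T \<and> (\<forall>t\<in>T. real_poly_fun t) \<and>
          (\<forall>x\<in>D. \<forall>x'\<in>D. same_signs T x x' \<longrightarrow>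
            (\<exists>\<phi>. strict_mono \<phi> \<and> surj \<phi> \<and> (\<forall>p\<in>?F2. \<forall>y. sgn (poly (p x) y) = sgn (poly (p x') (\<phi> y)))))"
          unfolding sign_diagram_determined_def ..
        have "\<exists>\<phi>. strict_mono \<phi> \<and> surj \<phi> \<and> (\<forall>p\<in>F. \<forall>y. sgn (poly (p x) y) = sgn (poly (p x') (\<phi> y)))"
          if x: "x \<in> D" "x' \<in> D" "same_signs T x x'" for x x'
        proof -
          from T[THEN conjunct2, THEN conjunct2, rule_format, OF x]
          obtain \<phi> where \<phi>: "strict_mono \<phi> \<and> surj \<phi> \<and>
            (\<forall>p\<in>?F2. \<forall>y. sgn (poly (p x) y) = sgn (poly (p x') (\<phi> y)))" ..
          then have \<phi>12: "strict_mono \<phi>" "surj \<phi>" by (rule conjunct1, rule conjunct1[OF conjunct2])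
          have \<phi>3: "sgn (poly (p x) y) = sgn (poly (p x') (\<phi> y))" if "p \<in> ?F2" for p y
            by (rule spec[OF bspec[OF conjunct2[OF conjunct2[OF \<phi>]] that]])
          let ?K = "(\<lambda>q. (q x, q x')) ` F'"
          have "\<exists>\<phi>. strict_mono \<phi> \<and> surj \<phi> \<and>
              (\<forall>(P, Q)\<in>insert (p x, p x') ?K. \<forall>y. sgn (poly P y) = sgn (poly Q (\<phi> y)))"
          proof (rule sign_iso_extend[OF _ \<phi>12])
            show "finite ?K" using F' by simp
            show "sgn (poly P y) = sgn (poly Q (\<phi> y))" if PQ: "(P, Q) \<in> ?K" for P Q y
            proof -
              obtain q where "q \<in> F'" "P = q x" "Q = q x'" using PQ by auto
              then show ?thesis using \<phi>3[of q y] by simp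
            qed
            show "(pderiv (p x), pderiv (p x')) \<in> ?K" by (auto simp: F'_def p'_def)
            show "degree (p x) = degree (p x')" "0 < degree (p x)" using dp x by auto
            show "sgn (lead_coeff (p x)) = sgn (lead_coeff (p x'))" using cf[OF p(1) x(1,2)] dp x by simp
            show "sgn (poly (p x) y) = sgn (poly (p x') (\<phi> y))"
              if PQ: "(P, Q) \<in> ?K" "P \<noteq> 0" "poly P y = 0" for P Q y
            proof -
              obtain q where q: "q \<in> F'" "P = q x" "Q = q x'" using PQ by auto
              have "degree (q x) > 0" using PQ q by (auto intro!: gr0I elim!: degree_eq_zeroE)
              then have d0: "degree (q x0) > 0" using dF'[OF q(1) x(1)] by simp
              have "poly (q x') (\<phi> y) = 0" using \<phi>3[of q y] q PQ by (simp add: sgn_0_0)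
              then show ?thesis
                using r(3)[OF q(1) d0 x(1), of y] r(3)[OF q(1) d0 x(2), of "\<phi> y"] \<phi>3[of "r q" y] PQ(3) q
                  \<open>poly (q x') (\<phi> y) = 0\<close> by simp
            qed
          qed
          then obtain \<psi> where \<psi>: "strict_mono \<psi>" "surj \<psi>"
            "\<forall>(P, Q)\<in>insert (p x, p x') ?K. \<forall>y. sgn (poly P y) = sgn (poly Q (\<psi> y))" by (elim exE conjE)
          have "sgn (poly (q x) y) = sgn (poly (q x') (\<psi> y))" if "q \<in> F" for q y
          proof -
            have "(q x, q x') \<in> insert (p x, p x') ?K" using that by (cases "q = p") (auto simp: F'_def)
            from bspec[OF \<psi>(3) this] show ?thesis by simp
          qed
          then show ?thesis using \<psi>(1,2) by (intro exI[of _ \<psi>] conjI ballI allI)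
        qed
        then have "\<forall>x\<in>D. \<forall>x'\<in>D. same_signs T x x' \<longrightarrow>
            (\<exists>\<phi>. strict_mono \<phi> \<and> surj \<phi> \<and> (\<forall>p\<in>F. \<forall>y. sgn (poly (p x) y) = sgn (poly (p x') (\<phi> y))))"
          by (intro ballI impI)
        with T show ?thesis unfolding sign_diagram_determined_def
          by (intro exI[of _ T] conjI) (elim conjE, assumption)+
      qed
    qed
  qed
qed

section \<open>Elimination of one real quantifier\<close>

lemma real_poly_fun_as_param_poly:
  fixes t :: "'a::euclidean_space \<times> real \<Rightarrow> real"
  assumes "real_poly_fun t"
  shows "\<exists>p. param_poly p \<and> (\<forall>x y. t (x, y) = poly (p x) y)"
  using assms
proof induction
  case (const c)
  then show ?case by (intro exI[of _ "\<lambda>x. [:c:]"]) (auto intro: param_poly_const)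
next
  case (coord b)
  then consider b' where "b = (b', 0)" "b' \<in> Basis" | "b = (0, 1)" by (auto simp: Basis_prod_def)
  then show ?case
  proof cases
    case 1
    then show ?thesis
      by (intro exI[of _ "\<lambda>x. [:x \<bullet> b':]"]) (auto intro: param_poly_embed real_poly_fun.coord)
  next
    case 2
    then show ?thesis by (intro exI[of _ "\<lambda>x. [:0, 1:]"]) (auto intro: param_poly_const)
  qed
next
  case (add p q)
  then obtain p1 q1 where "param_poly p1" "\<forall>x y. p (x, y) = poly (p1 x) y"
    "param_poly q1" "\<forall>x y. q (x, y) = poly (q1 x) y" by blast
  then show ?case by (intro exI[of _ "\<lambda>x. p1 x + q1 x"]) (auto intro: param_poly_add)
next
  case (mult p q)
  then obtain p1 q1 where "param_poly p1" "\<forall>x y. p (x, y) = poly (p1 x) y"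
    "param_poly q1" "\<forall>x y. q (x, y) = poly (q1 x) y" by blast
  then show ?case by (intro exI[of _ "\<lambda>x. p1 x * q1 x"]) (auto intro: param_poly_mult)
qed

text \<open>Being decided by the signs of finitely many polynomials is the same as being a Boolean
  combination of polynomial sign conditions; in this form negation and conjunction are immediate.
  One implication suffices since \<open>same_signs\<close> is symmetric.\<close>

definition definable :: "('a::euclidean_space \<Rightarrow> bool) \<Rightarrow> bool" where
  "definable P \<longleftrightarrow> (\<exists>T. finite T \<and> (\<forall>t\<in>T. real_poly_fun t) \<and>
     (\<forall>x x'. same_signs T x x' \<longrightarrow> P x \<longrightarrow> P x'))"

text \<open>Tarski-Seidenberg for one variable: if \<open>x\<close> and \<open>x'\<close> agree on
  the tests for the sign diagram, the isomorphism carries a witness \<open>y\<close> at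
  \<open>x\<close> to the witness \<open>\<phi> y\<close> at \<open>x'\<close>.\<close>

lemma definable_Ex_real:
  fixes P :: "'a::euclidean_space \<times> real \<Rightarrow> bool"
  assumes "definable P"
  shows "definable (\<lambda>x. \<exists>y. P (x, y))"
proof -
  obtain T where T: "finite T" "\<And>t. t \<in> T \<Longrightarrow> real_poly_fun t"
    "\<And>z z'. same_signs T z z' \<Longrightarrow> P z \<Longrightarrow> P z'"
    using assms unfolding definable_def by blast
  obtain c where c: "\<And>t. t \<in> T \<Longrightarrow> param_poly (c t)" "\<And>t x y. t \<in> T \<Longrightarrow> t (x, y) = poly (c t x) y"
    using real_poly_fun_as_param_poly[OF T(2)] by metis
  have "\<exists>d. \<forall>t\<in>T. \<forall>x. degree (c t x) \<le> d"
  proof -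
    obtain d where "\<And>t x. t \<in> T \<Longrightarrow> degree (c t x) \<le> d t" using c(1) unfolding param_poly_def by metis
    moreover have "d t \<le> Max (d ` T)" if "t \<in> T" for t using that T(1) by simp
    ultimately show ?thesis by (meson order_trans)
  qed
  then obtain d where "\<And>t x. t \<in> T \<Longrightarrow> degree (c t x) \<le> d" by blast
  then have "sign_diagram_determined UNIV (c ` T)"
    using T(1) c(1) by (intro sign_diagram_determined_bounded[of _ _ d, OF _ _ _ order_refl]) auto
  then obtain S where S: "finite S \<and> (\<forall>s\<in>S. real_poly_fun s) \<and>
     (\<forall>x\<in>UNIV. \<forall>x'\<in>UNIV. same_signs S x x' \<longrightarrow> (\<exists>\<phi>. strict_mono \<phi> \<and> surj \<phi> \<and>
       (\<forall>p\<in>c ` T. \<forall>y. sgn (poly (p x) y) = sgn (poly (p x') (\<phi> y)))))"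
    unfolding sign_diagram_determined_def ..
  have "\<exists>y. P (x', y)" if ss: "same_signs S x x'" and y: "P (x, y)" for x x' y
  proof -
    from S[THEN conjunct2, THEN conjunct2, rule_format, OF UNIV_I UNIV_I ss]
    obtain \<phi> where \<phi>: "\<forall>p\<in>c ` T. \<forall>y. sgn (poly (p x) y) = sgn (poly (p x') (\<phi> y))" by (elim exE conjE)
    have "same_signs T (x, y) (x', \<phi> y)"
      unfolding same_signs_def
    proof
      fix t assume t: "t \<in> T"
      from bspec[OF \<phi> imageI[OF t]] show "sgn (t (x, y)) = sgn (t (x', \<phi> y))" using c(2)[OF t] by simp
    qed
    then show ?thesis using T(3) y by blast
  qed
  with S show ?thesis unfolding definable_def by blast
qed

section \<open>Definable predicates and functions\<close>

lemma same_signsD: "same_signs T x x' \<Longrightarrow> t \<in> T \<Longrightarrow> sgn (t x) = sgn (t x')"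
  unfolding same_signs_def by (drule bspec)

lemma same_signs_sym: "same_signs T x x' \<Longrightarrow> same_signs T x' x"
  unfolding same_signs_def by (intro ballI) (drule bspec, assumption, erule sym)

lemma same_signs_mono: "same_signs S x x' \<Longrightarrow> T \<subseteq> S \<Longrightarrow> same_signs T x x'"
  unfolding same_signs_def by (intro ballI) (drule bspec, erule (1) subsetD)

lemma definableI:
  assumes "finite T" "\<And>t. t \<in> T \<Longrightarrow> real_poly_fun t" "\<And>x x'. same_signs T x x' \<Longrightarrow> P x \<Longrightarrow> P x'"
  shows "definable P"
  unfolding definable_def
proof (intro exI[of _ T] conjI ballI allI impI)
  show "finite T" by (rule assms(1))
  show "real_poly_fun t" if "t \<in> T" for t using that by (rule assms(2))
  show "P x'" if "same_signs T x x'" "P x" for x x' using that by (rule assms(3))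
qed

lemma definableE:
  assumes "definable P"
  obtains T where "finite T" "\<forall>t\<in>T. real_poly_fun t" "\<forall>x x'. same_signs T x x' \<longrightarrow> P x = P x'"
proof -
  from assms[unfolded definable_def] obtain T where T: "finite T \<and> (\<forall>t\<in>T. real_poly_fun t) \<and>
     (\<forall>x x'. same_signs T x x' \<longrightarrow> P x \<longrightarrow> P x')" ..
  have T3: "P x \<longrightarrow> P x'" if "same_signs T x x'" for x x'
    by (rule T[THEN conjunct2, THEN conjunct2, THEN spec, THEN spec, THEN mp, OF that])
  show thesis
  proof (rule that)
    show "finite T" by (rule conjunct1[OF T])
    show "\<forall>t\<in>T. real_poly_fun t" by (rule conjunct1[OF conjunct2[OF T]])
    show "\<forall>x x'. same_signs T x x' \<longrightarrow> P x = P x'"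
    proof (intro allI impI)
      fix x x' assume that: "same_signs T x x'"
      have "same_signs T x' x" using that by (rule same_signs_sym)
      then show "P x = P x'" using T3[OF that] T3[of x' x] by blast
    qed
  qed
qed

lemma definable_const: "definable (\<lambda>x. c)"
  by (rule definableI[of "{}"]) simp_all

lemma definable_sgn:
  assumes "real_poly_fun t"
  shows "definable (\<lambda>x. Q (sgn (t x)))"
proof (rule definableI[of "{t}"])
  show "Q (sgn (t x'))" if "same_signs {t} x x'" "Q (sgn (t x))" for x x'
    using same_signsD[OF that(1), of t] that(2) by simp
qed (simp_all add: assms)

lemma definable_not:
  assumes "definable P"
  shows "definable (\<lambda>x. \<not> P x)"
proof -
  obtain T where T': "finite T" "\<forall>t\<in>T. real_poly_fun t" "\<forall>x x'. same_signs T x x' \<longrightarrow> P x = P x'"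
    by (rule definableE[OF assms])
  note T = T'(1) T'(2)[rule_format] T'(3)[rule_format]
  show ?thesis
  proof (rule definableI[OF T(1,2)])
    show "\<not> P x'" if "same_signs T x x'" "\<not> P x" for x x' using T(3)[OF that(1)] that(2) by simp
  qed assumption
qed

lemma definable_conj:
  assumes "definable P" "definable Q"
  shows "definable (\<lambda>x. P x \<and> Q x)"
proof -
  obtain T where T': "finite T" "\<forall>t\<in>T. real_poly_fun t" "\<forall>x x'. same_signs T x x' \<longrightarrow> P x = P x'"
    by (rule definableE[OF assms(1)])
  note T = T'(1) T'(2)[rule_format] T'(3)[rule_format]
  obtain S where S': "finite S" "\<forall>t\<in>S. real_poly_fun t" "\<forall>x x'. same_signs S x x' \<longrightarrow> Q x = Q x'"
    by (rule definableE[OF assms(2)])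
  note S = S'(1) S'(2)[rule_format] S'(3)[rule_format]
  show ?thesis
  proof (rule definableI[of "T \<union> S"])
    show "finite (T \<union> S)" using T(1) S(1) by simp
    show "real_poly_fun t" if "t \<in> T \<union> S" for t using T(2) S(2) that by (elim UnE)
    show "P x' \<and> Q x'" if "same_signs (T \<union> S) x x'" "P x \<and> Q x" for x x'
    proof -
      have "same_signs T x x'" "same_signs S x x'" using that(1) by (rule same_signs_mono, simp)+
      then show ?thesis using T(3)[of x x'] S(3)[of x x'] that(2) by simp
    qed
  qed
qed

lemma definable_disj:
  assumes "definable P" "definable Q"
  shows "definable (\<lambda>x. P x \<or> Q x)"
  using definable_not[OF definable_conj[OF definable_not[OF assms(1)] definable_not[OF assms(2)]]] by (simp only: de_Morgan_conj not_not)

lemma definable_imp: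
  assumes "definable P" "definable Q"
  shows "definable (\<lambda>x. P x \<longrightarrow> Q x)"
  using definable_disj[OF definable_not[OF assms(1)] assms(2)] by (simp only: imp_conv_disj)

lemma definable_Ball_finite:
  assumes "finite I" "\<And>i. i \<in> I \<Longrightarrow> definable (P i)"
  shows "definable (\<lambda>x. \<forall>i\<in>I. P i x)"
  using assms
proof (induction rule: finite_induct)
  case empty
  show ?case by (simp add: definable_const)
next
  case (insert i I)
  have "definable (\<lambda>x. P i x \<and> (\<forall>i\<in>I. P i x))"
    by (intro definable_conj insert.IH insert.prems) simp_all
  then show ?case by simp
qed

lemma definable_Bex_finite:
  assumes "finite I" "\<And>i. i \<in> I \<Longrightarrow> definable (P i)"
  shows "definable (\<lambda>x. \<exists>i\<in>I. P i x)"
  using assms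
proof (induction rule: finite_induct)
  case empty
  show ?case by (simp add: definable_const)
next
  case (insert i I)
  have "definable (\<lambda>x. P i x \<or> (\<exists>i\<in>I. P i x))"
    by (intro definable_disj insert.IH insert.prems) simp_all
  then show ?case by simp
qed

section \<open>Polynomial maps and quantifiers over vectors\<close>

definition poly_map :: "('a::euclidean_space \<Rightarrow> 'b::euclidean_space) \<Rightarrow> bool" where
  "poly_map h \<longleftrightarrow> (\<forall>b\<in>Basis. real_poly_fun (\<lambda>x. h x \<bullet> b))"

lemma poly_map_linear:
  assumes "linear h"
  shows "poly_map h"
  unfolding poly_map_def
proof
  fix b :: 'b assume "b \<in> Basis"
  have eq: "(\<lambda>x. h x \<bullet> b) = (\<lambda>x. \<Sum>i\<in>Basis. (x \<bullet> i) * (h i \<bullet> b))"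
    by (intro ext Linear_Algebra.linear_componentwise[OF assms])
  show "real_poly_fun (\<lambda>x. h x \<bullet> b)" unfolding eq
    by (intro real_poly_fun_sum real_poly_fun.mult real_poly_fun.const real_poly_fun.coord finite_Basis)
qed

lemma poly_map_real: "poly_map h \<longleftrightarrow> real_poly_fun h" for h :: "'a::euclidean_space \<Rightarrow> real"
  by (simp add: poly_map_def)

lemma real_poly_fun_compose:
  assumes "real_poly_fun t" "poly_map h"
  shows "real_poly_fun (\<lambda>x. t (h x))"
  using assms(1)
proof induction
  case (const c)
  show ?case by (rule real_poly_fun.const)
next
  case (coord b)
  then show ?case using assms(2) by (simp add: poly_map_def)
next
  case (add p q)
  from add.IH show ?case by (rule real_poly_fun.add)
next
  case (mult p q)
  from mult.IH show ?case by (rule real_poly_fun.mult)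
qed

lemma definable_poly_map:
  assumes "definable P" "poly_map h"
  shows "definable (\<lambda>x. P (h x))"
proof -
  obtain T where T': "finite T" "\<forall>t\<in>T. real_poly_fun t" "\<forall>x x'. same_signs T x x' \<longrightarrow> P x = P x'"
    by (rule definableE[OF assms(1)])
  note T = T'(1) T'(2)[rule_format] T'(3)[rule_format]
  show ?thesis
  proof (rule definableI[of "(\<lambda>t x. t (h x)) ` T"])
    show "finite ((\<lambda>t x. t (h x)) ` T)" using T(1) by (rule finite_imageI)
    show "real_poly_fun s" if s: "s \<in> (\<lambda>t x. t (h x)) ` T" for s
    proof -
      obtain t where "t \<in> T" "s = (\<lambda>x. t (h x))" using s by (elim imageE)
      then show ?thesis using real_poly_fun_compose[OF T(2) assms(2)] by simp
    qed
    show "P (h x')" if "same_signs ((\<lambda>t x. t (h x)) ` T) x x'" "P (h x)" for x x'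
    proof -
      have "same_signs T (h x) (h x')"
        using same_signsD[OF that(1) imageI] unfolding same_signs_def by (intro ballI)
      then show ?thesis using T(3) that(2) by blast
    qed
  qed
qed

lemmas definable_linear = definable_poly_map[OF _ poly_map_linear]

text \<open>A quantifier over vectors is eliminated one coordinate at a time. The offset
  \<open>snd p\<close> holds the part of the vector already chosen; with the full basis and offset 0
  the whole space is reached.\<close>

lemma definable_Ex_span:
  fixes P :: "'a::euclidean_space \<times> 'b::euclidean_space \<Rightarrow> bool"
  assumes "finite B" "definable P"
  shows "definable (\<lambda>p. \<exists>z\<in>span B. P (fst p, snd p + z))"
  using assms(1)
proof (induction rule: finite_induct)
  case empty
  then show ?case using assms(2) by simp
next
  case (insert b B)
  have eq: "(\<exists>z\<in>span (insert b B). P (fst p, snd p + z)) \<longleftrightarrow>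
      (\<exists>s. \<exists>z\<in>span B. P (fst p, (snd p + s *\<^sub>R b) + z))" for p :: "'a \<times> 'b"
  proof safe
    fix z assume z: "z \<in> span (insert b B)" "P (fst p, snd p + z)"
    then obtain k where "z - k *\<^sub>R b \<in> span B" using span_breakdown_eq by blast
    then show "\<exists>s. \<exists>z\<in>span B. P (fst p, (snd p + s *\<^sub>R b) + z)"
      using z(2) by (intro exI[of _ k] bexI[of _ "z - k *\<^sub>R b"]) auto
  next
    fix s z assume z: "z \<in> span B" "P (fst p, snd p + s *\<^sub>R b + z)"
    then have "s *\<^sub>R b + z \<in> span (insert b B)"
      by (meson insertI1 span_add span_base span_mono span_scale subset_insertI subsetD)
    then show "\<exists>z\<in>span (insert b B). P (fst p, snd p + z)"
      using z(2) by (intro bexI[of _ "s *\<^sub>R b + z"]) (auto simp: add.assoc)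
  qed
  have "linear (\<lambda>q::('a \<times> 'b) \<times> real. (fst (fst q), snd (fst q) + snd q *\<^sub>R b))"
    by (simp add: linear_iff algebra_simps)
  from definable_linear[OF insert.IH this]
  have "definable (\<lambda>q::('a \<times> 'b) \<times> real. \<exists>z\<in>span B. P (fst (fst q), (snd (fst q) + snd q *\<^sub>R b) + z))"
    by simp
  from definable_Ex_real[OF this] show ?case unfolding eq by simp
qed

lemma definable_Ex:
  fixes P :: "'a::euclidean_space \<Rightarrow> 'b::euclidean_space \<Rightarrow> bool"
  assumes "definable (\<lambda>p. P (fst p) (snd p))"
  shows "definable (\<lambda>x. \<exists>y. P x y)"
proof -
  have "linear (\<lambda>x::'a. (x, 0::'b))" by (simp add: linear_iff)
  from definable_linear[OF definable_Ex_span[OF finite_Basis assms] this]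
  show ?thesis by simp
qed

lemma definable_All:
  fixes P :: "'a::euclidean_space \<Rightarrow> 'b::euclidean_space \<Rightarrow> bool"
  assumes "definable (\<lambda>p. P (fst p) (snd p))"
  shows "definable (\<lambda>x. \<forall>y. P x y)"
  using definable_not[OF definable_Ex[OF definable_not[OF assms]]] by simp

section \<open>Definable functions\<close>

definition definable_fun :: "('a::euclidean_space \<Rightarrow> 'b::euclidean_space) \<Rightarrow> bool" where
  "definable_fun g \<longleftrightarrow> definable (\<lambda>p. snd p = g (fst p))"

lemma definable_fun_poly_map:
  assumes "poly_map g"
  shows "definable_fun g"
proof -
  have *: "real_poly_fun (\<lambda>p. snd p \<bullet> b - g (fst p) \<bullet> b)" if "b \<in> Basis" for b
  proof (rule real_poly_fun_diff)
    show "real_poly_fun (\<lambda>p. snd p \<bullet> b)"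
      using poly_map_linear[OF linear_snd] that unfolding poly_map_def by (rule bspec)
    have "real_poly_fun (\<lambda>x. g x \<bullet> b)" using assms that unfolding poly_map_def by (rule bspec)
    then show "real_poly_fun (\<lambda>p. g (fst p) \<bullet> b)" by (rule real_poly_fun_compose) (rule poly_map_linear[OF linear_fst])
  qed
  have "definable (\<lambda>p. \<forall>b\<in>Basis. snd p \<bullet> b - g (fst p) \<bullet> b = 0)"
  proof (intro definable_Ball_finite finite_Basis)
    fix b :: 'b assume "b \<in> Basis"
    from definable_sgn[OF *[OF this], of "\<lambda>s. s = 0"]
    show "definable (\<lambda>p. snd p \<bullet> b - g (fst p) \<bullet> b = 0)" by (simp only: sgn_0_0)
  qed
  moreover have "(\<forall>b\<in>Basis. snd p \<bullet> b - g (fst p) \<bullet> b = 0) \<longleftrightarrow> snd p = g (fst p)" for p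
    by (subst euclidean_eq_iff) simp
  ultimately show ?thesis unfolding definable_fun_def by (simp only:)
qed

lemmas definable_fun_linear = definable_fun_poly_map[OF poly_map_linear]

lemma definable_compose:
  assumes "definable P" "definable_fun g"
  shows "definable (\<lambda>x. P (g x))"
proof -
  have "definable (\<lambda>p. snd p = g (fst p) \<and> P (snd p))"
    by (rule definable_conj[OF assms(2)[unfolded definable_fun_def] definable_linear[OF assms(1) linear_snd]])
  from definable_Ex[OF this] show ?thesis by simp
qed

lemma definable_fun_compose:
  fixes g :: "'c::euclidean_space \<Rightarrow> 'b::euclidean_space" and h :: "'a::euclidean_space \<Rightarrow> 'c"
  assumes "definable_fun g" "definable_fun h"
  shows "definable_fun (\<lambda>x. g (h x))"
proof -
  have l: "linear (\<lambda>q::('a \<times> 'b) \<times> 'c. (fst (fst q), snd q))" "linear (\<lambda>q::('a \<times> 'b) \<times> 'c. (snd q, snd (fst q)))"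
    by (simp_all add: linear_iff)
  have "definable (\<lambda>q. snd q = h (fst (fst q)) \<and> snd (fst q) = g (snd q))"
    using definable_conj[OF definable_linear[OF assms(2)[unfolded definable_fun_def] l(1)]
      definable_linear[OF assms(1)[unfolded definable_fun_def] l(2)]] by (simp only: fst_conv snd_conv)
  from definable_Ex[OF this] show ?thesis unfolding definable_fun_def by simp
qed

lemma definable_fun_Pair:
  fixes g :: "'a::euclidean_space \<Rightarrow> 'b::euclidean_space" and h :: "'a \<Rightarrow> 'c::euclidean_space"
  assumes "definable_fun g" "definable_fun h"
  shows "definable_fun (\<lambda>x. (g x, h x))"
proof -
  have l: "linear (\<lambda>q::'a \<times> 'b \<times> 'c. (fst q, fst (snd q)))" "linear (\<lambda>q::'a \<times> 'b \<times> 'c. (fst q, snd (snd q)))"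
    by (simp_all add: linear_iff)
  have "definable (\<lambda>q. fst (snd q) = g (fst q) \<and> snd (snd q) = h (fst q))"
    using definable_conj[OF definable_linear[OF assms(1)[unfolded definable_fun_def] l(1)]
      definable_linear[OF assms(2)[unfolded definable_fun_def] l(2)]] by (simp only: fst_conv snd_conv)
  then show ?thesis unfolding definable_fun_def by (simp add: prod_eq_iff)
qed

lemma definable_fun_const: "definable_fun (\<lambda>x. c)"
  by (intro definable_fun_poly_map) (auto simp: poly_map_def intro: real_poly_fun.const)

lemma definable_fun_id: "definable_fun (\<lambda>x. x)"
  by (intro definable_fun_linear linear_id[unfolded id_def])

lemma definable_fun_fst: "definable_fun g \<Longrightarrow> definable_fun (\<lambda>x. fst (g x))"
  by (rule definable_fun_compose[OF definable_fun_linear[OF linear_fst]])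

lemma definable_fun_snd: "definable_fun g \<Longrightarrow> definable_fun (\<lambda>x. snd (g x))"
  by (rule definable_fun_compose[OF definable_fun_linear[OF linear_snd]])

lemma definable_fun_add:
  assumes "definable_fun g" "definable_fun h"
  shows "definable_fun (\<lambda>x. g x + h x)"
proof -
  have "linear (\<lambda>q::'b \<times> 'b. fst q + snd q)" by (simp add: linear_iff algebra_simps)
  from definable_fun_compose[OF definable_fun_linear[OF this] definable_fun_Pair[OF assms]]
  show ?thesis by simp
qed

lemma definable_fun_minus:
  assumes "definable_fun g"
  shows "definable_fun (\<lambda>x. - g x)"
proof -
  have "linear (\<lambda>q::'b. - q)" by (simp add: linear_iff)
  from definable_fun_compose[OF definable_fun_linear[OF this] assms] show ?thesis .
qed

lemma definable_fun_diff:
  assumes "definable_fun g" "definable_fun h"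
  shows "definable_fun (\<lambda>x. g x - h x)"
  using definable_fun_add[OF assms(1) definable_fun_minus[OF assms(2)]] by simp

lemma definable_fun_scaleR:
  assumes "definable_fun g" "definable_fun h"
  shows "definable_fun (\<lambda>x. g x *\<^sub>R h x)"
proof -
  have "poly_map (\<lambda>q::real \<times> 'b. fst q *\<^sub>R snd q)"
    unfolding poly_map_def inner_scaleR_left
  proof (intro ballI real_poly_fun.mult)
    have "poly_map (fst :: real \<times> 'b \<Rightarrow> real)" by (rule poly_map_linear[OF linear_fst])
    then show "real_poly_fun (fst :: real \<times> 'b \<Rightarrow> real)" by (simp only: poly_map_real)
    show "real_poly_fun (\<lambda>q::real \<times> 'b. snd q \<bullet> b)" if "b \<in> Basis" for b
      using poly_map_linear[OF linear_snd] that unfolding poly_map_def by (rule bspec)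
  qed
  from definable_fun_compose[OF definable_fun_poly_map[OF this] definable_fun_Pair[OF assms]]
  show ?thesis by simp
qed

lemma definable_fun_mult:
  fixes g h :: "'a::euclidean_space \<Rightarrow> real"
  assumes "definable_fun g" "definable_fun h"
  shows "definable_fun (\<lambda>x. g x * h x)"
  using definable_fun_scaleR[OF assms] by simp

lemma definable_fun_inner:
  assumes "definable_fun g"
  shows "definable_fun (\<lambda>x. g x \<bullet> b)"
proof -
  have "linear (\<lambda>q. q \<bullet> b)" by (simp add: linear_iff inner_left_distrib)
  from definable_fun_compose[OF definable_fun_linear[OF this] assms] show ?thesis .
qed

lemma definable_less:
  fixes g h :: "'a::euclidean_space \<Rightarrow> real"
  assumes "definable_fun g" "definable_fun h"
  shows "definable (\<lambda>x. g x < h x)"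
proof -
  have "real_poly_fun (\<lambda>x::real. x)" using real_poly_fun.coord[of "1::real"] by simp
  from definable_compose[OF definable_sgn[OF this, of "\<lambda>s. s = 1"] definable_fun_diff[OF assms(2,1)]]
  show ?thesis by (simp add: sgn_1_pos)
qed

lemma definable_le:
  fixes g h :: "'a::euclidean_space \<Rightarrow> real"
  assumes "definable_fun g" "definable_fun h"
  shows "definable (\<lambda>x. g x \<le> h x)"
  using definable_not[OF definable_less[OF assms(2,1)]] by (simp add: not_less)

lemma definable_eq:
  assumes "definable_fun g" "definable_fun h"
  shows "definable (\<lambda>x. g x = h x)"
  using definable_compose[OF assms(1)[unfolded definable_fun_def] definable_fun_Pair[OF definable_fun_id assms(2)]]
  by (simp add: eq_commute)

text \<open>The norm is not polynomial, but its graph has polynomial conditions: a nonnegative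
  number whose square is \<open>x \<bullet> x\<close>.\<close>

lemma definable_fun_norm:
  assumes "definable_fun g"
  shows "definable_fun (\<lambda>x. norm (g x))"
proof -
  have "real_poly_fun (\<lambda>x::'b. \<Sum>b\<in>Basis. (x \<bullet> b) * (x \<bullet> b))"
    by (intro real_poly_fun_sum real_poly_fun.mult real_poly_fun.coord) auto
  then have "definable_fun (\<lambda>x::'b. x \<bullet> x)"
    by (intro definable_fun_poly_map) (simp add: poly_map_real euclidean_inner[symmetric])
  from definable_fun_compose[OF this definable_fun_fst[OF definable_fun_id]]
  have "definable (\<lambda>p::'b \<times> real. 0 \<le> snd p \<and> snd p * snd p = fst p \<bullet> fst p)"
    by (intro definable_conj definable_le definable_eq definable_fun_mult definable_fun_snd definable_fun_id definable_fun_const)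
  moreover have "0 \<le> snd p \<and> snd p * snd p = fst p \<bullet> fst p \<longleftrightarrow> snd p = norm (fst p)" for p :: "'b \<times> real"
    by (auto simp: power2_norm_eq_inner[symmetric] power2_eq_square intro: power2_eq_imp_eq)
  ultimately have "definable_fun (norm :: 'b \<Rightarrow> real)" unfolding definable_fun_def by simp
  from definable_fun_compose[OF this assms] show ?thesis .
qed

lemma definable_fun_abs:
  fixes g :: "'a::euclidean_space \<Rightarrow> real"
  assumes "definable_fun g"
  shows "definable_fun (\<lambda>x. \<bar>g x\<bar>)"
  using definable_fun_norm[OF assms] by simp

text \<open>The filter unfolds to a first-order formula with a bound \<open>b > 0\<close>, so
  one-sided slope conditions, also nested ones, stay definable.\<close>

lemma definable_eventually_right:
  fixes P :: "'a::euclidean_space \<Rightarrow> real \<Rightarrow> bool"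
  assumes "definable (\<lambda>p. P (fst p) (snd p))"
  shows "definable (\<lambda>x. \<forall>\<^sub>F h in at_right (0::real). P x h)"
proof -
  have l: "linear (\<lambda>q::('a \<times> real) \<times> real. (fst (fst q), snd q))" by (simp add: linear_iff)
  have P: "definable (\<lambda>q::('a \<times> real) \<times> real. P (fst (fst q)) (snd q))" using definable_linear[OF assms l] by simp
  show ?thesis unfolding eventually_at_right_field
    by (intro definable_Ex definable_conj definable_All definable_imp definable_less P
        definable_fun_fst definable_fun_snd definable_fun_id definable_fun_const)
qed

lemma definable_fun_if:
  assumes "definable C" "definable_fun g" "definable_fun h"
  shows "definable_fun (\<lambda>x. if C x then g x else h x)"
proof -
  have "definable (\<lambda>p. (C (fst p) \<and> snd p = g (fst p)) \<or> (\<not> C (fst p) \<and> snd p = h (fst p)))"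
    by (intro definable_disj definable_conj definable_not definable_linear[OF assms(1) linear_fst]
        assms(2,3)[unfolded definable_fun_def])
  then show ?thesis unfolding definable_fun_def by (rule back_subst[of definable]) auto
qed

lemmas definable_intros = definable_const definable_not definable_conj definable_disj definable_imp
  definable_Ex definable_All definable_less definable_le definable_eq definable_eventually_right
  definable_fun_const definable_fun_id definable_fun_fst definable_fun_snd definable_fun_Pair
  definable_fun_add definable_fun_minus definable_fun_diff definable_fun_scaleR definable_fun_mult
  definable_fun_inner definable_fun_norm definable_fun_abs definable_fun_if

lemma definable_slice:
  assumes "definable (\<lambda>p. P (fst p) (snd p))"
  shows "definable (P x)"
  using definable_compose[OF assms definable_fun_Pair[OF definable_fun_const[of x] definable_fun_id]] by simp

lemma definable_compose2:
  assumes "definable (\<lambda>p. P (fst p) (snd p))" "definable_fun g" "definable_fun h"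
  shows "definable (\<lambda>x. P (g x) (h x))"
  using definable_compose[OF assms(1) definable_fun_Pair[OF assms(2,3)]] by simp

lemma definable_fun_compose2:
  assumes "definable_fun (\<lambda>p. f (fst p) (snd p))" "definable_fun g" "definable_fun h"
  shows "definable_fun (\<lambda>x. f (g x) (h x))"
  using definable_fun_compose[OF assms(1) definable_fun_Pair[OF assms(2,3)]] by simp

lemma semialgebraic_imp_definable:
  assumes "semialgebraic S"
  shows "definable (\<lambda>x. x \<in> S)"
proof -
  have "definable (\<lambda>x. x \<in> B)" if bs: "basic_semialgebraic B" for B :: "'a set"
  proof -
    obtain E L N where B: "finite E" "finite L" "finite N"
      "\<forall>p\<in>E. real_poly_fun p" "\<forall>p\<in>L. real_poly_fun p" "\<forall>p\<in>N. real_poly_fun p"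
      "B = {x. (\<forall>p\<in>E. p x = 0) \<and> (\<forall>p\<in>L. p x < 0) \<and> (\<forall>p\<in>N. p x \<le> 0)}"
      using bs unfolding basic_semialgebraic_def by (elim exE conjE) (rule that)
    have *: "definable_fun p" if "real_poly_fun p" for p :: "'a \<Rightarrow> real"
      using that by (intro definable_fun_poly_map) (simp only: poly_map_real)
    have "definable (\<lambda>x. (\<forall>p\<in>E. p x = 0) \<and> (\<forall>p\<in>L. p x < 0) \<and> (\<forall>p\<in>N. p x \<le> 0))"
      by (intro definable_conj definable_Ball_finite definable_less definable_le definable_eq definable_fun_const
          * B(1-3) B(4-6)[rule_format])
    then show ?thesis unfolding B(7) mem_Collect_eq .
  qed
  moreover obtain \<F> where F: "finite \<F>" "\<forall>B\<in>\<F>. basic_semialgebraic B" "S = \<Union>\<F>"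
    using assms unfolding semialgebraic_def by blast
  ultimately have "definable (\<lambda>x. \<exists>B\<in>\<F>. x \<in> B)"
    by (intro definable_Bex_finite) (simp_all only:)
  then show ?thesis using F(3) by (simp only: Union_iff)
qed

lemma semialgebraic_fun_imp_definable_fun:
  assumes "semialgebraic_fun f"
  shows "definable_fun f"
proof -
  have "(p \<in> {(x, f x) |x. True}) = (snd p = f (fst p))" for p by (cases p) auto
  then show ?thesis using semialgebraic_imp_definable[OF assms[unfolded semialgebraic_fun_def]]
    unfolding definable_fun_def by (simp only:)
qed

section \<open>Definable sets of real numbers\<close>

lemma real_poly_fun_real_as_poly:
  fixes t :: "real \<Rightarrow> real"
  assumes "real_poly_fun t"
  shows "\<exists>p. t = poly p"
  using assms
proof induction
  case (const c)
  then show ?case by (intro exI[of _ "[:c:]"]) auto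
next
  case (coord b)
  then show ?case by (intro exI[of _ "[:0, 1:]"]) auto
next
  case (add p q)
  then obtain p1 q1 where "p = poly p1" "q = poly q1" by blast
  then show ?case by (intro exI[of _ "p1 + q1"]) auto
next
  case (mult p q)
  then obtain p1 q1 where "p = poly p1" "q = poly q1" by blast
  then show ?case by (intro exI[of _ "p1 * q1"]) auto
qed

lemma poly_sgn_constant_right:
  fixes p :: "real poly"
  shows "\<exists>\<delta>>0. \<forall>h\<in>{0<..<\<delta>}. \<forall>h'\<in>{0<..<\<delta>}. sgn (poly p h) = sgn (poly p h')"
proof (cases "p = 0")
  case True
  then show ?thesis by (intro exI[of _ 1]) auto
next
  case False
  define \<delta> where "\<delta> = Min (insert 1 {x. poly p x = 0 \<and> 0 < x})"
  have fin: "finite (insert 1 {x. poly p x = 0 \<and> 0 < x})"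
    using poly_roots_finite[OF False] by simp
  have "\<delta> \<in> insert 1 {x. poly p x = 0 \<and> 0 < x}" unfolding \<delta>_def using fin by (rule Min_in) simp
  then have "\<delta> > 0" by auto
  moreover have "poly p w \<noteq> 0" if "0 < w" "w < \<delta>" for w
  proof
    assume "poly p w = 0"
    then have "\<delta> \<le> w" unfolding \<delta>_def using fin that by (intro Min_le) auto
    then show False using that by simp
  qed
  ultimately show ?thesis by (intro exI[of _ \<delta>]) (auto intro!: poly_no_root_sgn)
qed

text \<open>Each of the finitely many tests has constant sign just to the right of 0, because a
  nonzero polynomial has finitely many roots; on a common interval these signs decide
  \<open>P\<close> once and for all.\<close>

lemma definable_dichotomy:
  fixes P :: "real \<Rightarrow> bool"
  assumes "definable P"
  shows "(\<forall>\<^sub>F h in at_right 0. P h) \<or> (\<forall>\<^sub>F h in at_right 0. \<not> P h)"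
proof -
  obtain T where T': "finite T" "\<forall>t\<in>T. real_poly_fun t" "\<forall>x x'. same_signs T x x' \<longrightarrow> P x = P x'"
    by (rule definableE[OF assms])
  note T = T'(1) T'(2)[rule_format] T'(3)[rule_format]
  have "\<forall>t\<in>T. \<exists>\<delta>>0. \<forall>h\<in>{0<..<\<delta>}. \<forall>h'\<in>{0<..<\<delta>}. sgn (t h) = sgn (t h')"
  proof
    fix t assume "t \<in> T"
    then obtain p where "t = poly p" using real_poly_fun_real_as_poly[OF T(2)] by blast
    then show "\<exists>\<delta>>0. \<forall>h\<in>{0<..<\<delta>}. \<forall>h'\<in>{0<..<\<delta>}. sgn (t h) = sgn (t h')"
      using poly_sgn_constant_right[of p] by (simp only:)
  qed
  from bchoice[OF this] obtain d where
    d: "\<forall>t\<in>T. d t > 0 \<and> (\<forall>h\<in>{0<..<d t}. \<forall>h'\<in>{0<..<d t}. sgn (t h) = sgn (t h'))" ..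
  define \<delta> where "\<delta> = Min (insert 1 (d ` T))"
  have "\<delta> \<in> insert 1 (d ` T)" unfolding \<delta>_def using T(1) by (intro Min_in) auto
  then have "\<delta> > 0" using d by auto
  have dl: "\<delta> \<le> d t" if "t \<in> T" for t unfolding \<delta>_def using T(1) that by (intro Min_le) auto
  have "same_signs T h h'" if "0 < h" "h < \<delta>" "0 < h'" "h' < \<delta>" for h h'
    unfolding same_signs_def
  proof
    fix t assume t: "t \<in> T"
    have "h \<in> {0<..<d t}" "h' \<in> {0<..<d t}" using that dl[OF t] by auto
    then show "sgn (t h) = sgn (t h')" using bspec[OF d t] by blast
  qed
  then have eq: "P h' = P (\<delta> / 2)" if "0 < h'" "h' < \<delta>" for h'
    using that \<open>\<delta> > 0\<close> by (intro T(3)) auto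
  show ?thesis
  proof (cases "P (\<delta> / 2)")
    case True
    then have "\<forall>\<^sub>F h in at_right 0. P h"
      using eq \<open>\<delta> > 0\<close> unfolding eventually_at_right_field by blast
    then show ?thesis ..
  next
    case False
    then have "\<forall>\<^sub>F h in at_right 0. \<not> P h"
      using eq \<open>\<delta> > 0\<close> unfolding eventually_at_right_field by blast
    then show ?thesis ..
  qed
qed

lemma definable_dichotomy_param:
  assumes "definable (\<lambda>p. P (fst p) (snd p))"
  shows "(\<forall>\<^sub>F h in at_right (0::real). P x h) \<or> (\<forall>\<^sub>F h in at_right 0. \<not> P x h)"
  by (rule definable_dichotomy[OF definable_slice[OF assms]])

text \<open>A definable set without interior points is right-isolated at each of its points, hence countable.\<close>

lemma definable_cover_interval:
  fixes E :: "'i::countable \<Rightarrow> real \<Rightarrow> bool"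
  assumes def: "\<And>k. definable (E k)" and "p < q" and cov: "\<And>x. p < x \<Longrightarrow> x < q \<Longrightarrow> \<exists>k. E k x"
  obtains k p' q' where "p \<le> p'" "p' < q'" "q' \<le> q" "\<forall>x. p' < x \<and> x < q' \<longrightarrow> E k x"
proof -
  have "\<exists>k p' q'. p \<le> p' \<and> p' < q' \<and> q' \<le> q \<and> (\<forall>x. p' < x \<and> x < q' \<longrightarrow> E k x)"
  proof (rule ccontr)
    assume no: "\<not> (\<exists>k p' q'. p \<le> p' \<and> p' < q' \<and> q' \<le> q \<and> (\<forall>x. p' < x \<and> x < q' \<longrightarrow> E k x))"
    have cnt: "countable {x\<in>{p<..<q}. E k x}" for k
    proof -
      \<comment> \<open>An interval inside \<open>E k\<close> is excluded, so \<open>E k\<close>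
        fails just to the right of \<open>x\<close>, up to a rational \<open>r\<close>. Distinct
        points of \<open>E k\<close> get distinct rationals, since a later point \<open>y\<close> of
        \<open>E k\<close> satisfies \<open>r x < y < r y\<close>.\<close>
      have "\<exists>r. r \<in> \<rat> \<and> x < r \<and> (\<forall>y. x < y \<and> y \<le> r \<longrightarrow> \<not> E k y)" if x: "p < x" "x < q" for x
      proof -
        have "definable (\<lambda>h. E k (x + h))"
          by (rule definable_compose[OF def]) (intro definable_intros)
        from definable_dichotomy[OF this] show ?thesis
        proof
          assume "\<forall>\<^sub>F h in at_right 0. E k (x + h)"
          then obtain d where d: "d > 0" "\<And>h. 0 < h \<Longrightarrow> h < d \<Longrightarrow> E k (x + h)"
            unfolding eventually_at_right_field by auto
          have "E k y" if "x < y" "y < min q (x + d)" for y using d(2)[of "y - x"] that by simp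
          moreover have "x < min q (x + d)" using x d by simp
          ultimately show ?thesis using no x by (meson less_imp_le min.cobounded1)
        next
          assume "\<forall>\<^sub>F h in at_right 0. \<not> E k (x + h)"
          then obtain d where d: "d > 0" "\<And>h. 0 < h \<Longrightarrow> h < d \<Longrightarrow> \<not> E k (x + h)"
            unfolding eventually_at_right_field by auto
          obtain r where r: "r \<in> \<rat>" "x < r" "r < x + d" using Rats_dense_in_real[of x "x + d"] d by auto
          have "\<not> E k y" if "x < y" "y \<le> r" for y using d(2)[of "y - x"] that r by simp
          then show ?thesis using r by blast
        qed
      qed
      then obtain r where r: "\<And>x. p < x \<Longrightarrow> x < q \<Longrightarrow> r x \<in> \<rat> \<and> x < r x \<and> (\<forall>y. x < y \<and> y \<le> r x \<longrightarrow> \<not> E k y)"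
        by metis
      have "inj_on r {x\<in>{p<..<q}. E k x}"
      proof (rule linorder_inj_onI)
        fix x y assume xy: "x < y" "x \<in> {x\<in>{p<..<q}. E k x}" "y \<in> {x\<in>{p<..<q}. E k x}"
        then have "r x < y" using r[of x] by force
        also have "y < r y" using r[of y] xy by simp
        finally show "r x \<noteq> r y" by simp
      qed auto
      moreover have "r ` {x\<in>{p<..<q}. E k x} \<subseteq> \<rat>" using r by auto
      ultimately show ?thesis using countable_rat by (meson countable_image_inj_on countable_subset)
    qed
    have "{p<..<q} \<subseteq> (\<Union>k. {x\<in>{p<..<q}. E k x})" using cov by auto
    moreover have "countable (\<Union>k. {x\<in>{p<..<q}. E k x})" using cnt by simp
    ultimately have "countable {p<..<q}" using countable_subset by blast
    then show False using \<open>p < q\<close> uncountable_open_interval by blast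
  qed
  then show thesis using that by blast
qed

section \<open>Definable selection\<close>

lemma definable_fun_of_graph:
  fixes R :: "'a::euclidean_space \<Rightarrow> 'b::euclidean_space \<Rightarrow> bool"
  assumes R: "definable (\<lambda>p. R (fst p) (snd p))"
    and ex: "\<And>x. \<exists>v. R x v" and uniq: "\<And>x v w. R x v \<Longrightarrow> R x w \<Longrightarrow> v = w"
  obtains s where "definable_fun s" "\<forall>x. R x (s x)"
proof -
  have "\<forall>x. \<exists>v. R x v" by (rule allI[OF ex])
  from choice[OF this] obtain s where s: "\<forall>x. R x (s x)" ..
  have "R (fst p) (snd p) \<longleftrightarrow> snd p = s (fst p)" for p
  proof
    assume "R (fst p) (snd p)"
    then show "snd p = s (fst p)" by (rule uniq[OF _ spec[OF s]])
  next
    assume "snd p = s (fst p)"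
    then show "R (fst p) (snd p)" using spec[OF s, of "fst p"] by (simp only:)
  qed
  then have "definable_fun s" using R unfolding definable_fun_def by (simp only:)
  then show thesis using s by (rule that)
qed

text \<open>Selection needs a canonical value: \<open>R\<close> describes the largest
  \<open>v \<le> 1\<close> such that \<open>Q\<close> holds on (0, v), which is unique and hence a
  definable function of \<open>x\<close>; half of it lies where \<open>Q\<close> holds.\<close>

lemma definable_choice_right:
  fixes Q :: "'a::euclidean_space \<Rightarrow> real \<Rightarrow> bool"
  assumes Q: "definable (\<lambda>p. Q (fst p) (snd p))"
  obtains s where "definable_fun s" "\<forall>x. (\<forall>\<^sub>F h in at_right 0. Q x h) \<longrightarrow> Q x (s x)"
proof -
  define ev where "ev = (\<lambda>x. \<forall>\<^sub>F h in at_right 0. Q x h)"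
  define B where "B = (\<lambda>x v. \<forall>h. 0 < h \<and> h < v \<longrightarrow> Q x h)"
  \<comment> \<open>The cap 1 keeps the largest value finite when \<open>Q\<close> holds for all
    positive \<open>h\<close>; the value 0 is the default where \<open>Q\<close> does not hold for
    all small \<open>h\<close>.\<close>
  define R where "R = (\<lambda>x v. ev x \<and> 0 < v \<and> v \<le> 1 \<and> B x v \<and> (\<forall>w. v < w \<and> w \<le> 1 \<longrightarrow> \<not> B x w) \<or> \<not> ev x \<and> v = 0)"
  have ex: "\<exists>v. R x v" for x
  proof (cases "ev x")
    case True
    define A where "A = {v. 0 < v \<and> v \<le> 1 \<and> B x v}"
    obtain d where d: "d > 0" "\<forall>h>0. h < d \<longrightarrow> Q x h"
      using True unfolding ev_def eventually_at_right_field by auto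
    then have "B x (min d 1)" unfolding B_def by simp
    then have A: "min d 1 \<in> A" using d(1) by (simp add: A_def)
    then have ne: "A \<noteq> {}" by blast
    have bdd: "bdd_above A" by (intro bdd_aboveI[of _ 1]) (simp add: A_def)
    have up: "v \<le> Sup A" if "v \<in> A" for v using that bdd by (rule cSup_upper)
    have pos: "0 < Sup A" using up[OF A] d(1) by linarith
    moreover have "Sup A \<le> 1" by (rule cSup_least[OF ne]) (simp add: A_def)
    moreover have "B x (Sup A)"
      unfolding B_def
    proof (intro allI impI)
      fix h assume h: "0 < h \<and> h < Sup A"
      then obtain v where "v \<in> A" "h < v" using less_cSupD[OF ne] by blast
      then show "Q x h" using h by (simp add: A_def B_def)
    qed
    moreover have "\<not> B x w" if "Sup A < w" "w \<le> 1" for w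
      using up[of w] that pos by (auto simp: A_def)
    ultimately have "R x (Sup A)" using True by (simp add: R_def)
    then show ?thesis ..
  next
    case False
    then show ?thesis by (simp add: R_def)
  qed
  have le: "w \<le> v" if "R x v" "R x w" for x v w
    using that by (cases "ev x") (auto simp: R_def not_le[symmetric])
  have uniq: "v = w" if "R x v" "R x w" for x v w
    using le[OF that] le[OF that(2,1)] by (rule order_antisym[rotated])
  have "definable (\<lambda>p. R (fst p) (snd p))" unfolding R_def ev_def B_def
    by (intro definable_intros definable_compose2[OF Q])
  then obtain s where s: "definable_fun s" "\<forall>x. R x (s x)"
    using ex uniq by (rule definable_fun_of_graph)
  have "definable_fun (\<lambda>x. (1/2) * s x)" by (intro definable_intros s(1))
  moreover have "Q x ((1/2) * s x)" if "ev x" for x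
  proof -
    have "0 < s x" "B x (s x)" using spec[OF s(2), of x] that by (simp_all add: R_def)
    then show ?thesis by (simp add: B_def)
  qed
  then have "\<forall>x. (\<forall>\<^sub>F h in at_right 0. Q x h) \<longrightarrow> Q x ((1/2) * s x)" by (simp add: ev_def)
  ultimately show thesis by (rule that)
qed

text \<open>Let \<open>m x\<close> be the infimum of the absolute values of the solutions. Either
  \<open>m x\<close> or \<open>- m x\<close> is a solution, or solutions accumulate at one of them
  from outside; by the dichotomy they then include \<open>m x + h\<close>, or
  \<open>- (m x + h)\<close>, for all small \<open>h > 0\<close>, where
  \<open>definable_choice_right\<close> applies.\<close>

lemma definable_choice_real:
  fixes P :: "'a::euclidean_space \<Rightarrow> real \<Rightarrow> bool"
  assumes P: "definable (\<lambda>p. P (fst p) (snd p))"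
  obtains s where "definable_fun s" "\<forall>x. (\<exists>y. P x y) \<longrightarrow> P x (s x)"
proof -
  define ne where "ne = (\<lambda>x. \<exists>y. P x y)"
  define lb where "lb = (\<lambda>x v. \<forall>y. P x y \<longrightarrow> v \<le> \<bar>y\<bar>)"
  define near where "near = (\<lambda>x v. \<exists>y. P x y \<and> \<bar>y\<bar> < v)"
  define R where "R = (\<lambda>x v. ne x \<and> lb x v \<and> (\<forall>e. 0 < e \<longrightarrow> near x (v + e)) \<or> \<not> ne x \<and> v = 0)"
  have ex: "\<exists>v. R x v" for x
  proof (cases "ne x")
    case True
    define A where "A = {\<bar>y\<bar> |y. P x y}"
    have A: "A \<noteq> {}" using True by (auto simp: A_def ne_def)
    have bdd: "bdd_below A" by (rule bdd_belowI[of _ 0]) (auto simp: A_def)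
    have "lb x (Inf A)" unfolding lb_def
    proof (intro allI impI)
      fix y assume "P x y"
      then show "Inf A \<le> \<bar>y\<bar>" by (intro cInf_lower[OF _ bdd]) (auto simp: A_def)
    qed
    moreover have "near x (Inf A + e)" if e: "0 < e" for e
    proof -
      obtain a where "a \<in> A" "a < Inf A + e" using cInf_lessD[OF A, of "Inf A + e"] e by auto
      then show ?thesis by (auto simp: A_def near_def)
    qed
    ultimately have "R x (Inf A)" using True by (simp add: R_def)
    then show ?thesis ..
  next
    case False
    then show ?thesis by (simp add: R_def)
  qed
  have le: "v \<le> w" if "R x v" "R x w" for x v w
  proof (cases "ne x")
    case True
    show ?thesis
    proof (rule field_le_epsilon)
      fix e :: real assume "e > 0"
      then have "near x (w + e)" "lb x v" using that True by (simp_all add: R_def)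
      then obtain y where "v \<le> \<bar>y\<bar>" "\<bar>y\<bar> < w + e" unfolding near_def lb_def by blast
      then show "v \<le> w + e" by simp
    qed
  next
    case False
    then show ?thesis using that by (simp add: R_def)
  qed
  have uniq: "v = w" if "R x v" "R x w" for x v w
    using le[OF that] le[OF that(2,1)] by (rule order_antisym)
  have "definable (\<lambda>p. R (fst p) (snd p))" unfolding R_def ne_def lb_def near_def
    by (intro definable_intros definable_compose2[OF P])
  then obtain m where m: "definable_fun m" and mR: "\<forall>x. R x (m x)"
    using ex uniq by (rule definable_fun_of_graph)
  have def1: "definable (\<lambda>p. P (fst p) (m (fst p) + snd p))" and def2: "definable (\<lambda>p. P (fst p) (- (m (fst p) + snd p)))"
    by (intro definable_intros definable_compose2[OF P] definable_fun_compose[OF m])+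
  obtain s1 where s1: "definable_fun s1" "\<forall>x. (\<forall>\<^sub>F h in at_right 0. P x (m x + h)) \<longrightarrow> P x (m x + s1 x)"
    by (rule definable_choice_right[of "\<lambda>x h. P x (m x + h)", OF def1])
  obtain s2 where s2: "definable_fun s2" "\<forall>x. (\<forall>\<^sub>F h in at_right 0. P x (- (m x + h))) \<longrightarrow> P x (- (m x + s2 x))"
    by (rule definable_choice_right[of "\<lambda>x h. P x (- (m x + h))", OF def2])
  define s where "s = (\<lambda>x. if P x (m x) then m x else if P x (- m x) then - m x
     else if P x (m x + s1 x) then m x + s1 x else - (m x + s2 x))"
  have "definable_fun s" unfolding s_def
    by (intro definable_intros definable_compose2[OF P] m s1(1) s2(1))
  moreover have "P x (s x)" if nex: "\<exists>y. P x y" for x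
  proof (rule ccontr)
    assume "\<not> P x (s x)"
    \<comment> \<open>If all four candidates fail, no solution has absolute value in [m x, m x + d)
      for some \<open>d > 0\<close>, against \<open>m x\<close> being the infimum.\<close>
    then have n: "\<not> P x (m x)" "\<not> P x (- m x)" "\<not> P x (m x + s1 x)" "\<not> P x (- (m x + s2 x))"
      unfolding s_def by (simp_all split: if_splits)
    have "\<forall>\<^sub>F h in at_right 0. \<not> P x (m x + h)"
      using definable_dichotomy_param[of "\<lambda>x h. P x (m x + h)", OF def1, of x] spec[OF s1(2), of x] n(3) by blast
    moreover have "\<forall>\<^sub>F h in at_right 0. \<not> P x (- (m x + h))"
      using definable_dichotomy_param[of "\<lambda>x h. P x (- (m x + h))", OF def2, of x] spec[OF s2(2), of x] n(4) by blast
    ultimately have "\<forall>\<^sub>F h in at_right 0. \<not> P x (m x + h) \<and> \<not> P x (- (m x + h))"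
      by (rule eventually_conj)
    then obtain d where d: "d > 0" "\<forall>h>0. h < d \<longrightarrow> \<not> P x (m x + h) \<and> \<not> P x (- (m x + h))"
      unfolding eventually_at_right_field by auto
    have "ne x" using nex by (simp add: ne_def)
    then have "near x (m x + d)" "lb x (m x)" using spec[OF mR, of x] d(1) by (simp_all add: R_def)
    then obtain y where y: "P x y" "\<bar>y\<bar> < m x + d" "m x \<le> \<bar>y\<bar>"
      unfolding near_def lb_def by blast
    have "y \<noteq> m x" "y \<noteq> - m x" using n y by auto
    then have "0 < \<bar>y\<bar> - m x" using y(3) by linarith
    then have "\<not> P x \<bar>y\<bar> \<and> \<not> P x (- \<bar>y\<bar>)" using spec[OF d(2), of "\<bar>y\<bar> - m x"] y(2) by simp
    then show False using y(1) by (cases "y \<ge> 0") auto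
  qed
  then have "\<forall>x. (\<exists>y. P x y) \<longrightarrow> P x (s x)" by blast
  ultimately show thesis by (rule that)
qed

text \<open>One coordinate after another, with an offset as in \<open>definable_Ex_span\<close>:
  \<open>D p t\<close> says that \<open>t\<close> is a coordinate along \<open>b\<close> which the
  remaining directions can complete to a solution.\<close>

lemma definable_choice:
  fixes P :: "'a::euclidean_space \<Rightarrow> 'b::euclidean_space \<Rightarrow> bool"
  assumes P: "definable (\<lambda>p. P (fst p) (snd p))"
  obtains s where "definable_fun s" "\<forall>x y. P x y \<longrightarrow> P x (s x)"
proof -
  have "\<exists>s::'a \<times> 'b \<Rightarrow> 'b. definable_fun s \<and> (\<forall>x y. \<forall>z\<in>span B. P x (y + z) \<longrightarrow> P x (y + s (x, y)))"
    if "finite B" for B :: "'b set"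
    using that
  proof (induction rule: finite_induct)
    case empty
    show ?case by (intro exI[of _ "\<lambda>p. 0"] conjI definable_fun_const) simp
  next
    case (insert b B)
    from insert.IH obtain s :: "'a \<times> 'b \<Rightarrow> 'b"
      where s: "definable_fun s" "\<forall>x y. \<forall>z\<in>span B. P x (y + z) \<longrightarrow> P x (y + s (x, y))"
      by (elim exE conjE)
    define D where "D = (\<lambda>p t. \<exists>z\<in>span B. P (fst p) ((snd p + t *\<^sub>R b) + z))"
    have "definable_fun (\<lambda>q::('a \<times> 'b) \<times> real. (fst (fst q), snd (fst q) + snd q *\<^sub>R b))"
      by (intro definable_intros)
    from definable_compose[OF definable_Ex_span[OF insert.hyps(1) P] this]
    have "definable (\<lambda>q. D (fst q) (snd q))" unfolding D_def by (simp only: fst_conv snd_conv)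
    then obtain c where c: "definable_fun c" "\<forall>p. (\<exists>t. D p t) \<longrightarrow> D p (c p)"
      by (rule definable_choice_real)
    define s' where "s' = (\<lambda>p. c p *\<^sub>R b + s (fst p, snd p + c p *\<^sub>R b))"
    have "definable_fun s'" unfolding s'_def
      by (intro definable_intros c(1) definable_fun_compose[OF s(1)])
    moreover have "P x (y + s' (x, y))" if z: "z \<in> span (insert b B)" "P x (y + z)" for x y z
    proof -
      obtain k where k: "z - k *\<^sub>R b \<in> span B" using z(1) span_breakdown_eq by blast
      have "D (x, y) k" unfolding D_def using k z(2) by (intro bexI[of _ "z - k *\<^sub>R b"]) simp_all
      then have "D (x, y) (c (x, y))" using c(2) by blast
      then obtain w where w: "w \<in> span B" "P x ((y + c (x, y) *\<^sub>R b) + w)" unfolding D_def by auto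
      have "P x ((y + c (x, y) *\<^sub>R b) + s (x, y + c (x, y) *\<^sub>R b))"
        using s(2) w by blast
      then show ?thesis by (simp add: s'_def add.assoc)
    qed
    ultimately show ?case by (intro exI[of _ s']) blast
  qed
  from this[OF finite_Basis] obtain s :: "'a \<times> 'b \<Rightarrow> 'b"
    where s: "definable_fun s" "\<forall>x y. \<forall>z\<in>span Basis. P x (y + z) \<longrightarrow> P x (y + s (x, y))"
    by (elim exE conjE)
  have "definable_fun (\<lambda>x. s (x, 0))" by (intro definable_intros definable_fun_compose[OF s(1)])
  moreover have "P x (s (x, 0))" if "P x y" for x y
    using s(2)[THEN spec, THEN spec, THEN bspec, of y x 0] that by simp
  then have "\<forall>x y. P x y \<longrightarrow> P x (s (x, 0))" by blast
  ultimately show thesis by (rule that)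
qed

section \<open>Maxima over balls\<close>

text \<open>Let \<sigma> be the supremum of the points \<open>s\<close> with
  \<open>F a \<le> F s\<close>. The condition \<open>left\<close> forbids a downward jump on arrival
  and gives \<open>F a \<le> F \<sigma>\<close>; the condition \<open>right\<close> then leads
  beyond \<sigma> unless \<open>\<sigma> = b\<close>. Upward jumps do no harm.\<close>

lemma right_nondecreasing_imp_le:
  fixes F :: "real \<Rightarrow> real"
  assumes "a \<le> b"
    and right: "\<And>s. a \<le> s \<Longrightarrow> s < b \<Longrightarrow> \<forall>\<^sub>F h in at_right 0. F s \<le> F (s + h)"
    and left: "\<And>s e. a < s \<Longrightarrow> s \<le> b \<Longrightarrow> e > 0 \<Longrightarrow> \<forall>\<^sub>F h in at_right 0. F (s - h) \<le> F s + e"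
  shows "F a \<le> F b"
proof -
  define A where "A = {s\<in>{a..b}. F a \<le> F s}"
  define \<sigma> where "\<sigma> = Sup A"
  have aA: "a \<in> A" using assms(1) by (simp add: A_def)
  then have ne: "A \<noteq> {}" by blast
  have bdd: "bdd_above A" by (rule bdd_aboveI[of _ b]) (simp add: A_def)
  have up: "s \<le> \<sigma>" if "s \<in> A" for s unfolding \<sigma>_def using that bdd by (rule cSup_upper)
  have \<sigma>b: "\<sigma> \<le> b" unfolding \<sigma>_def by (rule cSup_least[OF ne]) (simp add: A_def)
  have a\<sigma>: "a \<le> \<sigma>" by (rule up[OF aA])
  have F\<sigma>: "F a \<le> F \<sigma>"
  proof (cases "\<sigma> = a")
    case False
    then have "a < \<sigma>" using a\<sigma> by simp
    show ?thesis
    proof (rule field_le_epsilon)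
      fix e :: real assume "e > 0"
      from left[OF \<open>a < \<sigma>\<close> \<sigma>b this] obtain d where d: "d > 0" "\<forall>h>0. h < d \<longrightarrow> F (\<sigma> - h) \<le> F \<sigma> + e"
        unfolding eventually_at_right_field by auto
      obtain s where s: "s \<in> A" "\<sigma> - d < s" using less_cSupD[OF ne, of "\<sigma> - d"] d(1) unfolding \<sigma>_def by auto
      have "F s \<le> F \<sigma> + e"
      proof (cases "s = \<sigma>")
        case True
        then show ?thesis using \<open>e > 0\<close> by simp
      next
        case False
        then show ?thesis using up[OF s(1)] s(2) spec[OF d(2), of "\<sigma> - s"] by simp
      qed
      then show "F a \<le> F \<sigma> + e" using s(1) by (simp add: A_def)
    qed
  qed simp
  have "\<sigma> = b"
  proof (rule ccontr)
    assume "\<sigma> \<noteq> b"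
    then have "\<sigma> < b" using \<sigma>b by simp
    from right[OF a\<sigma> this] obtain d where d: "d > 0" "\<forall>h>0. h < d \<longrightarrow> F \<sigma> \<le> F (\<sigma> + h)"
      unfolding eventually_at_right_field by auto
    define h where "h = min (d / 2) (b - \<sigma>)"
    have h: "0 < h" "h < d" "h \<le> b - \<sigma>" using d(1) \<open>\<sigma> < b\<close> by (auto simp: h_def)
    then have "F \<sigma> \<le> F (\<sigma> + h)" using d(2) by blast
    then have "\<sigma> + h \<in> A" using h F\<sigma> a\<sigma> by (simp add: A_def)
    from up[OF this] show False using h(1) by simp
  qed
  then show ?thesis using F\<sigma> by simp
qed

lemma slope_ge_imp_ge:
  fixes F :: "real \<Rightarrow> real"
  assumes "a \<le> b"
    and right: "\<And>s. a \<le> s \<Longrightarrow> s < b \<Longrightarrow> \<forall>\<^sub>F h in at_right 0. F s + c * h \<le> F (s + h)"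
    and left: "\<And>s e. a < s \<Longrightarrow> s \<le> b \<Longrightarrow> e > 0 \<Longrightarrow> \<forall>\<^sub>F h in at_right 0. F (s - h) \<le> F s + e"
  shows "F a + c * (b - a) \<le> F b"
proof -
  have "F a - c * a \<le> F b - c * b"
  proof (rule right_nondecreasing_imp_le[where F = "\<lambda>s. F s - c * s", OF assms(1)])
    fix s assume "a \<le> s" "s < b"
    from right[OF this] show "\<forall>\<^sub>F h in at_right 0. F s - c * s \<le> F (s + h) - c * (s + h)"
      by (rule eventually_mono) (simp add: algebra_simps)
  next
    fix s e :: real assume s: "a < s" "s \<le> b" "e > 0"
    have "\<forall>\<^sub>F h in at_right 0. F (s - h) \<le> F s + e / 2" using s by (intro left) auto
    moreover have "\<forall>\<^sub>F h in at_right 0. \<bar>c\<bar> * h \<le> e / 2"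
      unfolding eventually_at_right_field
    proof (intro exI[of _ "e / 2 / (\<bar>c\<bar> + 1)"] conjI allI impI)
      show "0 < e / 2 / (\<bar>c\<bar> + 1)" using s(3) by simp
      fix h :: real assume "0 < h" "h < e / 2 / (\<bar>c\<bar> + 1)"
      then have "(\<bar>c\<bar> + 1) * h \<le> e / 2" by (simp add: field_simps)
      then show "\<bar>c\<bar> * h \<le> e / 2" using \<open>0 < h\<close> by (simp add: algebra_simps)
    qed
    moreover have "\<forall>\<^sub>F h in at_right 0. (0::real) < h" by (simp add: eventually_at_right_less)
    ultimately show "\<forall>\<^sub>F h in at_right 0. F (s - h) - c * (s - h) \<le> F s - c * s + e"
    proof eventually_elim
      case (elim h)
      have "c * h \<le> \<bar>c\<bar> * h" using elim(3) by (intro mult_right_mono) auto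
      moreover have "c * (s - h) = c * s - c * h" by (rule right_diff_distrib)
      ultimately show ?case using elim(1,2) by linarith
    qed
  qed
  then show ?thesis by (simp add: algebra_simps)
qed

text \<open>The absolute value keeps the ball nonempty: for negative radii the supremum would be unspecified.\<close>

definition ball_max :: "('a::euclidean_space \<Rightarrow> real) \<Rightarrow> 'a \<Rightarrow> real \<Rightarrow> real" where
  "ball_max f x r = robust_reg f \<bar>r\<bar> x"

lemma ball_max_attained:
  fixes f :: "'a::euclidean_space \<Rightarrow> real"
  assumes "continuous_on UNIV f"
  obtains y where "norm (y - x) \<le> \<bar>r\<bar>" "f y = ball_max f x r" "\<forall>z. norm (z - x) \<le> \<bar>r\<bar> \<longrightarrow> f z \<le> ball_max f x r"
proof -
  have "continuous_on (cball x \<bar>r\<bar>) f" by (rule continuous_on_subset[OF assms]) simp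
  then obtain y where y: "y \<in> cball x \<bar>r\<bar>" "\<forall>z\<in>cball x \<bar>r\<bar>. f z \<le> f y"
    using continuous_attains_sup[OF compact_cball] by (metis abs_ge_zero cball_eq_empty not_le)
  then have eq: "ball_max f x r = f y" unfolding ball_max_def robust_reg_def
    by (intro cSup_eq_maximum) auto
  show thesis
  proof (rule that)
    show "norm (y - x) \<le> \<bar>r\<bar>" using y(1) by (simp add: dist_norm norm_minus_commute)
    show "\<forall>z. norm (z - x) \<le> \<bar>r\<bar> \<longrightarrow> f z \<le> ball_max f x r"
      using y(2) by (simp add: eq dist_norm norm_minus_commute)
  qed (simp add: eq)
qed

lemma ball_max_upper:
  assumes "continuous_on UNIV f" "norm (z - x) \<le> \<bar>r\<bar>"
  shows "f z \<le> ball_max f x r"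
  using ball_max_attained[OF assms(1), of x r] assms(2) by metis

text \<open>The first ball lies in the second. This is the inequality by which a move of the centre
  is paid for with radius.\<close>

lemma ball_max_mono:
  assumes f: "continuous_on UNIV f" and "0 \<le> r" "r + norm (x' - x) \<le> r'"
  shows "ball_max f x r \<le> ball_max f x' r'"
proof -
  obtain y where y: "norm (y - x) \<le> \<bar>r\<bar>" "f y = ball_max f x r" by (rule ball_max_attained[OF f])
  have "norm (y - x') \<le> norm (y - x) + norm (x' - x)"
    using norm_triangle_ineq4[of "y - x" "x' - x"] by simp
  then have "norm (y - x') \<le> \<bar>r'\<bar>" using y(1) assms(2,3) by simp
  from ball_max_upper[OF f this] y(2) show ?thesis by simp
qed

text \<open>The point \<open>u\<close> divides the segment from \<open>x\<close> to a maximizer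
  \<open>y\<close> on the large ball in the ratio \<open>s\<close> to \<open>r\<close>, so
  \<open>y\<close> lies within \<open>r\<close> of \<open>u\<close>. Thus an increase of the radius
  by \<open>s\<close> is realized by moving the centre by at most \<open>s\<close>.\<close>

lemma ball_max_split:
  assumes f: "continuous_on UNIV f" and rs: "0 \<le> r" "0 \<le> s"
  obtains u where "norm (u - x) \<le> s" "ball_max f u r = ball_max f x (r + s)"
proof -
  obtain y where y: "norm (y - x) \<le> \<bar>r + s\<bar>" "f y = ball_max f x (r + s)" by (rule ball_max_attained[OF f])
  \<comment> \<open>For \<open>r + s = 0\<close> division by zero gives \<open>k = 0\<close>, and
    all points coincide.\<close>
  define k where "k = s / (r + s)"
  define u where "u = x + k *\<^sub>R (y - x)"
  have k: "0 \<le> k" "k \<le> 1" using rs by (auto simp: k_def divide_le_eq_1)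
  have 1: "norm (u - x) \<le> s"
  proof (cases "r + s = 0")
    case True
    then show ?thesis using rs by (simp add: u_def k_def)
  next
    case False
    have "norm (u - x) = k * norm (y - x)" using k by (simp add: u_def)
    also have "\<dots> \<le> k * (r + s)" using k y(1) rs by (intro mult_left_mono) auto
    also have "\<dots> = s" using False by (simp add: k_def)
    finally show ?thesis .
  qed
  have 2: "norm (y - u) \<le> r"
  proof (cases "r + s = 0")
    case True
    then show ?thesis using rs y(1) by (simp add: u_def k_def)
  next
    case False
    have "y - u = (1 - k) *\<^sub>R (y - x)" by (simp add: u_def algebra_simps)
    then have "norm (y - u) = (1 - k) * norm (y - x)" using k by simp
    also have "\<dots> \<le> (1 - k) * (r + s)" using k y(1) rs by (intro mult_left_mono) auto
    also have "\<dots> = r" using False by (simp add: k_def field_simps)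
    finally show ?thesis .
  qed
  have "ball_max f x (r + s) \<le> ball_max f u r" using ball_max_upper[OF f, of y u r] 2 y(2) rs by simp
  moreover have "ball_max f u r \<le> ball_max f x (r + s)"
    using rs 1 by (intro ball_max_mono[OF f]) (auto simp: norm_minus_commute)
  ultimately show thesis using 1 that by force
qed

text \<open>Shrinking a maximizer towards the centre by the factor \<open>r1 / r2\<close> moves it
  by at most \<open>r2 - r1\<close>, so uniform continuity bounds the loss; the ball of radius
  \<open>r + 1\<close> leaves room for all \<open>r'\<close> within distance 1 of
  \<open>r\<close>.\<close>

lemma ball_max_continuous:
  assumes f: "continuous_on UNIV f" and "0 \<le> r" "0 < e"
  obtains d where "0 < d" "\<forall>r'. 0 \<le> r' \<and> \<bar>r' - r\<bar> < d \<longrightarrow> \<bar>ball_max f x r' - ball_max f x r\<bar> < e"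
proof -
  have "uniformly_continuous_on (cball x (r + 1)) f"
    by (intro compact_uniformly_continuous continuous_on_subset[OF f]) auto
  then obtain d where d: "0 < d" "\<forall>y\<in>cball x (r + 1). \<forall>z\<in>cball x (r + 1). dist z y < d \<longrightarrow> dist (f z) (f y) < e"
    unfolding uniformly_continuous_on_def using assms(3) by blast
  have step: "ball_max f x r2 < ball_max f x r1 + e"
    if r12: "0 \<le> r1" "r1 \<le> r2" "r2 \<le> r + 1" "r2 - r1 < d" for r1 r2
  proof -
    obtain y where y: "norm (y - x) \<le> \<bar>r2\<bar>" "f y = ball_max f x r2" by (rule ball_max_attained[OF f])
    define k where "k = r1 / r2"
    define z where "z = x + k *\<^sub>R (y - x)"
    have k: "0 \<le> k" "k \<le> 1" using r12 by (auto simp: k_def divide_le_eq_1)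
    have kr: "k * r2 = r1" using r12 by (auto simp: k_def)
    have z: "norm (z - x) \<le> r1"
    proof -
      have "norm (z - x) = k * norm (y - x)" using k by (simp add: z_def)
      also have "\<dots> \<le> k * r2" using k y(1) r12 by (intro mult_left_mono) auto
      finally show ?thesis using kr by simp
    qed
    have "y - z = (1 - k) *\<^sub>R (y - x)" by (simp add: z_def algebra_simps)
    then have "norm (y - z) = (1 - k) * norm (y - x)" using k by simp
    also have "\<dots> \<le> (1 - k) * r2" using k y(1) r12 by (intro mult_left_mono) auto
    also have "\<dots> = r2 - r1" using kr by (simp add: algebra_simps)
    finally have "dist y z < d" using r12(4) by (simp add: dist_norm)
    moreover have "y \<in> cball x (r + 1)" "z \<in> cball x (r + 1)"
      using y(1) z r12 by (auto simp: dist_norm norm_minus_commute)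
    ultimately have "dist (f y) (f z) < e" using d(2) by blast
    then have "f y < f z + e" by (simp add: dist_real_def)
    also have "f z \<le> ball_max f x r1" using z r12(1) by (intro ball_max_upper[OF f]) simp
    finally show ?thesis using y(2) by simp
  qed
  have mono: "ball_max f x r1 \<le> ball_max f x r2" if "0 \<le> r1" "r1 \<le> r2" for r1 r2
    using that by (intro ball_max_mono[OF f]) auto
  show thesis
  proof (rule that[of "min d 1"], use d(1) in simp, intro allI impI)
    fix r' assume r': "0 \<le> r' \<and> \<bar>r' - r\<bar> < min d 1"
    show "\<bar>ball_max f x r' - ball_max f x r\<bar> < e"
    proof (cases "r' \<le> r")
      case True
      then show ?thesis using r' step[of r' r] mono[of r' r] by auto
    next
      case False
      then show ?thesis using r' assms(2) step[of r r'] mono[of r r'] by auto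
    qed
  qed
qed

lemma ball_max_left_continuous:
  assumes f: "continuous_on UNIV f" and "0 < r" "0 < e"
  shows "\<forall>\<^sub>F h in at_right 0. ball_max f x r \<le> ball_max f x (r - h) + e"
proof -
  obtain d where d: "0 < d" "\<forall>r'. 0 \<le> r' \<and> \<bar>r' - r\<bar> < d \<longrightarrow> \<bar>ball_max f x r' - ball_max f x r\<bar> < e"
    using ball_max_continuous[OF f less_imp_le[OF assms(2)] assms(3)] by blast
  show ?thesis unfolding eventually_at_right_field
  proof (intro exI[of _ "min r d"] conjI allI impI)
    fix h assume h: "0 < h" "h < min r d"
    have "\<bar>ball_max f x (r - h) - ball_max f x r\<bar> < e" by (rule d(2)[rule_format]) (use h in auto)
    then show "ball_max f x r \<le> ball_max f x (r - h) + e" by linarith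
  qed (use d(1) assms(2) in simp)
qed

lemma definable_fun_ball_max:
  assumes f: "continuous_on UNIV f" "definable_fun f"
  shows "definable_fun (\<lambda>p. ball_max f (fst p) (snd p))"
proof -
  define R where "R = (\<lambda>p v. (\<exists>z. norm (z - fst p) \<le> \<bar>snd p\<bar> \<and> f z = v) \<and>
     (\<forall>z. norm (z - fst p) \<le> \<bar>snd p\<bar> \<longrightarrow> f z \<le> v))"
  have "definable (\<lambda>q. R (fst q) (snd q))" unfolding R_def
    by (intro definable_intros definable_fun_compose[OF f(2)])
  moreover have "R p v \<longleftrightarrow> v = ball_max f (fst p) (snd p)" for p v
  proof -
    obtain y where y: "norm (y - fst p) \<le> \<bar>snd p\<bar>" "f y = ball_max f (fst p) (snd p)"
      "\<forall>z. norm (z - fst p) \<le> \<bar>snd p\<bar> \<longrightarrow> f z \<le> ball_max f (fst p) (snd p)"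
      by (rule ball_max_attained[OF f(1)])
    show ?thesis
    proof
      assume "R p v"
      then obtain z where "norm (z - fst p) \<le> \<bar>snd p\<bar>" "f z = v" "f y \<le> v"
        unfolding R_def using y(1) by blast
      then show "v = ball_max f (fst p) (snd p)" using y by force
    next
      assume "v = ball_max f (fst p) (snd p)"
      then show "R p v" unfolding R_def using y by blast
    qed
  qed
  ultimately show ?thesis unfolding definable_fun_def by (simp only:)
qed

section \<open>Definable families with slopes bounded from below\<close>

lemma eventually_right_small: "0 < d \<Longrightarrow> \<forall>\<^sub>F h in at_right (0::real). 0 < h \<and> h < d"
  unfolding eventually_at_right_field by blast

text \<open>The threshold for \<open>t\<close> depends on \<open>s\<close>, and \<open>u\<close> may
  jump in \<open>s\<close>. The interval is covered by sets on which one threshold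
  \<open>1 / (n + 1)\<close> works and the left-hand inequality \<open>Lt\<close> either holds for
  all smaller \<open>t\<close> or fails for all of them; one such set contains an interval. If
  \<open>Lt\<close> holds there, it excludes downward jumps, so \<open>u\<close> grows at rate
  \<open>c\<close> for each such \<open>t\<close> and the bound passes to the limit. If it fails,
  the two one-sided conditions contradict each other at nearby points.\<close>

lemma definable_slope_growth:
  fixes u :: "real \<Rightarrow> real \<Rightarrow> real"
  assumes u: "definable_fun (\<lambda>p. u (fst p) (snd p))" and pq: "p < q"
    and right: "\<And>s. p < s \<Longrightarrow> s < q \<Longrightarrow> \<forall>\<^sub>F t in at_right 0. \<forall>\<^sub>F h in at_right 0. u s t + c * h \<le> u (s + h) t"
    and lim: "\<And>s. p < s \<Longrightarrow> s < q \<Longrightarrow> ((\<lambda>t. u s t) \<longlongrightarrow> w s) (at_right 0)"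
  obtains a b where "p < a" "a < b" "b < q" "w a + c * (b - a) \<le> w b"
proof -
  define Rt where "Rt = (\<lambda>s t. \<forall>\<^sub>F h in at_right 0. u s t + c * h \<le> u (s + h) t)"
  define Lt where "Lt = (\<lambda>s t. \<forall>\<^sub>F h in at_right 0. u (s - h) t \<le> u s t - c * h)"
  have dR: "definable (\<lambda>p. Rt (fst p) (snd p))" and dL: "definable (\<lambda>p. Lt (fst p) (snd p))"
    unfolding Rt_def Lt_def by (intro definable_intros definable_fun_compose2[OF u])+
  define E where "E = (\<lambda>(k::nat \<times> bool) s. \<forall>t. 0 < t \<and> t < inverse (real (Suc (fst k))) \<longrightarrow>
      Rt s t \<and> (snd k \<longrightarrow> Lt s t) \<and> (\<not> snd k \<longrightarrow> \<not> Lt s t))"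
  have dE: "definable (E k)" for k
    unfolding E_def by (intro definable_intros definable_compose2[OF dR] definable_compose2[OF dL])
  have cover: "\<exists>k. E k s" if s: "p < s" "s < q" for s
  proof -
    have R: "\<forall>\<^sub>F t in at_right 0. Rt s t" using right[OF s] by (simp only: Rt_def)
    have "\<exists>b. \<forall>\<^sub>F t in at_right 0. (b \<longrightarrow> Lt s t) \<and> (\<not> b \<longrightarrow> \<not> Lt s t)"
      using definable_dichotomy_param[OF dL, of s]
    proof
      assume "\<forall>\<^sub>F t in at_right 0. Lt s t"
      then show ?thesis by (intro exI[of _ True]) simp
    next
      assume "\<forall>\<^sub>F t in at_right 0. \<not> Lt s t"
      then show ?thesis by (intro exI[of _ False]) simp
    qed
    then obtain b where "\<forall>\<^sub>F t in at_right 0. (b \<longrightarrow> Lt s t) \<and> (\<not> b \<longrightarrow> \<not> Lt s t)" ..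
    from eventually_conj[OF R this] obtain d where d: "d > 0"
        "\<forall>t>0. t < d \<longrightarrow> Rt s t \<and> (b \<longrightarrow> Lt s t) \<and> (\<not> b \<longrightarrow> \<not> Lt s t)"
      unfolding eventually_at_right_field by blast
    obtain k where "inverse (real (Suc k)) < d" using reals_Archimedean[OF d(1)] by blast
    then have "E (k, b) s" using d(2) unfolding E_def by (auto dest: less_trans)
    then show ?thesis ..
  qed
  obtain k p' q' where k: "p \<le> p'" "p' < q'" "q' \<le> q" "\<forall>s. p' < s \<and> s < q' \<longrightarrow> E k s"
    by (rule definable_cover_interval[OF dE pq cover])
  define t0 where "t0 = inverse (real (Suc (fst k)))"
  have t0: "t0 > 0" by (simp add: t0_def)
  have E: "Rt s t" "snd k \<Longrightarrow> Lt s t" "\<not> snd k \<Longrightarrow> \<not> Lt s t" if "p' < s" "s < q'" "0 < t" "t < t0" for s t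
    using k(4)[rule_format, of s] that by (simp_all add: E_def t0_def)
  show thesis
  proof (cases "snd k")
    case True
    define a where "a = p' + (q' - p') / 3"
    define b where "b = p' + 2 * (q' - p') / 3"
    have ab: "p' < a" "a < b" "b < q'" using k(2) by (simp_all add: a_def b_def field_simps)
    have "u a t + c * (b - a) \<le> u b t" if t: "0 < t" "t < t0" for t
    proof -
      have "u a t - c * a \<le> u b t - c * b"
      proof (rule right_nondecreasing_imp_le[where F = "\<lambda>s. u s t - c * s"])
        show "a \<le> b" using ab by simp
        fix s assume "a \<le> s" "s < b"
        then have "p' < s" "s < q'" using ab by auto
        from E(1)[OF this t] show "\<forall>\<^sub>F h in at_right 0. u s t - c * s \<le> u (s + h) t - c * (s + h)"
          unfolding Rt_def by (rule eventually_mono) (simp add: algebra_simps)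
      next
        fix s e :: real assume "a < s" "s \<le> b" and e: "e > 0"
        then have "p' < s" "s < q'" using ab by auto
        from E(2)[OF this t True] show "\<forall>\<^sub>F h in at_right 0. u (s - h) t - c * (s - h) \<le> u s t - c * s + e"
          unfolding Lt_def
        proof (rule eventually_mono)
          fix h assume "u (s - h) t \<le> u s t - c * h"
          moreover have "c * (s - h) = c * s - c * h" by (rule right_diff_distrib)
          ultimately show "u (s - h) t - c * (s - h) \<le> u s t - c * s + e" using e by linarith
        qed
      qed
      then show ?thesis by (simp add: algebra_simps)
    qed
    then have ev: "\<forall>\<^sub>F t in at_right 0. u a t + c * (b - a) \<le> u b t"
      using t0 unfolding eventually_at_right_field by blast
    have la: "((\<lambda>t. u a t + c * (b - a)) \<longlongrightarrow> w a + c * (b - a)) (at_right 0)"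
      using ab k(1,3) by (intro tendsto_intros lim) auto
    have lb: "((\<lambda>t. u b t) \<longlongrightarrow> w b) (at_right 0)" using ab k(1,3) by (intro lim) auto
    have "w a + c * (b - a) \<le> w b"
      by (rule tendsto_le[OF _ lb la ev]) simp
    then show thesis using ab k(1,3) by (intro that[of a b]) auto
  next
    case False
    define t where "t = t0 / 2"
    have t: "0 < t" "t < t0" using t0 by (simp_all add: t_def)
    \<comment> \<open>With \<open>t\<close> fixed, a second cover makes the threshold for
      \<open>h\<close> uniform. The right condition at \<open>s\<close> and the failure of the left
      one at \<open>s + h\<close> then compare the same two values in opposite ways.\<close>
    define D where "D = (\<lambda>(m::nat) s. \<forall>h. 0 < h \<and> h < inverse (real (Suc m)) \<longrightarrow>
       u s t + c * h \<le> u (s + h) t \<and> u s t - c * h < u (s - h) t)"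
    have dD: "definable (D m)" for m
      unfolding D_def by (intro definable_intros definable_fun_compose2[OF u])
    have coverD: "\<exists>m. D m s" if s: "p' < s" "s < q'" for s
    proof -
      have "definable (\<lambda>h. u (s - h) t \<le> u s t - c * h)"
        by (intro definable_intros definable_fun_compose2[OF u])
      then have "\<forall>\<^sub>F h in at_right 0. \<not> u (s - h) t \<le> u s t - c * h"
        using definable_dichotomy E(3)[OF s t False] unfolding Lt_def by blast
      from eventually_conj[OF E(1)[OF s t, unfolded Rt_def] this] obtain d where d: "d > 0"
        "\<forall>h>0. h < d \<longrightarrow> u s t + c * h \<le> u (s + h) t \<and> \<not> u (s - h) t \<le> u s t - c * h"
        unfolding eventually_at_right_field by blast
      obtain m where "inverse (real (Suc m)) < d" using reals_Archimedean[OF d(1)] by blast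
      then have "D m s" using d(2) unfolding D_def by (auto simp: not_le dest: less_trans)
      then show ?thesis ..
    qed
    obtain m p'' q'' where m: "p' \<le> p''" "p'' < q''" "q'' \<le> q'" "\<forall>s. p'' < s \<and> s < q'' \<longrightarrow> D m s"
      by (rule definable_cover_interval[OF dD k(2) coverD])
    \<comment> \<open>Starting at one third and moving by at most one third of the length keeps
      \<open>s\<close> and \<open>s + h\<close> inside.\<close>
    define s where "s = p'' + (q'' - p'') / 3"
    define h where "h = min ((q'' - p'') / 3) (inverse (real (Suc m)) / 2)"
    have h: "0 < h" "h < inverse (real (Suc m))" using m(2) by (auto simp: h_def min_def)
    have hl: "h \<le> (q'' - p'') / 3" unfolding h_def by (rule min.cobounded1)
    have s: "p'' < s" "s < q''" "p'' < s + h" "s + h < q''"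
      using m(2) h(1) hl by (simp_all add: s_def field_simps)
    have "u s t + c * h \<le> u (s + h) t" using m(4)[rule_format, of s] s(1,2) h unfolding D_def by blast
    moreover have "u (s + h) t - c * h < u (s + h - h) t" using m(4)[rule_format, of "s + h"] s(3,4) h unfolding D_def by blast
    ultimately have False by simp
    then show thesis ..
  qed
qed

text \<open>Each coordinate of \<open>z s t\<close> tends to that of \<open>xb\<close>, which is
  constant in \<open>s\<close>. If it grew at rate \<open>c\<close> throughout some interval,
  \<open>definable_slope_growth\<close> would make the constant limit grow; the same goes for
  decrease. Hence neither occurs anywhere on some subinterval, and the dichotomy turns this failure
  into the bound \<open>c * h\<close> for all small \<open>t\<close> and \<open>h\<close>.
  Coordinates are treated one by one, shrinking the interval.\<close>

lemma slow_selection: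
  fixes z :: "real \<Rightarrow> real \<Rightarrow> 'a::euclidean_space"
  assumes z: "definable_fun (\<lambda>p. z (fst p) (snd p))" and pq: "p < q" and c: "0 < c"
    and near: "\<And>s t. p < s \<Longrightarrow> s < q \<Longrightarrow> 0 < t \<Longrightarrow> norm (z s t - xb) \<le> t"
    and "finite B"
  shows "\<exists>p' q'. p \<le> p' \<and> p' < q' \<and> q' \<le> q \<and> (\<forall>b\<in>B. \<forall>s. p' < s \<and> s < q' \<longrightarrow>
     (\<forall>\<^sub>F t in at_right 0. \<forall>\<^sub>F h in at_right 0. \<bar>(z (s + h) t - z s t) \<bullet> b\<bar> \<le> c * h))"
  using \<open>finite B\<close>
proof (induction rule: finite_induct)
  case empty
  show ?case using pq by (rule_tac exI[of _ p], rule_tac exI[of _ q]) simp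
next
  case (insert b B)
  then obtain p' q' where pq': "p \<le> p'" "p' < q'" "q' \<le> q"
    and IH: "\<forall>b\<in>B. \<forall>s. p' < s \<and> s < q' \<longrightarrow>
     (\<forall>\<^sub>F t in at_right 0. \<forall>\<^sub>F h in at_right 0. \<bar>(z (s + h) t - z s t) \<bullet> b\<bar> \<le> c * h)" by (elim exE conjE)
  have lim: "((\<lambda>t. z s t \<bullet> b) \<longlongrightarrow> xb \<bullet> b) (at_right 0)" if s: "p' < s" "s < q'" for s
  proof -
    have "\<forall>\<^sub>F t in at_right 0. norm (z s t - xb) \<le> t"
      using near[of s] s pq' unfolding eventually_at_right_field by (intro exI[of _ 1]) auto
    moreover have "((\<lambda>t. t) \<longlongrightarrow> 0) (at_right (0::real))" by (rule tendsto_ident_at)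
    ultimately have "((\<lambda>t. z s t - xb) \<longlongrightarrow> 0) (at_right 0)" by (rule Lim_null_comparison)
    then have "((\<lambda>t. z s t) \<longlongrightarrow> xb) (at_right 0)" by (rule Lim_null[THEN iffD2])
    then show ?thesis by (intro tendsto_intros)
  qed
  define U1 where "U1 = (\<lambda>s t. \<forall>\<^sub>F h in at_right 0. z s t \<bullet> b + c * h \<le> z (s + h) t \<bullet> b)"
  define D1 where "D1 = (\<lambda>s t. \<forall>\<^sub>F h in at_right 0. - (z s t \<bullet> b) + c * h \<le> - (z (s + h) t \<bullet> b))"
  have d1: "definable (\<lambda>p. U1 (fst p) (snd p))" "definable (\<lambda>p. D1 (fst p) (snd p))"
    unfolding U1_def D1_def by (intro definable_intros definable_fun_compose2[OF z])+
  define Up where "Up = (\<lambda>s. \<forall>\<^sub>F t in at_right 0. U1 s t)"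
  define Dn where "Dn = (\<lambda>s. \<forall>\<^sub>F t in at_right 0. D1 s t)"
  have d2: "definable Up" "definable Dn" unfolding Up_def Dn_def
    by (intro definable_intros d1)+
  have nU: "\<exists>s. l < s \<and> s < r \<and> \<not> Up s" if lr: "p' \<le> l" "l < r" "r \<le> q'" for l r
  proof (rule ccontr)
    assume "\<not> (\<exists>s. l < s \<and> s < r \<and> \<not> Up s)"
    then have all: "Up s" if "l < s" "s < r" for s using that by blast
    have du: "definable_fun (\<lambda>p. z (fst p) (snd p) \<bullet> b)" by (intro definable_intros z)
    obtain a a' where "a < a'" "xb \<bullet> b + c * (a' - a) \<le> xb \<bullet> b"
    proof (rule definable_slope_growth[OF du lr(2), of c "\<lambda>s. xb \<bullet> b"])
      show "\<forall>\<^sub>F t in at_right 0. \<forall>\<^sub>F h in at_right 0. z s t \<bullet> b + c * h \<le> z (s + h) t \<bullet> b"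
        if "l < s" "s < r" for s using all[OF that] by (simp only: Up_def U1_def)
      show "((\<lambda>t. z s t \<bullet> b) \<longlongrightarrow> xb \<bullet> b) (at_right 0)" if "l < s" "s < r" for s
        using that lr by (intro lim) auto
    qed (rule that)
    then show False using c by (simp add: mult_le_0_iff)
  qed
  have nD: "\<exists>s. l < s \<and> s < r \<and> \<not> Dn s" if lr: "p' \<le> l" "l < r" "r \<le> q'" for l r
  proof (rule ccontr)
    assume "\<not> (\<exists>s. l < s \<and> s < r \<and> \<not> Dn s)"
    then have all: "Dn s" if "l < s" "s < r" for s using that by blast
    have du: "definable_fun (\<lambda>p. - (z (fst p) (snd p) \<bullet> b))" by (intro definable_intros z)
    obtain a a' where "a < a'" "- (xb \<bullet> b) + c * (a' - a) \<le> - (xb \<bullet> b)"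
    proof (rule definable_slope_growth[OF du lr(2), of c "\<lambda>s. - (xb \<bullet> b)"])
      show "\<forall>\<^sub>F t in at_right 0. \<forall>\<^sub>F h in at_right 0. - (z s t \<bullet> b) + c * h \<le> - (z (s + h) t \<bullet> b)"
        if "l < s" "s < r" for s using all[OF that] by (simp only: Dn_def D1_def)
      show "((\<lambda>t. - (z s t \<bullet> b)) \<longlongrightarrow> - (xb \<bullet> b)) (at_right 0)" if "l < s" "s < r" for s
        using that lr by (intro tendsto_minus lim) auto
    qed (rule that)
    then show False using c by (simp add: mult_le_0_iff)
  qed
  \<comment> \<open>Three definable sets cover the interval. A subinterval inside \<open>Up\<close>
    or inside \<open>Dn\<close> is impossible, as \<open>nU\<close> and \<open>nD\<close> find an
    exception in every subinterval.\<close>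
  have n2: "\<exists>l r. p' \<le> l \<and> l < r \<and> r \<le> q' \<and> (\<forall>s. l < s \<and> s < r \<longrightarrow> \<not> Up s \<and> \<not> Dn s)"
  proof -
    define E' where "E' = (\<lambda>(k::nat) s. if k = 0 then Up s else if k = 1 then Dn s else \<not> Up s \<and> \<not> Dn s)"
    have dE': "definable (E' k)" for k
      unfolding E'_def by (cases "k = 0"; cases "k = 1") (simp_all add: d2 definable_not definable_conj)
    have cover': "\<exists>k. E' k s" for s
    proof -
      consider "Up s" | "Dn s" | "\<not> Up s \<and> \<not> Dn s" by blast
      then show ?thesis
      proof cases
        case 1 then show ?thesis by (intro exI[of _ 0]) (simp add: E'_def)
      next
        case 2 then show ?thesis by (intro exI[of _ 1]) (simp add: E'_def)
      next
        case 3 then show ?thesis by (intro exI[of _ 2]) (simp add: E'_def)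
      qed
    qed
    obtain j l r where j: "p' \<le> l" "l < r" "r \<le> q'" "\<forall>s. l < s \<and> s < r \<longrightarrow> E' j s"
      by (rule definable_cover_interval[OF dE' pq'(2) cover'])
    obtain s1 where s1: "l < s1" "s1 < r" "\<not> Up s1" using nU[OF j(1-3)] by blast
    obtain s2 where s2: "l < s2" "s2 < r" "\<not> Dn s2" using nD[OF j(1-3)] by blast
    have "j \<noteq> 0" using j(4)[rule_format, of s1] s1 unfolding E'_def by presburger
    moreover have "j \<noteq> 1"
    proof
      assume "j = 1"
      then show False using j(4)[rule_format, of s2] s2 unfolding E'_def by simp
    qed
    ultimately have "\<not> Up s \<and> \<not> Dn s" if "l < s" "s < r" for s using j(4)[rule_format, of s] that by (simp add: E'_def)
    then show ?thesis using j(1-3) by blast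
  qed
  then obtain l r where lr: "p' \<le> l" "l < r" "r \<le> q'" "\<forall>s. l < s \<and> s < r \<longrightarrow> \<not> Up s \<and> \<not> Dn s" by blast
  have new: "\<forall>\<^sub>F t in at_right 0. \<forall>\<^sub>F h in at_right 0. \<bar>(z (s + h) t - z s t) \<bullet> b\<bar> \<le> c * h" if s: "l < s" "s < r" for s
  proof -
    have "\<not> Up s" "\<not> Dn s" using lr(4) s by auto
    then have "\<forall>\<^sub>F t in at_right 0. \<not> U1 s t" "\<forall>\<^sub>F t in at_right 0. \<not> D1 s t"
      using definable_dichotomy_param[OF d1(1), of s] definable_dichotomy_param[OF d1(2), of s]
      unfolding Up_def Dn_def by blast+
    then show ?thesis
    proof eventually_elim
      case (elim t)
      have "definable (\<lambda>h. z s t \<bullet> b + c * h \<le> z (s + h) t \<bullet> b)" "definable (\<lambda>h. - (z s t \<bullet> b) + c * h \<le> - (z (s + h) t \<bullet> b))"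
        by (intro definable_intros definable_fun_compose2[OF z])+
      then have "\<forall>\<^sub>F h in at_right 0. \<not> z s t \<bullet> b + c * h \<le> z (s + h) t \<bullet> b"
        "\<forall>\<^sub>F h in at_right 0. \<not> - (z s t \<bullet> b) + c * h \<le> - (z (s + h) t \<bullet> b)"
        using elim definable_dichotomy unfolding U1_def D1_def by blast+
      then show ?case
      proof eventually_elim
        case (elim h)
        then show ?case by (simp add: inner_diff_left)
      qed
    qed
  qed
  have old: "\<forall>\<^sub>F t in at_right 0. \<forall>\<^sub>F h in at_right 0. \<bar>(z (s + h) t - z s t) \<bullet> b'\<bar> \<le> c * h"
    if "l < s" "s < r" "b' \<in> B" for s b'
    using IH that lr(1,3) by auto
  show ?case
  proof (rule exI[of _ l], rule exI[of _ r], intro conjI ballI allI impI)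
    show "p \<le> l" "l < r" "r \<le> q" using pq' lr by auto
    fix b' s assume "b' \<in> insert b B" "l < s \<and> s < r"
    then show "\<forall>\<^sub>F t in at_right 0. \<forall>\<^sub>F h in at_right 0. \<bar>(z (s + h) t - z s t) \<bullet> b'\<bar> \<le> c * h"
      using new old by (elim insertE conjE) (simp_all only:)
  qed
qed

section \<open>Steep points near the centre\<close>

text \<open>Walk from \<open>x'\<close> to \<open>x\<close> at unit speed. A step \<open>h\<close>
  raises the maximum over the ball of radius \<open>r\<close> by no more than an increase of the
  radius by \<open>h\<close> would; if growth in the radius stayed below rate \<beta> along the
  whole segment, the total gain would be at most \<beta> times its length, against
  \<open>gap\<close>.\<close>

lemma steep_point:
  fixes f :: "'a::euclidean_space \<Rightarrow> real"
  assumes f: "continuous_on UNIV f" "definable_fun f" and "0 < r" "0 \<le> \<beta>"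
    and gap: "\<beta> * norm (x - x') < ball_max f x r - ball_max f x' r"
  obtains z where "z \<in> closed_segment x' x" "\<forall>\<^sub>F h in at_right 0. ball_max f z r + \<beta> * h \<le> ball_max f z (r + h)"
proof -
  have "\<exists>z\<in>closed_segment x' x. \<forall>\<^sub>F h in at_right 0. ball_max f z r + \<beta> * h \<le> ball_max f z (r + h)"
  proof (rule ccontr)
    assume no: "\<not> (\<exists>z\<in>closed_segment x' x. \<forall>\<^sub>F h in at_right 0. ball_max f z r + \<beta> * h \<le> ball_max f z (r + h))"
    define L where "L = norm (x - x')"
    have "x \<noteq> x'" using gap by auto
    then have L: "L > 0" by (simp add: L_def)
    define z where "z = (\<lambda>s. x' + (s / L) *\<^sub>R (x - x'))"
    have z0: "z 0 = x'" and zL: "z L = x" using L by (simp_all add: z_def)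
    have dz: "norm (z s - z s') = \<bar>s - s'\<bar>" for s s'
    proof -
      have "z s - z s' = ((s - s') / L) *\<^sub>R (x - x')" by (simp add: z_def algebra_simps diff_divide_distrib)
      then show ?thesis using L by (simp add: L_def[symmetric])
    qed
    have seg: "z s \<in> closed_segment x' x" if "0 \<le> s" "s \<le> L" for s
      unfolding in_segment using that L
      by (intro exI[of _ "s / L"]) (auto simp: z_def algebra_simps)
    have small: "\<forall>\<^sub>F h in at_right 0. \<not> ball_max f y r + \<beta> * h \<le> ball_max f y (r + h)"
      if "y \<in> closed_segment x' x" for y
    proof -
      have "definable (\<lambda>h. ball_max f y r + \<beta> * h \<le> ball_max f y (r + h))"
        by (intro definable_intros definable_fun_compose2[OF definable_fun_ball_max[OF f]])
      then show ?thesis using definable_dichotomy no that by blast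
    qed
    have "\<beta> * 0 - ball_max f (z 0) r \<le> \<beta> * L - ball_max f (z L) r"
    proof (rule right_nondecreasing_imp_le[where F = "\<lambda>s. \<beta> * s - ball_max f (z s) r"])
      show "0 \<le> L" using L by simp
      fix s assume s: "0 \<le> s" "s < L"
      then have "z s \<in> closed_segment x' x" by (intro seg) auto
      from small[OF this] eventually_right_small[OF zero_less_one]
      show "\<forall>\<^sub>F h in at_right 0. \<beta> * s - ball_max f (z s) r \<le> \<beta> * (s + h) - ball_max f (z (s + h)) r"
      proof eventually_elim
        case (elim h)
        have "ball_max f (z (s + h)) r \<le> ball_max f (z s) (r + h)"
          using elim(2) \<open>0 < r\<close> by (intro ball_max_mono[OF f(1)]) (auto simp: dz)
        then show ?case using elim(1) by (simp add: algebra_simps)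
      qed
    next
      fix s e :: real assume s: "0 < s" "s \<le> L" "e > 0"
      from ball_max_left_continuous[OF f(1) \<open>0 < r\<close> s(3), of "z s"] eventually_right_small[OF \<open>0 < r\<close>]
      show "\<forall>\<^sub>F h in at_right 0. \<beta> * (s - h) - ball_max f (z (s - h)) r \<le> \<beta> * s - ball_max f (z s) r + e"
      proof eventually_elim
        case (elim h)
        have "ball_max f (z s) (r - h) \<le> ball_max f (z (s - h)) r"
          using elim(2) by (intro ball_max_mono[OF f(1)]) (auto simp: dz)
        moreover have "\<beta> * (s - h) \<le> \<beta> * s" using elim(2) \<open>0 \<le> \<beta>\<close> by (intro mult_left_mono) auto
        ultimately show ?case using elim(1) by linarith
      qed
    qed
    then show False using gap[folded L_def] by (simp add: z0 zL)
  qed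
  then show thesis using that by blast
qed

lemma no_steep_interval:
  fixes f :: "'a::euclidean_space \<Rightarrow> real"
  assumes f: "continuous_on UNIV f" "definable_fun f" and pq: "0 \<le> p" "p < q" and ab: "0 \<le> \<alpha>" "\<alpha> < \<beta>"
    and flat: "\<And>s. p < s \<Longrightarrow> s < q \<Longrightarrow> \<not> (\<forall>\<^sub>F h in at_right 0. ball_max f xb s + \<alpha> * h \<le> ball_max f xb (s + h))"
    and steep: "\<And>s t. p < s \<Longrightarrow> s < q \<Longrightarrow> 0 < t \<Longrightarrow> \<exists>x x'. norm (x - xb) \<le> t \<and> norm (x' - xb) \<le> t \<and>
        \<beta> * norm (x - x') < ball_max f x s - ball_max f x' s"
  shows False
proof -
  note bm = definable_fun_ball_max[OF f]
  define V where "V = (\<lambda>s y. \<forall>\<^sub>F h in at_right 0. ball_max f y s + \<beta> * h \<le> ball_max f y (s + h))"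
  have dV: "definable (\<lambda>p. V (fst p) (snd p))"
    unfolding V_def by (intro definable_intros definable_fun_compose2[OF bm])
  have dP: "definable (\<lambda>p. norm (snd p - xb) \<le> snd (fst p) \<and> V (fst (fst p)) (snd p))"
    by (intro definable_intros definable_compose2[OF dV])
  obtain z0 where z0: "definable_fun z0"
    "\<forall>p y. norm (y - xb) \<le> snd p \<and> V (fst p) y \<longrightarrow> norm (z0 p - xb) \<le> snd p \<and> V (fst p) (z0 p)"
    using definable_choice[of "\<lambda>p y. norm (y - xb) \<le> snd p \<and> V (fst p) y", OF dP] by blast
  define z where "z = (\<lambda>s t. z0 (s, t))"
  have zdef: "definable_fun (\<lambda>p. z (fst p) (snd p))" unfolding z_def using z0(1) by simp
  \<comment> \<open>The steep point lies on a segment between two points of the ball of radius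
    \<open>t\<close> around \<open>xb\<close>, hence in that ball by convexity.\<close>
  have zP: "norm (z s t - xb) \<le> t" "V s (z s t)" if s: "p < s" "s < q" "0 < t" for s t
  proof -
    obtain x x' where x: "norm (x - xb) \<le> t" "norm (x' - xb) \<le> t" "\<beta> * norm (x - x') < ball_max f x s - ball_max f x' s"
      using steep[OF s] by blast
    have "0 < s" "0 \<le> \<beta>" using s(1) pq(1) ab by auto
    then obtain y where y: "y \<in> closed_segment x' x" "V s y"
      using steep_point[OF f _ _ x(3)] unfolding V_def by blast
    have "closed_segment x' x \<subseteq> cball xb t"
      using x(1,2) by (intro closed_segment_subset convex_cball) (auto simp: dist_norm norm_minus_commute)
    then have "norm (y - xb) \<le> t" using y(1) by (auto simp: dist_norm norm_minus_commute)
    then show "norm (z s t - xb) \<le> t" "V s (z s t)"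
      using spec[OF spec[OF z0(2), of "(s, t)"], of y] y(2) by (simp_all add: z_def)
  qed
  \<comment> \<open>Obtained by solving \<open>\<beta> * (1 - \<eta>) = \<gamma>\<close> for the
    midpoint \<gamma> of \<alpha> and \<beta>.\<close>
  define \<eta> where "\<eta> = (\<beta> - \<alpha>) / (2 * \<beta>)"
  define \<gamma> where "\<gamma> = (\<alpha> + \<beta>) / 2"
  have \<beta>: "\<beta> > 0" using ab by simp
  have \<eta>: "0 < \<eta>" "\<eta> < 1" and \<gamma>: "\<beta> * (1 - \<eta>) = \<gamma>" "\<alpha> < \<gamma>"
    using ab \<beta> by (simp_all add: \<eta>_def \<gamma>_def field_simps)
  \<comment> \<open>Each coordinate gets an equal share, so that the l1 bound on the norm adds up to
    \<open>\<eta> * h\<close>.\<close>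
  define c where "c = \<eta> / real DIM('a)"
  have c: "c > 0" "real DIM('a) * c = \<eta>" using \<eta> by (simp_all add: c_def)
  obtain p' q' where pq': "p \<le> p'" "p' < q'" "q' \<le> q" and slow: "\<forall>b\<in>Basis. \<forall>s. p' < s \<and> s < q' \<longrightarrow>
     (\<forall>\<^sub>F t in at_right 0. \<forall>\<^sub>F h in at_right 0. \<bar>(z (s + h) t - z s t) \<bullet> b\<bar> \<le> c * h)"
    using slow_selection[OF zdef pq(2) c(1) zP(1) finite_Basis] by blast
  define g where "g = ball_max f xb"
  have gcont: "\<forall>\<^sub>F h in at_right 0. - g (s - h) \<le> - g s + e" if "0 < s" "0 < e" for s e
    using ball_max_left_continuous[OF f(1) that, of xb] unfolding g_def by (rule eventually_mono) simp
  define u where "u = (\<lambda>s t. ball_max f (z s t) s)"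
  have du: "definable_fun (\<lambda>p. u (fst p) (snd p))"
    unfolding u_def by (intro definable_fun_compose2[OF bm] definable_intros zdef)
  obtain a b where ab': "p' < a" "a < b" "b < q'" "g a + \<gamma> * (b - a) \<le> g b"
  proof (rule definable_slope_growth[OF du pq'(2), of \<gamma> g])
    fix s assume s: "p' < s" "s < q'"
    then have sp: "p < s" "s < q" "0 < s" using pq' pq by auto
    have "\<forall>\<^sub>F t in at_right 0. \<forall>b\<in>Basis. \<forall>\<^sub>F h in at_right 0. \<bar>(z (s + h) t - z s t) \<bullet> b\<bar> \<le> c * h"
      using slow s by (intro eventually_ball_finite finite_Basis) blast
    with eventually_right_small[OF zero_less_one]
    show "\<forall>\<^sub>F t in at_right 0. \<forall>\<^sub>F h in at_right 0. u s t + \<gamma> * h \<le> u (s + h) t"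
    proof eventually_elim
      case (elim t)
      have 1: "\<forall>\<^sub>F h in at_right 0. \<forall>b\<in>Basis. \<bar>(z (s + h) t - z s t) \<bullet> b\<bar> \<le> c * h"
        by (rule eventually_ball_finite[OF finite_Basis elim(2)])
      \<comment> \<open>Of the radius gain \<open>h\<close>, the part \<open>\<eta> * h\<close> is
        reserved for moving the centre from \<open>z s t\<close> to \<open>z (s + h) t\<close>; the
        growth at rate \<beta> is applied to the remaining \<open>(1 - \<eta>) * h\<close>.\<close>
      have 2: "\<forall>\<^sub>F h in at_right 0. ball_max f (z s t) s + \<gamma> * h \<le> ball_max f (z s t) (s + (1 - \<eta>) * h)"
      proof -
        obtain d where d: "d > 0" "\<forall>h>0. h < d \<longrightarrow> ball_max f (z s t) s + \<beta> * h \<le> ball_max f (z s t) (s + h)"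
          using zP(2)[OF sp(1,2)] elim(1) unfolding V_def eventually_at_right_field by blast
        have "ball_max f (z s t) s + \<gamma> * h \<le> ball_max f (z s t) (s + (1 - \<eta>) * h)" if h: "0 < h" "h < d" for h
        proof -
          have "0 < (1 - \<eta>) * h" using h \<eta> by simp
          moreover have "(1 - \<eta>) * h \<le> 1 * h" using h \<eta> by (intro mult_right_mono) auto
          then have "(1 - \<eta>) * h < d" using h by linarith
          ultimately have "ball_max f (z s t) s + \<beta> * ((1 - \<eta>) * h) \<le> ball_max f (z s t) (s + (1 - \<eta>) * h)"
            using d(2) by blast
          then show ?thesis using \<gamma>(1) by (simp only: mult.assoc[symmetric])
        qed
        then show ?thesis using d(1) unfolding eventually_at_right_field by blast
      qed
      from 1 2 eventually_right_small[OF zero_less_one] show ?case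
      proof eventually_elim
        case (elim h)
        have "norm (z (s + h) t - z s t) \<le> (\<Sum>b\<in>Basis. \<bar>(z (s + h) t - z s t) \<bullet> b\<bar>)" by (rule norm_le_l1)
        also have "\<dots> \<le> real DIM('a) * (c * h)" using elim(1) by (intro sum_bounded_above) blast
        also have "\<dots> = \<eta> * h" using c(2) by (simp only: mult.assoc[symmetric])
        finally have n: "norm (z (s + h) t - z s t) \<le> \<eta> * h" .
        have "\<eta> * h \<le> 1 * h" using elim(3) \<eta> by (intro mult_right_mono) auto
        moreover have "(1 - \<eta>) * h = h - \<eta> * h" by (simp add: algebra_simps)
        ultimately have "0 \<le> s + (1 - \<eta>) * h" "s + (1 - \<eta>) * h + norm (z (s + h) t - z s t) \<le> s + h"
          using n sp elim(3) by linarith+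
        then have "ball_max f (z s t) (s + (1 - \<eta>) * h) \<le> ball_max f (z (s + h) t) (s + h)"
          by (rule ball_max_mono[OF f(1)])
        then show ?case using elim(2) by (simp add: u_def)
      qed
    qed
  next
    fix s assume s: "p' < s" "s < q'"
    then have sp: "p < s" "s < q" "0 < s" using pq' pq by auto
    \<comment> \<open>Squeezed between \<open>g (s - t)\<close> and \<open>g (s + t)\<close>, as
      \<open>z s t\<close> is within \<open>t\<close> of \<open>xb\<close>.\<close>
    show "((\<lambda>t. u s t) \<longlongrightarrow> g s) (at_right 0)"
    proof (rule tendstoI)
      fix e :: real assume "e > 0"
      obtain d where d: "0 < d" "\<forall>r'. 0 \<le> r' \<and> \<bar>r' - s\<bar> < d \<longrightarrow> \<bar>g r' - g s\<bar> < e"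
        using ball_max_continuous[OF f(1) less_imp_le[OF sp(3)] \<open>e > 0\<close>, of xb] unfolding g_def by blast
      have "0 < min d s" using d(1) sp(3) by simp
      from eventually_right_small[OF this] show "\<forall>\<^sub>F t in at_right 0. dist (u s t) (g s) < e"
      proof eventually_elim
        case (elim t)
        then have n: "norm (z s t - xb) \<le> t" by (intro zP(1) sp(1,2)) simp
        have "g (s - t) \<le> u s t" unfolding u_def g_def
          using elim n by (intro ball_max_mono[OF f(1)]) auto
        moreover have "u s t \<le> g (s + t)" unfolding u_def g_def
          using n sp by (intro ball_max_mono[OF f(1)]) (auto simp: norm_minus_commute)
        moreover have "\<bar>g (s - t) - g s\<bar> < e" "\<bar>g (s + t) - g s\<bar> < e"
          using elim sp by (auto intro!: d(2)[rule_format])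
        ultimately show ?case by (simp add: dist_real_def)
      qed
    qed
  qed (rule that)
  \<comment> \<open>The upper bound \<alpha> for the slope of \<open>g\<close> is used as a lower
    bound for the slope of \<open>- g\<close>.\<close>
  have "- g a + (- \<alpha>) * (b - a) \<le> - g b"
  proof (rule slope_ge_imp_ge[where F = "\<lambda>s. - g s"])
    show "a \<le> b" using ab' by simp
    fix s assume "a \<le> s" "s < b"
    then have s: "p < s" "s < q" using ab' pq' by auto
    have "definable (\<lambda>h. ball_max f xb s + \<alpha> * h \<le> ball_max f xb (s + h))"
      by (intro definable_intros definable_fun_compose2[OF bm])
    then have "\<forall>\<^sub>F h in at_right 0. \<not> ball_max f xb s + \<alpha> * h \<le> ball_max f xb (s + h)"
      using definable_dichotomy flat[OF s] by blast
    then show "\<forall>\<^sub>F h in at_right 0. - g s + (- \<alpha>) * h \<le> - g (s + h)"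
      unfolding g_def by (rule eventually_mono) simp
  next
    fix s e :: real assume "a < s" "s \<le> b" "e > 0"
    then show "\<forall>\<^sub>F h in at_right 0. - g (s - h) \<le> - g s + e"
      using ab' pq' pq by (intro gcont) auto
  qed
  then have "\<gamma> * (b - a) \<le> \<alpha> * (b - a)" using ab'(4) by simp
  then show False using \<gamma>(2) ab'(2) by simp
qed

section \<open>The moduli of the robust regularization\<close>

text \<open>\<open>L\<close> bounds the right slope of the maximum around \<open>xb\<close> from
  below and the variation with the centre near \<open>xb\<close> from above. Stated with epsilons,
  not through limits superior in the extended reals, the condition is first-order in
  \<open>s\<close> and \<open>L\<close>.\<close>

definition exact_slope :: "('a::euclidean_space \<Rightarrow> real) \<Rightarrow> 'a \<Rightarrow> real \<Rightarrow> real \<Rightarrow> bool" where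
  "exact_slope f xb s L \<longleftrightarrow>
     (\<forall>e. 0 < e \<longrightarrow> (\<forall>\<^sub>F h in at_right 0. ball_max f xb s + (L - e) * h \<le> ball_max f xb (s + h))) \<and>
     (\<forall>e. 0 < e \<longrightarrow> (\<exists>t. 0 < t \<and> (\<forall>x x'. norm (x - xb) \<le> t \<and> norm (x' - xb) \<le> t \<longrightarrow>
        ball_max f x s - ball_max f x' s \<le> (L + e) * norm (x - x'))))"

lemma definable_exact_slope:
  assumes "continuous_on UNIV f" "definable_fun f"
  shows "definable (\<lambda>p. exact_slope f xb (fst p) (snd p))"
  unfolding exact_slope_def
  by (intro definable_intros definable_fun_compose2[OF definable_fun_ball_max[OF assms]])

text \<open>Otherwise at each \<open>s\<close> in the interval the lower right slope is infinite, or
  it is a finite \<open>L\<close> and pairs near \<open>xb\<close> are steeper, with rationals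
  \<open>L < a < b\<close> to witness the gap. These are countably many definable classes, so one of
  them holds on an interval: an infinite slope there would make \<open>g\<close> grow by any amount,
  and a rational gap contradicts \<open>no_steep_interval\<close>.\<close>

lemma exact_slope_dense:
  fixes f :: "'a::euclidean_space \<Rightarrow> real"
  assumes f: "continuous_on UNIV f" "definable_fun f" and pq: "0 \<le> p" "p < q"
  shows "\<exists>s. p < s \<and> s < q \<and> (\<exists>L. exact_slope f xb s L)"
proof (rule ccontr)
  assume no: "\<not> (\<exists>s. p < s \<and> s < q \<and> (\<exists>L. exact_slope f xb s L))"
  note bm = definable_fun_ball_max[OF f]
  define g where "g = ball_max f xb"
  define slope where "slope = (\<lambda>s c. \<forall>\<^sub>F h in at_right 0. g s + c * h \<le> g (s + h))"
  define fast where "fast = (\<lambda>s c. \<forall>t. 0 < t \<longrightarrow> (\<exists>x x'. (norm (x - xb) \<le> t \<and> norm (x' - xb) \<le> t) \<and>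
        c * norm (x - x') < ball_max f x s - ball_max f x' s))"
  have dslope: "definable (\<lambda>p. slope (fst p) (snd p))"
    unfolding slope_def g_def by (intro definable_intros definable_fun_compose2[OF bm])
  have dfast: "definable (\<lambda>p. fast (fst p) (snd p))"
    unfolding fast_def by (intro definable_intros definable_fun_compose2[OF bm])
  define E where "E = (\<lambda>k s. case k of None \<Rightarrow> \<forall>c. slope s c
     | Some (a :: rat, b :: rat) \<Rightarrow> 0 \<le> real_of_rat a \<and> real_of_rat a < real_of_rat b \<and>
        \<not> slope s (real_of_rat a) \<and> fast s (real_of_rat b))"
  have dE: "definable (E k)" for k
  proof (cases k)
    case None
    have "definable (\<lambda>s. \<forall>c. slope s c)" by (intro definable_intros definable_compose2[OF dslope])
    then show ?thesis using None by (simp add: E_def)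
  next
    case (Some ab)
    obtain a b where ab: "ab = (a, b)" by (cases ab)
    have "definable (\<lambda>s. 0 \<le> real_of_rat a \<and> real_of_rat a < real_of_rat b \<and>
        \<not> slope s (real_of_rat a) \<and> fast s (real_of_rat b))"
      by (intro definable_intros definable_compose2[OF dslope] definable_compose2[OF dfast])
    then show ?thesis using Some ab by (simp add: E_def)
  qed
  have cover: "\<exists>k. E k s" if s: "p < s" "s < q" for s
  proof (cases "\<forall>c. slope s c")
    case True
    then show ?thesis by (intro exI[of _ None]) (simp add: E_def)
  next
    case False
    then obtain c0 where c0: "\<not> slope s c0" by blast
    have sp: "0 < s" using s pq by simp
    \<comment> \<open>The candidate \<open>L\<close> is the supremum of the rates reached. Rate 0 is
      always reached because \<open>g\<close> is nondecreasing, so the set is nonempty and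
      \<open>L \<ge> 0\<close>.\<close>
    define C where "C = {c. slope s c}"
    have down: "slope s c" if "slope s c'" "c \<le> c'" for c c'
    proof -
      from that(1) eventually_right_small[OF zero_less_one] show ?thesis unfolding slope_def
      proof eventually_elim
        case (elim h)
        have "c * h \<le> c' * h" using that(2) elim(2) by (intro mult_right_mono) auto
        then show ?case using elim(1) by linarith
      qed
    qed
    have "slope s 0" unfolding slope_def
      using eventually_right_small[OF zero_less_one]
    proof eventually_elim
      case (elim h)
      then show ?case unfolding g_def using sp by (simp add: ball_max_mono[OF f(1)])
    qed
    then have C0: "0 \<in> C" by (simp add: C_def)
    then have ne: "C \<noteq> {}" by blast
    have bdd: "bdd_above C"
    proof (rule bdd_aboveI[of _ c0])
      fix c assume "c \<in> C"
      then show "c \<le> c0" using down[of c c0] c0 by (cases "c \<le> c0") (auto simp: C_def)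
    qed
    define L where "L = Sup C"
    have L0: "0 \<le> L" unfolding L_def by (rule cSup_upper[OF C0 bdd])
    have above: "\<not> slope s c" if "L < c" for c
    proof
      assume "slope s c"
      then have "c \<le> L" unfolding L_def by (intro cSup_upper[OF _ bdd]) (simp add: C_def)
      then show False using that by simp
    qed
    have below: "slope s (L - e)" if "0 < e" for e
    proof -
      have "L - e < Sup C" using that by (simp add: L_def)
      then obtain c where "c \<in> C" "L - e < c" using less_cSupD[OF ne] by blast
      then show ?thesis using down[of c "L - e"] by (simp add: C_def)
    qed
    have "\<not> exact_slope f xb s L" using no s by blast
    then have "\<exists>e>0. \<not> (\<exists>t. 0 < t \<and> (\<forall>x x'. norm (x - xb) \<le> t \<and> norm (x' - xb) \<le> t \<longrightarrow>
        ball_max f x s - ball_max f x' s \<le> (L + e) * norm (x - x')))"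
      using below unfolding exact_slope_def slope_def g_def by blast
    then obtain e where e: "e > 0" "\<forall>t. 0 < t \<longrightarrow> (\<exists>x x'. (norm (x - xb) \<le> t \<and> norm (x' - xb) \<le> t) \<and>
        \<not> ball_max f x s - ball_max f x' s \<le> (L + e) * norm (x - x'))" by blast
    obtain a where a: "L < real_of_rat a" "real_of_rat a < L + e" using of_rat_dense[of L "L + e"] e(1) by auto
    obtain b where b: "real_of_rat a < real_of_rat b" "real_of_rat b < L + e" using of_rat_dense[OF a(2)] by auto
    have "fast s (real_of_rat b)" unfolding fast_def
    proof (intro allI impI)
      fix t :: real assume "0 < t"
      then obtain x x' where x: "norm (x - xb) \<le> t \<and> norm (x' - xb) \<le> t"
        "(L + e) * norm (x - x') < ball_max f x s - ball_max f x' s" using e(2) by (auto simp: not_le)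
      have "real_of_rat b * norm (x - x') \<le> (L + e) * norm (x - x')" using b(2) by (intro mult_right_mono) auto
      then have "real_of_rat b * norm (x - x') < ball_max f x s - ball_max f x' s" using x(2) by linarith
      with x(1) show "\<exists>x x'. (norm (x - xb) \<le> t \<and> norm (x' - xb) \<le> t) \<and>
        real_of_rat b * norm (x - x') < ball_max f x s - ball_max f x' s" by blast
    qed
    moreover have "0 \<le> real_of_rat a" using a(1) L0 by linarith
    moreover have "\<not> slope s (real_of_rat a)" by (rule above[OF a(1)])
    ultimately have "E (Some (a, b)) s" using b(1) by (simp add: E_def)
    then show ?thesis ..
  qed
  obtain k p' q' where k: "p \<le> p'" "p' < q'" "q' \<le> q" "\<forall>s. p' < s \<and> s < q' \<longrightarrow> E k s"
    by (rule definable_cover_interval[OF dE pq(2) cover])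
  show False
  proof (cases k)
    case None
    define a where "a = p' + (q' - p') / 3"
    define b where "b = p' + 2 * (q' - p') / 3"
    have ab: "p' < a" "a < b" "b < q'" using k(2) by (simp_all add: a_def b_def field_simps)
    \<comment> \<open>Every rate is reached here, so one is taken that overshoots
      \<open>g b - g a\<close> by 1.\<close>
    define c where "c = (g b - g a + 1) / (b - a)"
    have "g a + c * (b - a) \<le> g b"
    proof (rule slope_ge_imp_ge)
      show "a \<le> b" using ab by simp
      fix s assume "a \<le> s" "s < b"
      then have "p' < s \<and> s < q'" using ab by auto
      with k(4) have "E None s" using None by blast
      then show "\<forall>\<^sub>F h in at_right 0. g s + c * h \<le> g (s + h)" by (simp add: E_def slope_def)
    next
      fix s e :: real assume s: "a < s" "s \<le> b" "e > 0"
      then have "0 < s" using ab k pq by linarith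
      from eventually_right_small[OF this]
      show "\<forall>\<^sub>F h in at_right 0. g (s - h) \<le> g s + e"
      proof eventually_elim
        case (elim h)
        have "g (s - h) \<le> g s" unfolding g_def using elim by (intro ball_max_mono[OF f(1)]) auto
        then show ?case using s(3) by simp
      qed
    qed
    then show False using ab by (simp add: c_def)
  next
    case (Some r)
    obtain a b where r: "r = (a, b)" by (cases r)
    have E: "0 \<le> real_of_rat a" "real_of_rat a < real_of_rat b" "\<not> slope s (real_of_rat a)" "fast s (real_of_rat b)"
      if "p' < s" "s < q'" for s
    proof -
      have "E (Some (a, b)) s" using k(4) that Some r by blast
      then show "0 \<le> real_of_rat a" "real_of_rat a < real_of_rat b" "\<not> slope s (real_of_rat a)" "fast s (real_of_rat b)"
        by (simp_all add: E_def)
    qed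
    have mid: "p' < (p' + q') / 2" "(p' + q') / 2 < q'" using k(2) by simp_all
    have "0 \<le> p'" using pq k by simp
    show False
    proof (rule no_steep_interval[OF f \<open>0 \<le> p'\<close> k(2) E(1)[OF mid] E(2)[OF mid], of xb])
      show "\<not> (\<forall>\<^sub>F h in at_right 0. ball_max f xb s + real_of_rat a * h \<le> ball_max f xb (s + h))"
        if "p' < s" "s < q'" for s using E(3)[OF that] unfolding slope_def g_def .
      show "\<exists>x x'. norm (x - xb) \<le> t \<and> norm (x' - xb) \<le> t \<and>
          real_of_rat b * norm (x - x') < ball_max f x s - ball_max f x' s"
        if "p' < s" "s < q'" "0 < t" for s t using E(4)[OF that(1,2)] that(3) unfolding fast_def by blast
    qed
  qed
qed

text \<open>Radii with an exact slope are dense near 0, which rules out the negative alternative of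
  the dichotomy.\<close>

lemma exact_slope_eventually:
  assumes f: "continuous_on UNIV f" "definable_fun f"
  shows "\<forall>\<^sub>F s in at_right 0. \<exists>L. exact_slope f xb s L"
proof -
  have "definable (\<lambda>s. \<exists>L. exact_slope f xb s L)" by (intro definable_Ex definable_exact_slope f)
  from definable_dichotomy[OF this] show ?thesis
  proof
    assume "\<forall>\<^sub>F s in at_right 0. \<not> (\<exists>L. exact_slope f xb s L)"
    then obtain d where "d > 0" "\<forall>s>0. s < d \<longrightarrow> \<not> (\<exists>L. exact_slope f xb s L)"
      unfolding eventually_at_right_field by blast
    then show ?thesis using exact_slope_dense[OF f order_refl, of d xb] by blast
  qed
qed

text \<open>If \<open>s * L \<ge> \<delta>\<close> for all small \<open>s\<close>, then between
  \<open>b / 2\<close> and \<open>b\<close> one has \<open>L \<ge> \<delta> / b\<close>, so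
  \<open>g\<close> has slope at least \<open>\<delta> / (2 * b)\<close>, half being given away as
  slack; hence \<open>g\<close> gains \<open>\<delta> / 4\<close> there for every small
  \<open>b\<close>, which continuity of \<open>g\<close> at 0 forbids.\<close>

lemma exact_slope_small:
  assumes f: "continuous_on UNIV f" "definable_fun f" and \<delta>: "0 < \<delta>"
  shows "\<forall>\<^sub>F s in at_right 0. \<forall>L. exact_slope f xb s L \<longrightarrow> s * L < \<delta>"
proof -
  define g where "g = ball_max f xb"
  have "definable (\<lambda>s. \<exists>L. exact_slope f xb s L \<and> \<delta> \<le> s * L)"
    by (intro definable_intros definable_compose2[OF definable_exact_slope[OF f]])
  from definable_dichotomy[OF this] show ?thesis
  proof
    assume "\<forall>\<^sub>F s in at_right 0. \<exists>L. exact_slope f xb s L \<and> \<delta> \<le> s * L"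
    then obtain d where d: "d > 0" "\<forall>s>0. s < d \<longrightarrow> (\<exists>L. exact_slope f xb s L \<and> \<delta> \<le> s * L)"
      unfolding eventually_at_right_field by blast
    have growth: "\<delta> / 4 \<le> g b - g (b / 2)" if b: "0 < b" "b < d" for b
    proof -
      have "g (b / 2) + (\<delta> / (2 * b)) * (b - b / 2) \<le> g b"
      proof (rule slope_ge_imp_ge)
        show "b / 2 \<le> b" using b by simp
        fix s assume s: "b / 2 \<le> s" "s < b"
        then have sp: "0 < s" "s < d" using b by auto
        then obtain L where L: "exact_slope f xb s L" "\<delta> \<le> s * L" using d(2) by blast
        have "0 < L" using L(2) \<delta> sp(1) by (metis less_le_trans zero_less_mult_pos)
        have "\<delta> \<le> b * L" using L(2) mult_right_mono[of s b L] s \<open>0 < L\<close> by linarith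
        then have "\<delta> / (2 * b) \<le> L - \<delta> / (2 * b)" using b by (simp add: field_simps)
        moreover have "\<forall>\<^sub>F h in at_right 0. g s + (L - \<delta> / (2 * b)) * h \<le> g (s + h)"
          using L(1) \<delta> b unfolding exact_slope_def g_def by simp
        ultimately show "\<forall>\<^sub>F h in at_right 0. g s + (\<delta> / (2 * b)) * h \<le> g (s + h)"
        proof -
          assume le: "\<delta> / (2 * b) \<le> L - \<delta> / (2 * b)"
          assume "\<forall>\<^sub>F h in at_right 0. g s + (L - \<delta> / (2 * b)) * h \<le> g (s + h)"
          from this eventually_right_small[OF zero_less_one] show ?thesis
          proof eventually_elim
            case (elim h)
            have "(\<delta> / (2 * b)) * h \<le> (L - \<delta> / (2 * b)) * h" using le elim(2) by (intro mult_right_mono) auto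
            then show ?case using elim(1) by linarith
          qed
        qed
      next
        fix s e :: real assume s: "b / 2 < s" "s \<le> b" "e > 0"
        then have "0 < s" using b by linarith
        from eventually_right_small[OF this]
        show "\<forall>\<^sub>F h in at_right 0. g (s - h) \<le> g s + e"
        proof eventually_elim
          case (elim h)
          have "g (s - h) \<le> g s" unfolding g_def using elim by (intro ball_max_mono[OF f(1)]) auto
          then show ?case using s(3) by simp
        qed
      qed
      moreover have "(\<delta> / (2 * b)) * (b - b / 2) = \<delta> / 4" using b by (simp add: field_simps)
      ultimately show ?thesis by linarith
    qed
    \<comment> \<open>Two values within \<open>\<delta> / 8\<close> of \<open>g 0\<close> differ by
      less than the gain \<open>\<delta> / 4\<close>.\<close>
    have "0 < \<delta> / 8" using \<delta> by simp
    then obtain d' where d': "0 < d'" "\<forall>r'. 0 \<le> r' \<and> \<bar>r' - 0\<bar> < d' \<longrightarrow> \<bar>g r' - g 0\<bar> < \<delta> / 8"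
      using ball_max_continuous[OF f(1) order_refl, of "\<delta> / 8" xb] unfolding g_def by blast
    define b where "b = min d d' / 2"
    have b: "0 < b" "b < d" "b < d'" using d(1) d'(1) by (auto simp: b_def)
    have "\<bar>g b - g 0\<bar> < \<delta> / 8" using spec[OF d'(2), of b] b by simp
    moreover have "\<bar>g (b / 2) - g 0\<bar> < \<delta> / 8" using spec[OF d'(2), of "b / 2"] b by simp
    ultimately show ?thesis using growth[OF b(1,2)] by linarith
  next
    assume "\<forall>\<^sub>F s in at_right 0. \<not> (\<exists>L. exact_slope f xb s L \<and> \<delta> \<le> s * L)"
    then show ?thesis by (rule eventually_mono) (simp add: not_le[symmetric])
  qed
qed

section \<open>The moduli as extended reals\<close>

text \<open>Pairs with second entry \<open>xb\<close> are among those over which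
  \<open>lip_mod\<close> is formed, at the same distance from the base point.\<close>

lemma calm_mod_le_lip_mod: "calm_mod F xb \<le> lip_mod F xb"
proof (rule dense_ge)
  fix C assume "lip_mod F xb < C"
  then have "\<forall>\<^sub>F p in at (xb, xb) within {(x, x'). x \<noteq> x'}.
      (case p of (x, x') \<Rightarrow> ereal (\<bar>F x - F x'\<bar> / norm (x - x'))) < C"
    unfolding lip_mod_def by (rule Limsup_lessD)
  then obtain d where d: "d > 0" "\<forall>p\<in>{(x, x'). x \<noteq> x'}. p \<noteq> (xb, xb) \<and> dist p (xb, xb) < d \<longrightarrow>
      (case p of (x, x') \<Rightarrow> ereal (\<bar>F x - F x'\<bar> / norm (x - x'))) < C"
    unfolding eventually_at by blast
  have "\<forall>\<^sub>F x in at xb. ereal (\<bar>F x - F xb\<bar> / norm (x - xb)) \<le> C"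
    unfolding eventually_at
  proof (intro exI[of _ d] conjI ballI impI)
    fix x assume x: "x \<noteq> xb \<and> dist x xb < d"
    have "(x, xb) \<in> {(x, x'). x \<noteq> x'}" using x by simp
    moreover have "(x, xb) \<noteq> (xb, xb) \<and> dist (x, xb) (xb, xb) < d" using x by (simp add: dist_Pair_Pair)
    ultimately show "ereal (\<bar>F x - F xb\<bar> / norm (x - xb)) \<le> C" using bspec[OF d(2)] by fastforce
  qed (rule d(1))
  then show "calm_mod F xb \<le> C" unfolding calm_mod_def by (rule Limsup_bounded)
qed

text \<open>The second half of \<open>exact_slope\<close> bounds \<open>lip_mod\<close> by
  \<open>L\<close>. For the lower bound, \<open>ball_max_split\<close> turns a growth of the radius
  by \<open>h\<close> into a point \<open>u\<close> within \<open>h\<close> of \<open>xb\<close>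
  with the same value, so the difference quotient at \<open>u\<close> nearly reaches
  \<open>L\<close>.\<close>

lemma exact_slope_moduli:
  fixes f :: "'a::euclidean_space \<Rightarrow> real"
  assumes f: "continuous_on UNIV f" and s: "0 < s" and L: "exact_slope f xb s L"
  shows "lip_mod (robust_reg f s) xb = ereal L" "calm_mod (robust_reg f s) xb = ereal L" "0 \<le> L"
proof -
  let ?F = "robust_reg f s"
  have F: "?F = (\<lambda>x. ball_max f x s)" using s by (simp add: ball_max_def fun_eq_iff)
  have upper: "lip_mod ?F xb \<le> ereal L"
  proof (rule ereal_le_epsilon2)
    fix e :: real assume "0 < e"
    then obtain t where t: "0 < t" "\<forall>x x'. norm (x - xb) \<le> t \<and> norm (x' - xb) \<le> t \<longrightarrow>
        ball_max f x s - ball_max f x' s \<le> (L + e) * norm (x - x')"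
      using L unfolding exact_slope_def by blast
    have "\<forall>\<^sub>F p in at (xb, xb) within {(x, x'). x \<noteq> x'}.
        (case p of (x, x') \<Rightarrow> ereal (\<bar>?F x - ?F x'\<bar> / norm (x - x'))) \<le> ereal (L + e)"
      unfolding eventually_at
    proof (intro exI[of _ t] conjI ballI impI)
      fix p assume p: "p \<in> {(x::'a, x'). x \<noteq> x'}" "p \<noteq> (xb, xb) \<and> dist p (xb, xb) < t"
      obtain x x' where xx: "p = (x, x')" by (cases p)
      have "norm (x - xb) \<le> t" "norm (x' - xb) \<le> t"
        using p(2) dist_fst_le[of p "(xb, xb)"] dist_snd_le[of p "(xb, xb)"] by (simp_all add: xx dist_norm)
      then have "ball_max f x s - ball_max f x' s \<le> (L + e) * norm (x - x')"
        "ball_max f x' s - ball_max f x s \<le> (L + e) * norm (x' - x)" using t(2) by blast+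
      then have "\<bar>?F x - ?F x'\<bar> \<le> (L + e) * norm (x - x')" by (simp add: F norm_minus_commute abs_le_iff)
      moreover have "norm (x - x') > 0" using p(1) xx by simp
      ultimately show "(case p of (x, x') \<Rightarrow> ereal (\<bar>?F x - ?F x'\<bar> / norm (x - x'))) \<le> ereal (L + e)"
        by (simp add: xx divide_le_eq)
    qed (rule t(1))
    then show "lip_mod ?F xb \<le> ereal L + ereal e" unfolding lip_mod_def by (simp add: Limsup_bounded)
  qed
  \<comment> \<open>This makes the intermediate value \<open>m\<close> below positive, so that
    \<open>u\<close> differs from \<open>xb\<close> and
    \<open>m * norm (u - xb) \<le> m * h\<close>.\<close>
  have nonneg: "0 \<le> calm_mod ?F xb"
    unfolding calm_mod_def by (rule le_Limsup) (simp_all add: eventually_at_filter)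
  have lower: "ereal L \<le> calm_mod ?F xb"
  proof (rule ccontr)
    assume "\<not> ereal L \<le> calm_mod ?F xb"
    then have "calm_mod ?F xb < ereal L" by simp
    then obtain m where m: "calm_mod ?F xb < ereal m" "ereal m < ereal L" using ereal_dense2 by blast
    have m0: "0 < m" using nonneg m(1) by (metis ereal_less(2) le_less_trans)
    from m(1) have "\<forall>\<^sub>F x in at xb. ereal (\<bar>?F x - ?F xb\<bar> / norm (x - xb)) < ereal m"
      unfolding calm_mod_def by (rule Limsup_lessD)
    then obtain d where d: "d > 0" "\<forall>x. x \<noteq> xb \<and> dist x xb < d \<longrightarrow> \<bar>?F x - ?F xb\<bar> / norm (x - xb) < m"
      unfolding eventually_at by auto
    have "0 < L - m" using m(2) by simp
    then have "\<forall>\<^sub>F h in at_right 0. ball_max f xb s + (L - (L - m)) * h \<le> ball_max f xb (s + h)"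
      using L unfolding exact_slope_def by blast
    from eventually_conj[OF this eventually_right_small[OF d(1)]]
    obtain h where h: "ball_max f xb s + m * h \<le> ball_max f xb (s + h)" "0 < h" "h < d"
      using eventually_happens[of _ "at_right (0::real)"] by force
    obtain u where u: "norm (u - xb) \<le> h" "ball_max f u s = ball_max f xb (s + h)"
      using h(2) s by (rule_tac ball_max_split[OF f, of s h xb]) auto
    have gain: "m * h \<le> ?F u - ?F xb" using h(1) u(2) by (simp add: F)
    have mh: "0 < m * h" using m0 h(2) by simp
    have "u \<noteq> xb" using gain mh by auto
    then have "\<bar>?F u - ?F xb\<bar> / norm (u - xb) < m" using d(2) u(1) h(3) by (simp add: dist_norm)
    then have "\<bar>?F u - ?F xb\<bar> < m * norm (u - xb)" using \<open>u \<noteq> xb\<close> by (simp add: divide_less_eq)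
    also have "\<dots> \<le> m * h" using m0 u(1) by (intro mult_left_mono) auto
    finally show False using gain by simp
  qed
  have le: "calm_mod ?F xb \<le> lip_mod ?F xb" by (rule calm_mod_le_lip_mod)
  show 1: "calm_mod ?F xb = ereal L" using upper lower le by (meson order_antisym order_trans)
  show "lip_mod ?F xb = ereal L" using upper lower le by (meson order_antisym order_trans)
  show "0 \<le> L" using nonneg 1 by simp
qed

theorem theorem5p3:
  fixes f :: "real ^ 'n \<Rightarrow> real" and xb :: "real ^ 'n"
  assumes "continuous_on UNIV f" and "semialgebraic_fun f"
  shows "\<exists>eb>0.
     (\<forall>eps. 0 < eps \<and> eps \<le> eb \<longrightarrow>
        lipschitz_at (robust_reg f eps) xb \<and>
        calm_mod (robust_reg f eps) xb = lip_mod (robust_reg f eps) xb \<and>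
        lip_mod (robust_reg f eps) xb < \<infinity>) \<and>
     ((\<lambda>eps. ereal eps * lip_mod (robust_reg f eps) xb) \<longlongrightarrow> 0) (at_right 0)"
proof -
  have f: "continuous_on UNIV f" "definable_fun f"
    using assms semialgebraic_fun_imp_definable_fun by blast+
  obtain d where d: "d > 0" "\<forall>s>0. s < d \<longrightarrow> (\<exists>L. exact_slope f xb s L)"
    using exact_slope_eventually[OF f, of xb] unfolding eventually_at_right_field by blast
  \<comment> \<open>Half of \<open>d\<close>, because the bound on \<open>eps\<close> may be
    attained while exact slopes are known only for radii below \<open>d\<close>.\<close>
  have regular: "lipschitz_at (robust_reg f s) xb \<and> calm_mod (robust_reg f s) xb = lip_mod (robust_reg f s) xb \<and>
      lip_mod (robust_reg f s) xb < \<infinity>" if "0 < s \<and> s \<le> d / 2" for s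
  proof -
    have s: "0 < s" "s < d" using that d(1) by auto
    then obtain L where "exact_slope f xb s L" using d(2) by blast
    from exact_slope_moduli[OF f(1) s(1) this] show ?thesis by (simp add: lipschitz_at_def)
  qed
  \<comment> \<open>Convergence is shown in the reals; for small radii the modulus is finite, so
    \<open>l\<close> loses nothing there.\<close>
  define l where "l = (\<lambda>s. real_of_ereal (lip_mod (robust_reg f s) xb))"
  have "((\<lambda>s. s * l s) \<longlongrightarrow> 0) (at_right 0)"
  proof (rule tendstoI)
    fix \<delta> :: real assume "0 < \<delta>"
    from exact_slope_eventually[OF f, of xb] exact_slope_small[OF f this, of xb] eventually_right_small[OF zero_less_one]
    show "\<forall>\<^sub>F s in at_right 0. dist (s * l s) 0 < \<delta>"
    proof eventually_elim
      case (elim s)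
      then obtain L where L: "exact_slope f xb s L" by blast
      from exact_slope_moduli[OF f(1) _ L] elim(3) have "l s = L" "0 \<le> L" by (simp_all add: l_def)
      moreover have "s * L < \<delta>" using elim(2) L by blast
      ultimately show ?case using elim(3) by (simp add: dist_real_def)
    qed
  qed
  then have "((\<lambda>s. ereal (s * l s)) \<longlongrightarrow> ereal 0) (at_right 0)" by (rule tendsto_ereal)
  moreover have "\<forall>\<^sub>F s in at_right 0. ereal (s * l s) = ereal s * lip_mod (robust_reg f s) xb"
    using exact_slope_eventually[OF f, of xb] eventually_right_small[OF zero_less_one]
  proof eventually_elim
    case (elim s)
    then obtain L where L: "exact_slope f xb s L" by blast
    from exact_slope_moduli(1)[OF f(1) _ L] elim(2) show ?case by (simp add: l_def)
  qed
  ultimately have "((\<lambda>s. ereal s * lip_mod (robust_reg f s) xb) \<longlongrightarrow> 0) (at_right 0)"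
    using Lim_transform_eventually by (fastforce simp: zero_ereal_def)
  moreover have "0 < d / 2" using d(1) by simp
  ultimately show ?thesis using regular by blast
qed

end
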